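(* Let $d\geq 1$ be an integer, let $r$ be a prime power, let $k\geq\lceil d\,\tfrac{r-1}{r}\rceil+1$ be an integer, and let $N=(d+k+1)(r-1)$. Let $f:\Delta_N\rightarrow\mathbb{R}^d$ be a continuous map. If the vertices of $\Delta_N$ are colored by $k$ colors, where each color class has cardinality at most $2r-1$, then there are $r$ pairwise disjoint rainbow faces $\sigma_1,\ldots,\sigma_r$ of $\Delta_N$ with $f(\sigma_1)\cap\cdots\cap f(\sigma_r)\neq\emptyset$.
   Context: $\Delta_N$ is the standard $N$-simplex. A coloring of the vertex set by $k$ colors is a partition of the vertex set into $k$ pairwise disjoint color classes $C_1,\ldots,C_k$; a face $\sigma$ is rainbow if $|\sigma\cap C_i|\leq 1$ for every $i$. *)

theory Defs
  imports
    "HOL-Homology.Homology"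
    "HOL-Number_Theory.Prime_Powers"
begin

text \<open>
  The simplex \<open>\<Delta>\<^sub>N\<close> is \<^const>\<open>standard_simplex\<close>, with the topology inherited from
  \<^term>\<open>powertop_real UNIV\<close>. Its vertex set is \<^term>\<open>{..N}\<close>, the index \<open>i\<close> standing for the
  \<open>i\<close>-th unit vector, and a face is named by its set of vertices: two faces of a simplex are
  disjoint as sets of points iff their vertex sets are disjoint.
\<close>

text \<open>The points of the face of \<open>\<Delta>\<^sub>N\<close> with vertex set \<open>S\<close>.\<close>

definition simplex_face :: "nat \<Rightarrow> nat set \<Rightarrow> (nat \<Rightarrow> real) set" where
  "simplex_face N S = {x \<in> standard_simplex N. \<forall>i. i \<notin> S \<longrightarrow> x i = 0}"

text \<open>Color classes are allowed to be empty, so not all \<open>k\<close> colors have to be used.\<close>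

definition coloring :: "nat set \<Rightarrow> nat \<Rightarrow> (nat \<Rightarrow> nat set) \<Rightarrow> bool" where
  "coloring V k C \<longleftrightarrow> disjoint_family_on C {1..k} \<and> (\<Union>i\<in>{1..k}. C i) = V"

definition rainbow :: "nat \<Rightarrow> (nat \<Rightarrow> nat set) \<Rightarrow> nat set \<Rightarrow> bool" where
  "rainbow k C \<sigma> \<longleftrightarrow> (\<forall>i\<in>{1..k}. card (\<sigma> \<inter> C i) \<le> 1)"

end

(*
The theorem follows from the topological Tverberg theorem for prime powers by the constraint method:
add to f, for each color class C i, the coordinate sum of x u * x v over u ~= v in C i. A Tverberg
point of the enlarged map has equal coordinates on all r faces, and since card (C i) < 2 r some face
has at most one vertex in C i; there the i-th new coordinate vanishes, hence it vanishes on all faces,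
which are therefore rainbow.

Topological Tverberg for r = p^n is proved with the group G = (Z_p)^n acting on the r faces. A point of
the deleted join is a point t of the simplex together with a labelling A of the vertices by G. If no
Tverberg point exists, then every t carries, for each of the B = d + k + 1 target coordinates, an
equivariant label in G (a face on which the coordinate is maximal), and on a small simplex some
coordinate omits a label. The cocycle on r labels given by the product of the differences of labels
vanishes when a label is omitted; so the B-fold cup product of this cocycle vanishes on iterated
subdivisions, and its value at A is mod p an equivariant coboundary. This is refuted by pairing with an
explicit cycle of (Z_p)^n: a signed sum over shuffles of n paths in Z_p. In the pairing a shuffle only
contributes if its path visits all of G in every block of r rows, which forces it to move like an
odometer, and the remaining sum is a product of Vandermonde determinants, a unit mod p.
*)
theory Submission
  imports Defs "HOL-Number_Theory.Residues" "HOL-Computational_Algebra.Polynomial"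
begin

section \<open>Products over pairs and alternating cochains\<close>

text \<open>To refute that the Euler cochain is an equivariant coboundary, a single chain suffices:
  a cycle modulo \<open>p\<close> and the action, on which the cochain is a unit. Two demands shape
  its weights. Where a path goes straight through a row, no other word offers a face to cancel with,
  so the sum over the value at that row has to vanish by itself; a weight of degree
  \<open>p - 2\<close> in each value achieves this, since power sums of exponent below
  \<open>p - 1\<close> are \<open>0\<close> mod \<open>p\<close>. And the surviving terms must not
  cancel each other: the Vandermonde product of a run, times the Vandermonde product that the Euler
  cochain contributes for the same line, is one and the same unit for every order of the values. The
  step counts are exactly those of an odometer in base \<open>p\<close>, once per block; they leave
  no slack, which is why a single word survives.

  Of the \<open>B = d + k + 1\<close> target coordinates, \<open>d + k\<close> carry the functions
  to be equalised. The additional one is the mass that a face receives from \<open>t\<close>: only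
  when the masses agree can the other coordinates be read as values at points of the
  simplex.\<close>

definition pairs :: "nat \<Rightarrow> (nat \<times> nat) set" where
  "pairs m = {(i, j). i < j \<and> j < m}"

definition pairprod :: "('a \<Rightarrow> 'a \<Rightarrow> int) \<Rightarrow> nat \<Rightarrow> (nat \<Rightarrow> 'a) \<Rightarrow> int" where
  "pairprod F m g = (\<Prod>(i, j)\<in>pairs m. F (g i) (g j))"

text \<open>The coface map that misses \<open>k\<close>: composing a sequence with it deletes entry
  \<open>k\<close>.\<close>

definition skip :: "nat \<Rightarrow> nat \<Rightarrow> nat" where
  "skip k i = (if i < k then i else Suc i)"

lemma finite_pairs [simp]: "finite (pairs m)"
  by (rule finite_subset[of _ "{..<m} \<times> {..<m}"]) (auto simp: pairs_def)

lemma pairprod_cong: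
  assumes "\<And>i. i < m \<Longrightarrow> g i = h i"
  shows "pairprod F m g = pairprod F m h"
  unfolding pairprod_def by (rule prod.cong) (auto simp: pairs_def assms)

lemma pairprod_cong_mod:
  assumes "\<And>i j. \<lbrakk>i < j; j < m\<rbrakk> \<Longrightarrow> [F (g i) (g j) = F' (h i) (h j)] (mod P)"
  shows "[pairprod F m g = pairprod F' m h] (mod P)"
  unfolding pairprod_def by (rule cong_prod) (auto simp: pairs_def assms)

lemma pairprod_eq_0:
  assumes "a < b" "b < m" "F (g a) (g b) = 0"
  shows "pairprod F m g = 0"
  unfolding pairprod_def
  by (rule prod_zero[OF finite_pairs]) (use assms in \<open>auto simp: pairs_def intro!: bexI[of _ "(a, b)"]\<close>)

lemma skip_inj: "skip k i = skip k j \<longleftrightarrow> i = j"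
  by (auto simp: skip_def split: if_splits)

lemma skip_less: "skip k i < skip k j \<longleftrightarrow> i < j"
  by (auto simp: skip_def split: if_splits)

lemma skip_neq [simp]: "skip k i \<noteq> k"
  by (auto simp: skip_def split: if_splits)

lemma ex_skip:
  assumes "i \<noteq> k"
  obtains i' where "skip k i' = i"
proof (cases "i < k")
  case True then show thesis using that[of i] by (simp add: skip_def)
next
  case False then show thesis using that[of "i - 1"] assms by (simp add: skip_def)
qed

lemma skip_less_Suc: "k \<le> m \<Longrightarrow> skip k i < Suc m \<longleftrightarrow> i < m"
  by (auto simp: skip_def split: if_splits)

lemma bij_betw_skip:
  assumes "k \<le> m"
  shows "bij_betw (skip k) {..<m} ({..m} - {k})"
proof (intro bij_betw_imageI)
  show "inj_on (skip k) {..<m}" by (auto simp: inj_on_def skip_inj)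
  show "skip k ` {..<m} = {..m} - {k}"
  proof (intro Set.set_eqI iffI)
    fix i assume i: "i \<in> {..m} - {k}"
    then obtain i' where "skip k i' = i" using ex_skip[of i k] by auto
    then show "i \<in> skip k ` {..<m}"
      using i skip_less_Suc[OF assms, of i'] by auto
  next
    fix i assume "i \<in> skip k ` {..<m}"
    then obtain i' where "i' < m" "i = skip k i'" by auto
    then show "i \<in> {..m} - {k}" using skip_less_Suc[OF assms, of i'] by simp
  qed
qed

lemma bij_betw_skip_pairs:
  assumes "k \<le> m"
  shows "bij_betw (map_prod (skip k) (skip k)) (pairs m) {(i, j). (i, j) \<in> pairs (Suc m) \<and> i \<noteq> k \<and> j \<noteq> k}"
proof (intro bij_betw_imageI)
  show "inj_on (map_prod (skip k) (skip k)) (pairs m)" by (auto simp: inj_on_def skip_inj)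
  show "map_prod (skip k) (skip k) ` pairs m = {(i, j). (i, j) \<in> pairs (Suc m) \<and> i \<noteq> k \<and> j \<noteq> k}"
  proof (intro Set.set_eqI iffI)
    fix x assume "x \<in> {(i, j). (i, j) \<in> pairs (Suc m) \<and> i \<noteq> k \<and> j \<noteq> k}"
    then obtain i j where x: "x = (i, j)" and ij: "(i, j) \<in> pairs (Suc m)" "i \<noteq> k" "j \<noteq> k" by auto
    obtain i' where i': "skip k i' = i" using ex_skip[OF ij(2)] .
    obtain j' where j': "skip k j' = j" using ex_skip[OF ij(3)] .
    have "(i', j') \<in> pairs m"
      using ij i' j' skip_less_Suc[OF assms, of j'] skip_less[of k i' j'] by (auto simp: pairs_def)
    then show "x \<in> map_prod (skip k) (skip k) ` pairs m"
      unfolding x using i' j' by (metis image_eqI map_prod_simp)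
  next
    fix x assume "x \<in> map_prod (skip k) (skip k) ` pairs m"
    then show "x \<in> {(i, j). (i, j) \<in> pairs (Suc m) \<and> i \<noteq> k \<and> j \<noteq> k}"
      using assms by (auto simp: pairs_def skip_less skip_less_Suc)
  qed
qed

text \<open>Isolates the dependence on entry \<open>d\<close>. The case distinction keeps the
  smaller index in the first argument, since \<open>F\<close> need not be symmetric.\<close>

lemma pairprod_remove:
  assumes "d \<le> m"
  shows "pairprod F (Suc m) g = pairprod F m (g \<circ> skip d) *
    (\<Prod>i\<in>{..m} - {d}. if i < d then F (g i) (g d) else F (g d) (g i))"
proof -
  let ?A = "{(i, j). (i, j) \<in> pairs (Suc m) \<and> i \<noteq> d \<and> j \<noteq> d}"
  let ?w = "\<lambda>i. if i < d then (i, d) else (d, i)"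
  have eq: "pairs (Suc m) = ?A \<union> ?w ` ({..m} - {d})"
  proof (intro Set.set_eqI iffI)
    fix x assume x: "x \<in> pairs (Suc m)"
    obtain i j where [simp]: "x = (i, j)" by (cases x)
    have ij: "i < j" "j < Suc m" using x by (auto simp: pairs_def)
    consider "i = d" | "j = d" | "i \<noteq> d" "j \<noteq> d" by blast
    then show "x \<in> ?A \<union> ?w ` ({..m} - {d})"
    proof cases
      case 1 then show ?thesis using ij by (intro UnI2 image_eqI[of _ _ j]) auto
    next
      case 2 then show ?thesis using ij by (intro UnI2 image_eqI[of _ _ i]) auto
    next
      case 3 then show ?thesis using x by simp
    qed
  next
    fix x assume "x \<in> ?A \<union> ?w ` ({..m} - {d})"
    then show "x \<in> pairs (Suc m)" using assms by (auto simp: pairs_def)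
  qed
  have "pairprod F (Suc m) g = (\<Prod>(i, j)\<in>?A \<union> ?w ` ({..m} - {d}). F (g i) (g j))"
    unfolding pairprod_def by (subst eq) simp
  also have "\<dots> = (\<Prod>(i, j)\<in>?A. F (g i) (g j)) * (\<Prod>(i, j)\<in>?w ` ({..m} - {d}). F (g i) (g j))"
    by (rule prod.union_disjoint)
      (auto intro: finite_subset[OF _ finite_pairs[of "Suc m"]] split: if_splits)
  also have "(\<Prod>(i, j)\<in>?A. F (g i) (g j)) = pairprod F m (g \<circ> skip d)"
    unfolding pairprod_def
    by (subst prod.reindex_bij_betw[OF bij_betw_skip_pairs[OF assms], symmetric])
      (simp add: case_prod_beta)
  also have "(\<Prod>(i, j)\<in>?w ` ({..m} - {d}). F (g i) (g j)) =
      (\<Prod>i\<in>{..m} - {d}. if i < d then F (g i) (g d) else F (g d) (g i))"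
    by (subst prod.reindex) (auto simp: inj_on_def intro!: prod.cong split: if_splits)
  finally show ?thesis .
qed

text \<open>Apart from the pair \<open>(i, Suc i)\<close> itself, a swap of neighbours permutes the
  pairs without reversing any. The two remaining factors are multiplied crosswise because they
  cannot be divided by.\<close>

lemma pairprod_transpose:
  assumes "Suc i < m"
  shows "pairprod F m (g \<circ> Transposition.transpose i (Suc i)) * F (g i) (g (Suc i)) =
         pairprod F m g * F (g (Suc i)) (g i)"
proof -
  let ?T = "Transposition.transpose i (Suc i)" and ?R = "pairs m - {(i, Suc i)}"
  have mem: "(i, Suc i) \<in> pairs m" using assms by (auto simp: pairs_def)
  have split: "pairprod F m h = F (h i) (h (Suc i)) * (\<Prod>(a, b)\<in>?R. F (h a) (h b))" for h
    unfolding pairprod_def by (subst prod.remove[OF finite_pairs mem]) simp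
  have T: "map_prod ?T ?T x \<in> ?R" if "x \<in> ?R" for x
    using that assms unfolding pairs_def Transposition.transpose_def
    by (cases x) (simp split: if_splits, (linarith | simp)+)
  have "bij_betw (map_prod ?T ?T) ?R ?R"
  proof (rule bij_betw_byWitness[where f' = "map_prod ?T ?T"])
    have "map_prod ?T ?T (map_prod ?T ?T x) = x" for x by (cases x) simp
    then show "\<forall>x\<in>?R. map_prod ?T ?T (map_prod ?T ?T x) = x"
      "\<forall>x\<in>?R. map_prod ?T ?T (map_prod ?T ?T x) = x" by blast+
    show "map_prod ?T ?T ` ?R \<subseteq> ?R" "map_prod ?T ?T ` ?R \<subseteq> ?R" by (intro image_subsetI T; assumption)+
  qed
  then have "(\<Prod>x\<in>?R. case map_prod ?T ?T x of (a, b) \<Rightarrow> F (g a) (g b)) = (\<Prod>(a, b)\<in>?R. F (g a) (g b))"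
    by (rule prod.reindex_bij_betw)
  then have "(\<Prod>(a, b)\<in>?R. F ((g \<circ> ?T) a) ((g \<circ> ?T) b)) = (\<Prod>(a, b)\<in>?R. F (g a) (g b))"
    by (simp add: case_prod_beta)
  then show ?thesis unfolding split[of "g \<circ> ?T"] split[of g] by simp
qed

text \<open>A face that keeps both equal entries has a factor \<open>F x x = 0\<close>, so only the
  faces without \<open>a\<close> or without \<open>b\<close> remain. They hold the same entries and
  differ by moving one of them past \<open>b - a - 1\<close> others; this sign offsets
  \<open>(-1) ^ a\<close> against \<open>(-1) ^ b\<close>. That \<open>F x x = 0\<close> is a
  separate premise, since antisymmetry modulo 2 does not imply it.\<close>

lemma alternating_coboundary:
  assumes anti: "\<And>x y. [F y x = - F x y] (mod P)"
    and nul: "\<And>x. F x x = 0"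
    and ab: "a < b" "b \<le> m" and eq: "g a = g b"
  shows "[(\<Sum>k\<le>m. (- 1) ^ k * pairprod F m (g \<circ> skip k)) = 0] (mod P)"
proof -
  have zero: "pairprod F m (g \<circ> skip k) = 0" if k: "k \<le> m" "k \<noteq> a" "k \<noteq> b" for k
  proof -
    obtain i where i: "skip k i = a" by (rule ex_skip[OF k(2)[symmetric]])
    obtain j where j: "skip k j = b" by (rule ex_skip[OF k(3)[symmetric]])
    have "i < j" "j < m"
      using iffD1[OF skip_less[of k i j, unfolded i j] ab(1)]
        iffD1[OF skip_less_Suc[OF k(1), of j, unfolded j]] ab(2) by simp_all
    then show ?thesis by (rule pairprod_eq_0) (simp add: i j eq nul)
  qed
  obtain m' where m: "m = Suc m'" using ab by (cases m) auto
  obtain b' where b: "b = Suc b'" using ab by (cases b) auto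
  have le: "a \<le> b'" "b' \<le> m'" "a \<le> m'" using ab m b by auto
  \<comment> \<open>\<open>b'\<close> is the position of \<open>b\<close> once entry
    \<open>a\<close> is gone, whereas \<open>a < b\<close> keeps its position when \<open>b\<close>
    goes; both orders of deletion leave the same sequence.\<close>
  have ss: "skip a \<circ> skip b' = skip b \<circ> skip a" using le b by (auto simp: skip_def fun_eq_iff)
  let ?I = "{..m} - {a} - {b}"
  let ?wb = "\<lambda>i. if i < a then F (g i) (g a) else F (g a) (g i)"
  let ?wa = "\<lambda>i. if i < b then F (g i) (g a) else F (g a) (g i)"
  let ?R = "pairprod F m' (g \<circ> skip b \<circ> skip a)"
  have imb: "skip b ` ({..m'} - {a}) = ?I"
  proof -
    have "skip b ` ({..m'} - {a}) = skip b ` {..<m} - skip b ` {a}"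
      unfolding m lessThan_Suc_atMost by (rule image_set_diff) (auto simp: inj_def skip_inj)
    also have "skip b ` {..<m} = {..m} - {b}" using bij_betw_skip[OF ab(2)] by (simp add: bij_betw_def)
    also have "skip b ` {a} = {a}" using ab by (simp add: skip_def)
    finally show ?thesis by auto
  qed
  have ima: "skip a ` ({..m'} - {b'}) = ?I"
  proof -
    have "skip a ` ({..m'} - {b'}) = skip a ` {..<m} - skip a ` {b'}"
      unfolding m lessThan_Suc_atMost by (rule image_set_diff) (auto simp: inj_def skip_inj)
    also have "skip a ` {..<m} = {..m} - {a}"
      using bij_betw_skip[of a m] le m by (simp add: bij_betw_def)
    also have "skip a ` {b'} = {b}" using le b by (simp add: skip_def)
    finally show ?thesis by auto
  qed
  have "skip b a = a" "skip b i < a \<longleftrightarrow> i < a" for i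
    using ab(1) by (auto simp: skip_def)
  then have "(\<Prod>i\<in>{..m'} - {a}. if i < a then F ((g \<circ> skip b) i) ((g \<circ> skip b) a)
      else F ((g \<circ> skip b) a) ((g \<circ> skip b) i)) = (\<Prod>i\<in>?I. ?wb i)"
    unfolding imb[symmetric] by (subst prod.reindex) (simp_all add: inj_on_def skip_inj cong: prod.cong if_cong)
  then have Qb: "pairprod F m (g \<circ> skip b) = ?R * (\<Prod>i\<in>?I. ?wb i)"
    unfolding m pairprod_remove[OF le(3)] by simp
  have "skip a b' = b" "skip a i < b \<longleftrightarrow> i < b'" for i
    using le b by (auto simp: skip_def)
  then have "(\<Prod>i\<in>{..m'} - {b'}. if i < b' then F ((g \<circ> skip a) i) ((g \<circ> skip a) b')
      else F ((g \<circ> skip a) b') ((g \<circ> skip a) i)) = (\<Prod>i\<in>?I. ?wa i)"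
    unfolding ima[symmetric] by (subst prod.reindex) (simp_all add: inj_on_def skip_inj eq cong: prod.cong if_cong)
  then have Qa: "pairprod F m (g \<circ> skip a) = ?R * (\<Prod>i\<in>?I. ?wa i)"
    unfolding m pairprod_remove[OF le(2)] by (simp add: o_assoc[symmetric] ss)
  have "[(\<Prod>i\<in>?I. ?wa i) = (\<Prod>i\<in>?I. ?wb i * (if a < i \<and> i < b then - 1 else 1))] (mod P)"
    by (rule cong_prod) (use anti[of "g _" "g a"] ab in \<open>auto intro: cong_refl\<close>)
  also have "(\<Prod>i\<in>?I. ?wb i * (if a < i \<and> i < b then - 1 else 1)) =
      (\<Prod>i\<in>?I. ?wb i) * (\<Prod>i\<in>?I. if a < i \<and> i < b then - 1 else 1)"
    by (rule prod.distrib)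
  also have "(\<Prod>i\<in>?I. if a < i \<and> i < b then - 1 else 1 :: int) = (\<Prod>i\<in>{a<..<b}. - 1)"
    by (rule prod.mono_neutral_cong_right) (use ab in auto)
  also have "\<dots> = (- 1) ^ (b' - a)" by (simp add: b)
  finally have Q: "[pairprod F m (g \<circ> skip a) = pairprod F m (g \<circ> skip b) * (- 1) ^ (b' - a)] (mod P)"
    unfolding Qa Qb using cong_scalar_left[of _ _ P ?R] by (simp add: mult.assoc)
  have "(\<Sum>k\<le>m. (- 1) ^ k * pairprod F m (g \<circ> skip k)) =
      (\<Sum>k\<in>{a, b}. (- 1) ^ k * pairprod F m (g \<circ> skip k))"
    by (rule sum.mono_neutral_right) (use ab zero in auto)
  also have "\<dots> = (- 1) ^ a * pairprod F m (g \<circ> skip a) + (- 1) ^ b * pairprod F m (g \<circ> skip b)"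
    using ab by simp
  also have "[\<dots> = (- 1) ^ a * (pairprod F m (g \<circ> skip b) * (- 1) ^ (b' - a)) + (- 1) ^ b * pairprod F m (g \<circ> skip b)] (mod P)"
    by (intro cong_add cong_scalar_left Q cong_refl)
  also have "(- 1) ^ a * (pairprod F m (g \<circ> skip b) * (- 1) ^ (b' - a)) =
      pairprod F m (g \<circ> skip b) * ((- 1) ^ a * (- 1) ^ (b' - a))" by simp
  also have "(- 1) ^ a * (- 1) ^ (b' - a) = ((- 1) ^ b' :: int)"
    using le by (simp flip: power_add)
  finally show ?thesis by (simp add: b comp_def)
qed

text \<open>A cochain of degree \<open>m\<close> is a function of sequences that only reads the entries \<open>0..m\<close>; this is the
  Leibniz rule for the cup product \<open>f x * h (\<lambda>i. x (m + i))\<close>.\<close>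

lemma coboundary_cup:
  fixes f h :: "(nat \<Rightarrow> 'a) \<Rightarrow> int"
  assumes f: "\<And>x y. (\<And>i. i \<le> m \<Longrightarrow> x i = y i) \<Longrightarrow> f x = f y"
    and df: "[(\<Sum>k\<le>Suc m. (- 1) ^ k * f (x \<circ> skip k)) = 0] (mod P)"
    and dh: "[(\<Sum>k\<le>Suc l. (- 1) ^ k * h ((\<lambda>i. x (m + i)) \<circ> skip k)) = 0] (mod P)"
  shows "[(\<Sum>k\<le>Suc (m + l). (- 1) ^ k * (f (x \<circ> skip k) * h (\<lambda>i. x (skip k (m + i))))) = 0] (mod P)"
proof -
  let ?t = "\<lambda>k. (- 1) ^ k * (f (x \<circ> skip k) * h (\<lambda>i. x (skip k (m + i))))"
  have lo: "?t k = (- 1) ^ k * f (x \<circ> skip k) * h (\<lambda>i. x (Suc (m + i)))" if "k \<le> m" for k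
  proof -
    have "(\<lambda>i. x (skip k (m + i))) = (\<lambda>i. x (Suc (m + i)))" using that by (auto simp: skip_def)
    then show ?thesis by (simp only: mult.assoc)
  qed
  have hi: "?t (m + k) = (- 1) ^ m * f x * ((- 1) ^ k * h ((\<lambda>i. x (m + i)) \<circ> skip k))" if "1 \<le> k" for k
  proof -
    have "f (x \<circ> skip (m + k)) = f x" by (rule f) (use that in \<open>auto simp: skip_def\<close>)
    moreover have "(\<lambda>i. x (skip (m + k) (m + i))) = (\<lambda>i. x (m + i)) \<circ> skip k"
      by (auto simp: skip_def fun_eq_iff)
    ultimately show ?thesis by (simp add: power_add)
  qed
  have "{..Suc (m + l)} = {..m} \<union> {m + 1..m + Suc l}" by auto
  also have "{m + 1..m + Suc l} = (+) m ` {1..Suc l}" by (subst image_add_atLeastAtMost) (simp only: add.commute)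
  finally have "{..Suc (m + l)} = {..m} \<union> (+) m ` {1..Suc l}" .
  then have "(\<Sum>k\<le>Suc (m + l). ?t k) = (\<Sum>k\<in>{..m} \<union> (+) m ` {1..Suc l}. ?t k)" by simp
  also have "\<dots> = (\<Sum>k\<le>m. ?t k) + (\<Sum>k\<in>(+) m ` {1..Suc l}. ?t k)"
    by (rule sum.union_disjoint) auto
  also have "(\<Sum>k\<in>(+) m ` {1..Suc l}. ?t k) = (\<Sum>k=1..Suc l. ?t (m + k))"
    by (subst sum.reindex) auto
  also have "\<dots> = (\<Sum>k=1..Suc l. (- 1) ^ m * f x * ((- 1) ^ k * h ((\<lambda>i. x (m + i)) \<circ> skip k)))"
    by (intro sum.cong hi) auto
  also have "\<dots> = (- 1) ^ m * f x * (\<Sum>k=1..Suc l. (- 1) ^ k * h ((\<lambda>i. x (m + i)) \<circ> skip k))"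
    by (rule sum_distrib_left[symmetric])
  also have "(\<Sum>k\<le>m. ?t k) = (\<Sum>k\<le>m. (- 1) ^ k * f (x \<circ> skip k)) * h (\<lambda>i. x (Suc (m + i)))"
    unfolding sum_distrib_right by (intro sum.cong lo) auto
  also have "(\<Sum>k\<le>m. (- 1) ^ k * f (x \<circ> skip k)) =
      (\<Sum>k\<le>Suc m. (- 1) ^ k * f (x \<circ> skip k)) + (- 1) ^ m * f x"
  proof -
    have "f (x \<circ> skip (Suc m)) = f x" by (rule f) (auto simp: skip_def)
    then show ?thesis by simp
  qed
  also have "(\<Sum>k=1..Suc l. (- 1) ^ k * h ((\<lambda>i. x (m + i)) \<circ> skip k)) =
      (\<Sum>k\<le>Suc l. (- 1) ^ k * h ((\<lambda>i. x (m + i)) \<circ> skip k)) - h (\<lambda>i. x (Suc (m + i)))"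
  proof -
    have "{..Suc l} = insert 0 {1..Suc l}" by auto
    moreover have "(\<lambda>i. x (m + i)) \<circ> skip 0 = (\<lambda>i. x (Suc (m + i)))" by (auto simp: skip_def)
    ultimately show ?thesis by simp
  qed
  \<comment> \<open>The surplus \<open>(- 1) ^ m * f x\<close> of the first sum and the missing term
    \<open>k = 0\<close> of the second one yield the same product with opposite signs.\<close>
  finally have eq: "(\<Sum>k\<le>Suc (m + l). ?t k) =
     (\<Sum>k\<le>Suc m. (- 1) ^ k * f (x \<circ> skip k)) * h (\<lambda>i. x (Suc (m + i))) +
     (- 1) ^ m * f x * (\<Sum>k\<le>Suc l. (- 1) ^ k * h ((\<lambda>i. x (m + i)) \<circ> skip k))"
    by (simp only: algebra_simps)
  show ?thesis
    unfolding eq using cong_add[OF cong_scalar_right[OF df] cong_scalar_left[OF dh]] by simp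
qed

section \<open>The group and its Euler cocycle\<close>

locale elementary_abelian =
  fixes p n :: nat
  assumes prime_p: "prime p"
begin

abbreviation "P \<equiv> int p"

abbreviation "r \<equiv> p ^ n"

definition "G = {..<n} \<rightarrow>\<^sub>E {0..<P}"

definition add :: "(nat \<Rightarrow> int) \<Rightarrow> (nat \<Rightarrow> int) \<Rightarrow> nat \<Rightarrow> int" where
  "add u g = (\<lambda>k\<in>{..<n}. (u k + g k) mod P)"

text \<open>The difference at the highest coordinate where the labels differ. It is antisymmetric, nonzero mod
  \<open>p\<close> on distinct labels and translation invariant mod \<open>p\<close>, for \<open>p = 2\<close> as well.\<close>

definition tau :: "(nat \<Rightarrow> int) \<Rightarrow> (nat \<Rightarrow> int) \<Rightarrow> int" where
  "tau g h = (if \<exists>k<n. g k \<noteq> h k then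
     (let k = Max {k. k < n \<and> g k \<noteq> h k} in h k - g k) else 0)"

text \<open>One cup factor of degree \<open>r - 1\<close> per target coordinate, labelled by
  \<open>L b\<close>. Blocks \<open>b\<close> and \<open>b + 1\<close> share the row
  \<open>(b + 1) * (r - 1)\<close>, as a front face and a back face do, so the total degree is
  \<open>B * (r - 1)\<close>.\<close>

definition euler :: "nat \<Rightarrow> (nat \<Rightarrow> 'a \<Rightarrow> nat \<Rightarrow> int) \<Rightarrow> (nat \<Rightarrow> 'a) \<Rightarrow> int" where
  "euler B L x = (\<Prod>b<B. pairprod tau r (\<lambda>i. L b (x (b * (r - 1) + i))))"

lemma p_gt_1: "p > 1" using prime_p by (rule prime_gt_1_nat)

lemma p_pos [simp]: "p > 0" using p_gt_1 by simp

lemma finite_G: "finite G" unfolding G_def by (intro finite_PiE) auto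

lemma card_G: "card G = r" unfolding G_def by (subst card_PiE) auto

lemma r_pos [simp]: "r > 0" by simp

lemma add_in_G [simp]: "add u g \<in> G"
  by (auto simp: G_def add_def)

lemma G_eqI: "\<lbrakk>g \<in> G; h \<in> G; \<And>k. k < n \<Longrightarrow> g k = h k\<rbrakk> \<Longrightarrow> g = h"
  unfolding G_def by (rule PiE_ext) auto

lemma G_bounds: "\<lbrakk>g \<in> G; k < n\<rbrakk> \<Longrightarrow> 0 \<le> g k \<and> g k < P"
  by (auto simp: G_def PiE_iff)

lemma add_cancel:
  assumes "g \<in> G" "h \<in> G" "k < n"
  shows "add u g k = add u h k \<longleftrightarrow> g k = h k"
proof
  assume "add u g k = add u h k"
  then have "[u k + g k = u k + h k] (mod P)" using assms by (simp add: add_def cong_def)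
  then have "[g k = h k] (mod P)" by (simp add: cong_add_lcancel)
  then show "g k = h k"
    using G_bounds[OF assms(1,3)] G_bounds[OF assms(2,3)] by (simp add: cong_def)
qed (use assms in \<open>simp add: add_def\<close>)

lemma tau_refl [simp]: "tau g g = 0" by (simp add: tau_def)

lemma tau_antisym: "tau h g = - tau g h"
proof -
  have "{k. k < n \<and> h k \<noteq> g k} = {k. k < n \<and> g k \<noteq> h k}" "(\<exists>k<n. h k \<noteq> g k) = (\<exists>k<n. g k \<noteq> h k)" by auto
  then show ?thesis by (cases "\<exists>k<n. g k \<noteq> h k") (simp_all only: tau_def Let_def if_True if_False minus_diff_eq minus_zero)
qed

lemma tau_top:
  assumes "k < n" "g k \<noteq> h k" "\<And>k'. \<lbrakk>k < k'; k' < n\<rbrakk> \<Longrightarrow> g k' = h k'"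
  shows "tau g h = h k - g k"
proof -
  have "Max {k. k < n \<and> g k \<noteq> h k} = k"
    by (rule Max_eqI) (use assms in \<open>auto intro: leI\<close>)
  then show ?thesis using assms by (auto simp: tau_def Let_def)
qed

lemma tau_add:
  assumes "g \<in> G" "h \<in> G"
  shows "[tau (add u g) (add u h) = tau g h] (mod P)"
proof (cases "\<exists>k<n. g k \<noteq> h k")
  case True
  let ?K = "{k. k < n \<and> g k \<noteq> h k}"
  have eq: "{k. k < n \<and> add u g k \<noteq> add u h k} = ?K"
    using add_cancel[OF assms] by blast
  have "Max ?K \<in> ?K" by (rule Max_in) (use True in auto)
  then have "Max ?K < n" by simp
  then have "[add u h (Max ?K) - add u g (Max ?K) = (u (Max ?K) + h (Max ?K)) - (u (Max ?K) + g (Max ?K))] (mod P)"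
    by (intro cong_diff) (simp_all add: add_def)
  moreover have "\<exists>k<n. add u g k \<noteq> add u h k" using True add_cancel[OF assms] by blast
  ultimately show ?thesis using True by (simp add: tau_def Let_def eq)
next
  case False
  then show ?thesis using add_cancel[OF assms] by (auto simp: tau_def)
qed

lemma pairprod_tau_inj:
  assumes "pairprod tau m g \<noteq> 0"
  shows "inj_on g {..<m}"
proof (rule linorder_inj_onI)
  fix i j assume "i < j" "j \<in> {..<m}"
  then show "g i \<noteq> g j" using assms pairprod_eq_0[of i j m tau g] by auto
qed auto

text \<open>Pigeonhole: \<open>r + 1\<close> labels in a group of order \<open>r\<close> repeat, so
  \<open>alternating_coboundary\<close> applies.\<close>

lemma pairprod_tau_coboundary:
  assumes "\<And>i. i \<le> r \<Longrightarrow> g i \<in> G"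
  shows "[(\<Sum>k\<le>r. (- 1) ^ k * pairprod tau r (g \<circ> skip k)) = 0] (mod P)"
proof -
  have "card (g ` {..r}) \<le> card G"
    by (rule card_mono[OF finite_G]) (use assms in auto)
  then have "\<not> inj_on g {..r}" using card_image[of g "{..r}"] card_G by auto
  have "\<exists>a b. a < b \<and> b \<le> r \<and> g a = g b"
  proof (rule ccontr)
    assume "\<not> ?thesis"
    then have "inj_on g {..r}" by (intro linorder_inj_onI) auto
    with \<open>\<not> inj_on g {..r}\<close> show False ..
  qed
  then obtain a b where "a < b" "b \<le> r" "g a = g b" by blast
  moreover have "[tau y x = - tau x y] (mod P)" for x y
    by (subst tau_antisym) (rule cong_refl)
  ultimately show ?thesis by (intro alternating_coboundary[of tau P a b]) simp_all
qed

lemma euler_cong: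
  assumes "\<And>i b. \<lbrakk>i \<le> B * (r - 1); b < B\<rbrakk> \<Longrightarrow> L b (x i) = L' b (y i)"
  shows "euler B L x = euler B L' y"
  unfolding euler_def
proof (intro prod.cong refl pairprod_cong assms)
  fix b i assume "b \<in> {..<B}" "i < r"
  then have "b * (r - 1) + i \<le> b * (r - 1) + (r - 1)" by simp
  also have "\<dots> = Suc b * (r - 1)" by simp
  also have "\<dots> \<le> B * (r - 1)" using \<open>b \<in> {..<B}\<close> by (intro mult_right_mono) auto
  finally show "b * (r - 1) + i \<le> B * (r - 1)" .
qed simp

text \<open>Induction on the number of cup factors with the Leibniz rule
  \<open>coboundary_cup\<close>.\<close>

lemma euler_coboundary:
  assumes "\<And>b i. \<lbrakk>b < B; i \<le> Suc (B * (r - 1))\<rbrakk> \<Longrightarrow> L b (x i) \<in> G"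
  shows "[(\<Sum>k\<le>Suc (B * (r - 1)). (- 1) ^ k * euler B L (x \<circ> skip k)) = 0] (mod P)"
  using assms
proof (induction B)
  case 0
  then show ?case by (simp add: euler_def)
next
  case (Suc B)
  let ?m = "B * (r - 1)"
  let ?h = "\<lambda>y. pairprod tau r (\<lambda>i. L B (y i))"
  have m: "Suc B * (r - 1) = ?m + (r - 1)" by simp
  have "[(\<Sum>k\<le>Suc (?m + (r - 1)). (- 1) ^ k * (euler B L (x \<circ> skip k) * ?h (\<lambda>i. x (skip k (?m + i))))) = 0] (mod P)"
  proof (rule coboundary_cup)
    show "euler B L x = euler B L y" if "\<And>i. i \<le> ?m \<Longrightarrow> x i = y i" for x y
      by (rule euler_cong) (use that in simp)
    show "[(\<Sum>k\<le>Suc ?m. (- 1) ^ k * euler B L (x \<circ> skip k)) = 0] (mod P)"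
      by (rule Suc.IH) (use Suc.prems in auto)
    have "[(\<Sum>k\<le>r. (- 1) ^ k * pairprod tau r ((\<lambda>i. L B (x (?m + i))) \<circ> skip k)) = 0] (mod P)"
    proof (rule pairprod_tau_coboundary)
      fix i assume "i \<le> r"
      then have "?m + i \<le> Suc (?m + (r - 1))" by linarith
      then show "L B (x (?m + i)) \<in> G" using Suc.prems[of B "?m + i"] m by simp
    qed
    then show "[(\<Sum>k\<le>Suc (r - 1). (- 1) ^ k * ?h ((\<lambda>i. x (?m + i)) \<circ> skip k)) = 0] (mod P)"
      by (simp add: comp_def)
  qed
  then show ?case unfolding m by (simp add: euler_def)
qed

lemma euler_add:
  assumes "\<And>b i. \<lbrakk>b < B; i \<le> B * (r - 1)\<rbrakk> \<Longrightarrow> L b (x i) \<in> G"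
  shows "[euler B (\<lambda>b x. add u (L b x)) x = euler B L x] (mod P)"
  unfolding euler_def
proof (intro cong_prod pairprod_cong_mod tau_add assms)
  fix b i j assume b: "b \<in> {..<B}" and ij: "i < j" "j < r"
  have "b * (r - 1) + j \<le> b * (r - 1) + (r - 1)" using ij by simp
  also have "\<dots> = Suc b * (r - 1)" by simp
  also have "\<dots> \<le> B * (r - 1)" using b by (intro mult_right_mono) auto
  finally show "b * (r - 1) + j \<le> B * (r - 1)" .
  then show "b * (r - 1) + i \<le> B * (r - 1)" using ij by simp
qed auto

text \<open>Telescoping \<open>(v + 1) ^ (k + 1) - v ^ (k + 1)\<close> over all residues expresses
  \<open>P ^ (k + 1)\<close> by the power sums of exponent at most \<open>k\<close>. The lower ones
  vanish by induction, and the coefficient \<open>k + 1 < p\<close> of the last one is a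
  unit.\<close>

lemma power_sum_cong_0:
  assumes "k < p - 1"
  shows "[(\<Sum>v<p. int v ^ k) = 0] (mod P)"
  using assms
proof (induction k rule: less_induct)
  case (less k)
  have "P ^ Suc k = (\<Sum>v<p. int (Suc v) ^ Suc k - int v ^ Suc k)"
    by (subst sum_lessThan_telescope) simp
  also have "\<dots> = (\<Sum>v<p. \<Sum>j\<le>k. of_nat (Suc k choose j) * int v ^ j)"
  proof (rule sum.cong[OF refl])
    fix v
    have "int (Suc v) ^ Suc k = (int v + 1) ^ Suc k" by (simp add: add.commute)
    also have "\<dots> = (\<Sum>j\<le>Suc k. of_nat (Suc k choose j) * int v ^ j)"
      by (subst binomial_ring) simp
    finally show "int (Suc v) ^ Suc k - int v ^ Suc k = (\<Sum>j\<le>k. of_nat (Suc k choose j) * int v ^ j)"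
      by simp
  qed
  also have "\<dots> = (\<Sum>j\<le>k. of_nat (Suc k choose j) * (\<Sum>v<p. int v ^ j))"
    by (subst sum.swap) (simp add: sum_distrib_left)
  also have "\<dots> = (\<Sum>j<k. of_nat (Suc k choose j) * (\<Sum>v<p. int v ^ j)) + of_nat (Suc k) * (\<Sum>v<p. int v ^ k)"
    by (simp add: lessThan_Suc_atMost[symmetric])
  finally have eq: "P ^ Suc k = \<dots>" .
  have "P dvd (\<Sum>j<k. of_nat (Suc k choose j) * (\<Sum>v<p. int v ^ j))"
    by (rule dvd_sum, rule dvd_mult) (use less in \<open>auto simp: cong_0_iff\<close>)
  moreover have "P dvd P ^ Suc k" by simp
  ultimately have "P dvd of_nat (Suc k) * (\<Sum>v<p. int v ^ k)"
    unfolding eq by (simp only: dvd_add_right_iff)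
  moreover have "\<not> P dvd of_nat (Suc k)"
    using less.prems zdvd_imp_le[of P "of_nat (Suc k)"] by auto
  ultimately show ?case
    using prime_p by (auto simp: cong_0_iff prime_dvd_mult_iff)
qed

lemma poly_sum_cong_0:
  fixes q :: "int poly"
  assumes "degree q < p - 1"
  shows "[(\<Sum>v<p. poly q (int v)) = 0] (mod P)"
proof -
  have "(\<Sum>v<p. poly q (int v)) = (\<Sum>i\<le>degree q. coeff q i * (\<Sum>v<p. int v ^ i))"
    by (simp add: poly_altdef sum_distrib_left) (rule sum.swap)
  also have "[\<dots> = (\<Sum>i\<le>degree q. coeff q i * 0)] (mod P)"
    by (intro cong_sum cong_scalar_left power_sum_cong_0) (use assms in auto)
  finally show ?thesis by simp
qed

end

section \<open>Pairing with the shuffle cycle\<close>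

text \<open>\<open>upd\<close> resets the one parameter that \<open>get\<close> reads, so
  \<open>X\<close> is the product of a slice, where this parameter is \<open>v0\<close>, with
  \<open>V\<close>. The sum is taken along the second factor first.\<close>

lemma fibre_sum_cong_0:
  fixes f :: "'x \<Rightarrow> int"
  assumes "\<And>x v. \<lbrakk>x \<in> X; v \<in> V\<rbrakk> \<Longrightarrow> upd x v \<in> X"
    and "\<And>x v u. \<lbrakk>x \<in> X; v \<in> V; u \<in> V\<rbrakk> \<Longrightarrow> upd (upd x v) u = upd x u"
    and "\<And>x. x \<in> X \<Longrightarrow> get x \<in> V" and "\<And>x. x \<in> X \<Longrightarrow> upd x (get x) = x"
    and "\<And>x v. \<lbrakk>x \<in> X; v \<in> V\<rbrakk> \<Longrightarrow> get (upd x v) = v"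
    and sum0: "\<And>x. x \<in> X \<Longrightarrow> [(\<Sum>v\<in>V. f (upd x v)) = 0] (mod m)"
  shows "[(\<Sum>x\<in>X. f x) = 0] (mod m)"
proof (cases "X = {}")
  case False
  then obtain v0 where v0: "v0 \<in> V" using assms(3) by blast
  define R where "R = (\<lambda>x. upd x v0) ` X"
  have R: "R \<subseteq> X" using assms(1) v0 by (auto simp: R_def)
  have "bij_betw (\<lambda>(x, v). upd x v) (R \<times> V) X"
  proof (rule bij_betw_byWitness[where f' = "\<lambda>x. (upd x v0, get x)"])
    show "\<forall>a\<in>R \<times> V. (upd (case a of (x, v) \<Rightarrow> upd x v) v0, get (case a of (x, v) \<Rightarrow> upd x v)) = a"
    proof clarify
      fix x v assume xv: "x \<in> R" "v \<in> V"
      then obtain x' where "x' \<in> X" "x = upd x' v0" by (auto simp: R_def)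
      then show "upd (upd x v) v0 = x \<and> get (upd x v) = v"
        using assms xv v0 R by (metis subsetD)
    qed
    show "\<forall>x\<in>X. (case (upd x v0, get x) of (x, v) \<Rightarrow> upd x v) = x"
      using assms v0 by auto
  qed (use assms R v0 in \<open>auto simp: R_def\<close>)
  then have "(\<Sum>z\<in>R \<times> V. f (case z of (x, v) \<Rightarrow> upd x v)) = (\<Sum>x\<in>X. f x)"
    by (rule sum.reindex_bij_betw)
  then have "(\<Sum>x\<in>X. f x) = (\<Sum>(x, v)\<in>R \<times> V. f (upd x v))"
    by (simp add: case_prod_beta)
  also have "\<dots> = (\<Sum>x\<in>R. \<Sum>v\<in>V. f (upd x v))" by (rule sum.cartesian_product[symmetric])
  also have "[\<dots> = (\<Sum>x\<in>R. 0)] (mod m)"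
    by (rule cong_sum) (use R sum0 in blast)
  finally show ?thesis by simp
qed simp

section \<open>Step counts of a shuffle word\<close>

definition step_count :: "(nat \<Rightarrow> nat) \<Rightarrow> nat \<Rightarrow> nat \<Rightarrow> nat" where
  "step_count c k i = card {j. j < i \<and> c j = k}"

lemma step_count_0 [simp]: "step_count c k 0 = 0" by (simp add: step_count_def)

lemma step_count_Suc [simp]: "step_count c k (Suc i) = step_count c k i + (if c i = k then 1 else 0)"
proof -
  have "{j. j < Suc i \<and> c j = k} = (if c i = k then insert i {j. j < i \<and> c j = k} else {j. j < i \<and> c j = k})"
    by (auto simp: less_Suc_eq)
  then show ?thesis by (simp add: step_count_def)
qed

lemma step_count_mono: "i \<le> j \<Longrightarrow> step_count c k i \<le> step_count c k j"
  unfolding step_count_def by (rule card_mono) auto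

text \<open>The prefix of length \<open>Suc i\<close> is the only one that contains just one of the
  two swapped steps.\<close>

lemma step_count_transpose:
  assumes "i' \<noteq> Suc i"
  shows "step_count (c \<circ> Transposition.transpose i (Suc i)) k i' = step_count c k i'"
proof -
  let ?T = "Transposition.transpose i (Suc i)"
  have T: "?T j < i' \<longleftrightarrow> j < i'" for j
    using assms by (auto simp: Transposition.transpose_def)
  have "{j. j < i' \<and> c (?T j) = k} = ?T ` {j. j < i' \<and> c j = k}"
  proof (intro Set.set_eqI iffI)
    fix j assume "j \<in> {j. j < i' \<and> c (?T j) = k}"
    then show "j \<in> ?T ` {j. j < i' \<and> c j = k}"
      by (intro image_eqI[of _ _ "?T j"]) (auto simp: T)
  qed (auto simp: T)
  then show ?thesis by (simp add: step_count_def card_image)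
qed

context elementary_abelian
begin

context
  fixes B :: nat
begin

text \<open>A shuffle word \<open>c\<close> gives the direction \<open>c i\<close> of the step from row \<open>i\<close> to row \<open>i + 1\<close> of a path in the group;
  \<open>x k\<close> is the sequence of values that coordinate \<open>k\<close> runs through. The steps in direction \<open>k\<close> come in
  \<open>num_lines k\<close> runs of \<open>p - 1\<close>; a run together with the value before it can visit a whole line.\<close>

definition "num_lines k = B * p ^ (n - 1 - k)"

definition "N = B * (r - 1)"

text \<open>The prescribed counts are those of an odometer in base \<open>p\<close>: among the
  \<open>r - 1\<close> advances of one block, exactly \<open>p ^ (n - 1 - k) * (p - 1)\<close> stop
  carrying at digit \<open>k\<close>. These numbers add up to \<open>r - 1\<close>.\<close>

definition "shuffle_words = {c \<in> {..<N} \<rightarrow>\<^sub>E {..<n}. \<forall>k<n. step_count c k N = num_lines k * (p - 1)}"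

text \<open>All coordinates start at \<open>0\<close>, so row \<open>0\<close> has the label
  \<open>0\<close> and each translation class of paths is represented once.\<close>

definition "paths k = {y \<in> {..num_lines k * (p - 1)} \<rightarrow>\<^sub>E {0..<P}. y 0 = 0}"

definition "path_families = PiE {..<n} paths"

definition row_label :: "(nat \<Rightarrow> nat) \<Rightarrow> (nat \<Rightarrow> nat \<Rightarrow> int) \<Rightarrow> nat \<Rightarrow> nat \<Rightarrow> int" where
  "row_label c x i = (\<lambda>k\<in>{..<n}. x k (step_count c k i))"

text \<open>The Vandermonde product of a run omits the value before it, so it has degree \<open>p - 2\<close> in each of its
  variables and sums to \<open>0\<close> mod \<open>p\<close> over each of them.\<close>

definition lineprod :: "nat \<Rightarrow> (nat \<Rightarrow> int) \<Rightarrow> int" where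
  "lineprod m y = (\<Prod>l<m. pairprod (\<lambda>u v. v - u) (p - 1) (\<lambda>j. y (l * (p - 1) + Suc j)))"

definition "weight x = (\<Prod>k<n. lineprod (num_lines k) (x k))"

text \<open>The sign by inversions; a pair of equal letters counts as being in order.\<close>

definition "shuffle_sign c = pairprod (\<lambda>u v. if v < u then - 1 else 1) N c" for c :: "nat \<Rightarrow> nat"

definition "shuffle_pairing \<phi> = (\<Sum>c\<in>shuffle_words. \<Sum>x\<in>path_families. shuffle_sign c * weight x * \<phi> (row_label c x))"

lemma finite_shuffle_words: "finite shuffle_words"
  unfolding shuffle_words_def by (rule finite_subset[of _ "{..<N} \<rightarrow>\<^sub>E {..<n}"]) (auto intro: finite_PiE)

lemma path_familiesD:
  assumes "x \<in> path_families" "k < n"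
  shows "x k 0 = 0" "j \<le> num_lines k * (p - 1) \<Longrightarrow> 0 \<le> x k j \<and> x k j < P"
    "j > num_lines k * (p - 1) \<Longrightarrow> x k j = undefined"
  using assms unfolding path_families_def paths_def
  by (auto simp: PiE_iff extensional_def)

lemma path_familiesI:
  assumes "x' \<in> path_families" "k < n" "y 0 = 0" "\<And>j. j \<le> num_lines k * (p - 1) \<Longrightarrow> 0 \<le> y j \<and> y j < P"
    "\<And>j. j > num_lines k * (p - 1) \<Longrightarrow> y j = undefined"
  shows "x'(k := y) \<in> path_families"
  using assms unfolding path_families_def paths_def
  by (auto simp: PiE_iff extensional_def)

lemma step_count_le: "\<lbrakk>c \<in> shuffle_words; k < n; i \<le> N\<rbrakk> \<Longrightarrow> step_count c k i \<le> num_lines k * (p - 1)"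
  using step_count_mono[of i N c k] by (auto simp: shuffle_words_def)

lemma row_label_in_G: "\<lbrakk>c \<in> shuffle_words; x \<in> path_families; i \<le> N\<rbrakk> \<Longrightarrow> row_label c x i \<in> G"
  using path_familiesD(2) step_count_le by (auto simp: G_def row_label_def)

text \<open>Each of the other \<open>p - 2\<close> entries contributes one linear factor in entry
  \<open>d\<close>.\<close>

lemma pairprod_diff_poly:
  assumes "d < p - 1"
  shows "\<exists>q. degree q < p - 1 \<and> (\<forall>v. pairprod (\<lambda>u v. v - u) (p - 1) (y(d := v)) = poly q v)"
proof -
  obtain m where m: "p - 1 = Suc m" using assms by (cases "p - 1") auto
  let ?f = "\<lambda>i. if i < d then [:- y i, 1:] else [:y i, - 1:]"
  let ?q = "smult (pairprod (\<lambda>u v. v - u) m (y \<circ> skip d)) (\<Prod>i\<in>{..m} - {d}. ?f i)"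
  have d: "d \<le> m" using assms m by simp
  have "degree ?q \<le> degree (\<Prod>i\<in>{..m} - {d}. ?f i)" by (rule degree_smult_le)
  also have "\<dots> \<le> (\<Sum>i\<in>{..m} - {d}. degree (?f i))"
    by (rule order_trans[OF degree_prod_sum_le]) (simp_all add: o_def)
  also have "\<dots> \<le> (\<Sum>i\<in>{..m} - {d}. 1)" by (rule sum_mono) auto
  also have "\<dots> < p - 1" using d m by simp
  finally have "degree ?q < p - 1" .
  moreover have "pairprod (\<lambda>u v. v - u) (p - 1) (y(d := v)) = poly ?q v" for v
  proof -
    have "y(d := v) \<circ> skip d = y \<circ> skip d" by (auto simp: fun_eq_iff)
    then show ?thesis
      unfolding m pairprod_remove[OF d] by (auto simp: poly_prod intro!: prod.cong split: if_splits)
  qed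
  ultimately show ?thesis by blast
qed

lemma sum_int_lessThan: "(\<Sum>v\<in>{0..<P}. f v) = (\<Sum>v<p. f (int v))"
proof -
  have "{0..<P} = int ` {..<p}"
    using image_int_atLeastLessThan[of 0 p] by (simp add: atLeast0LessThan)
  then show ?thesis by (simp add: sum.reindex)
qed

text \<open>An index \<open>j > 0\<close> lies in exactly one run,
  \<open>j = l * (p - 1) + Suc d\<close>. In this entry the weight is a constant times one
  Vandermonde product, a polynomial of degree below \<open>p - 1\<close>, whose sum over all
  residues vanishes.\<close>

lemma weight_upd_sum:
  assumes k: "k < n" and j: "0 < j" "j \<le> num_lines k * (p - 1)"
  shows "[(\<Sum>v\<in>{0..<P}. weight (x(k := (x k)(j := v)))) = 0] (mod P)"
proof -
  define l d where "l = (j - 1) div (p - 1)" and "d = (j - 1) mod (p - 1)"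
  have p1: "0 < p - 1" using p_gt_1 by simp
  have d: "d < p - 1" using p1 by (simp add: d_def)
  have jeq: "j = l * (p - 1) + Suc d"
    using j div_mult_mod_eq[of "j - 1" "p - 1"] by (simp add: l_def d_def)
  have l: "l < num_lines k"
    unfolding l_def using j p1 by (simp add: div_less_iff_less_mult)
  let ?V = "\<lambda>y. pairprod (\<lambda>u v. v - u) (p - 1) y"
  let ?x = "\<lambda>v. x(k := (x k)(j := v))"
  define C where "C = (\<Prod>k'\<in>{..<n} - {k}. lineprod (num_lines k') (x k')) *
     (\<Prod>l'\<in>{..<num_lines k} - {l}. ?V (\<lambda>j. x k (l' * (p - 1) + Suc j)))"
  have W: "weight (?x v) = C * ?V ((\<lambda>j. x k (l * (p - 1) + Suc j))(d := v))" for v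
  proof -
    have "weight (?x v) = lineprod (num_lines k) (?x v k) * (\<Prod>k'\<in>{..<n} - {k}. lineprod (num_lines k') (?x v k'))"
      unfolding weight_def by (subst prod.remove[of _ k]) (use k in auto)
    also have "(\<Prod>k'\<in>{..<n} - {k}. lineprod (num_lines k') (?x v k')) = (\<Prod>k'\<in>{..<n} - {k}. lineprod (num_lines k') (x k'))"
      by (rule prod.cong) auto
    also have "lineprod (num_lines k) (?x v k) = ?V (\<lambda>i. ((x k)(j := v)) (l * (p - 1) + Suc i)) *
       (\<Prod>l'\<in>{..<num_lines k} - {l}. ?V (\<lambda>i. ((x k)(j := v)) (l' * (p - 1) + Suc i)))"
      unfolding lineprod_def by (subst prod.remove[of _ l]) (use l in auto)
    also have "(\<lambda>i. ((x k)(j := v)) (l * (p - 1) + Suc i)) = (\<lambda>j. x k (l * (p - 1) + Suc j))(d := v)"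
      by (auto simp: fun_eq_iff jeq)
    also have "(\<Prod>l'\<in>{..<num_lines k} - {l}. ?V (\<lambda>i. ((x k)(j := v)) (l' * (p - 1) + Suc i))) =
       (\<Prod>l'\<in>{..<num_lines k} - {l}. ?V (\<lambda>j. x k (l' * (p - 1) + Suc j)))"
    proof (intro prod.cong refl pairprod_cong)
      fix l' i assume l': "l' \<in> {..<num_lines k} - {l}" and i: "i < p - 1"
      have "l' * (p - 1) + Suc i \<noteq> j"
      proof
        assume "l' * (p - 1) + Suc i = j"
        then have "l' * (p - 1) + i = l * (p - 1) + d" using jeq by simp
        then have "(l' * (p - 1) + i) div (p - 1) = (l * (p - 1) + d) div (p - 1)" by simp
        then have "l' = l" using i d by (simp add: div_mult_self3)
        with l' show False by simp
      qed
      then show "((x k)(j := v)) (l' * (p - 1) + Suc i) = x k (l' * (p - 1) + Suc i)" by simp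
    qed
    finally show ?thesis by (simp only: C_def mult_ac)
  qed
  obtain q where q: "degree q < p - 1" "\<And>v. ?V ((\<lambda>j. x k (l * (p - 1) + Suc j))(d := v)) = poly q v"
    using pairprod_diff_poly[OF d] by metis
  have "(\<Sum>v\<in>{0..<P}. weight (?x v)) = C * (\<Sum>v<p. poly q (int v))"
    unfolding W q(2) sum_distrib_left[symmetric] sum_int_lessThan ..
  also have "[\<dots> = C * 0] (mod P)" by (intro cong_scalar_left poly_sum_cong_0 q)
  finally show ?thesis by simp
qed

text \<open>The value \<open>x k j\<close> can be read in row \<open>i\<close> at most, and
  \<open>\<phi>\<close> ignores that row. While the value varies, only the weight changes, and the
  weights sum to \<open>0\<close>.\<close>

lemma shuffle_sum_inner_row:
  assumes c: "c \<in> shuffle_words" and k: "k < n" and j: "0 < j" "j \<le> num_lines k * (p - 1)"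
    and i: "\<And>i'. \<lbrakk>i' \<le> N; i' \<noteq> i\<rbrakk> \<Longrightarrow> step_count c k i' \<noteq> j"
    and loc: "\<And>A A'. (\<And>j. \<lbrakk>j \<le> N; j \<noteq> i\<rbrakk> \<Longrightarrow> A j = A' j) \<Longrightarrow> \<phi> A = \<phi> A'"
  shows "[(\<Sum>x\<in>path_families. shuffle_sign c * weight x * \<phi> (row_label c x)) = 0] (mod P)"
proof -
  define upd :: "(nat \<Rightarrow> nat \<Rightarrow> int) \<Rightarrow> int \<Rightarrow> nat \<Rightarrow> nat \<Rightarrow> int" where
    "upd = (\<lambda>x v. x(k := (x k)(j := v)))"
  define get :: "(nat \<Rightarrow> nat \<Rightarrow> int) \<Rightarrow> int" where "get = (\<lambda>x. x k j)"
  have upd: "upd x v \<in> path_families" if "x \<in> path_families" "v \<in> {0..<P}" for x v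
    unfolding upd_def by (rule path_familiesI) (use k j that path_familiesD[OF that(1) k] in auto)
  have get: "get x \<in> {0..<P}" if "x \<in> path_families" for x
    using path_familiesD(2)[OF that k j(2)] by (simp add: get_def)
  have upd_upd: "upd (upd x v) u = upd x u" "upd x (get x) = x" "get (upd x v) = v" for x u v
    by (simp_all add: upd_def get_def)
  have sum0: "[(\<Sum>v\<in>{0..<P}. shuffle_sign c * weight (upd x v) * \<phi> (row_label c (upd x v))) = 0] (mod P)" for x
  proof -
    have "\<phi> (row_label c (upd x v)) = \<phi> (row_label c x)" for v
      by (rule loc) (use i in \<open>auto simp: row_label_def fun_eq_iff upd_def\<close>)
    then have "(\<Sum>v\<in>{0..<P}. shuffle_sign c * weight (upd x v) * \<phi> (row_label c (upd x v))) =
      shuffle_sign c * \<phi> (row_label c x) * (\<Sum>v\<in>{0..<P}. weight (upd x v))"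
      by (simp add: sum_distrib_left mult_ac)
    also have "[\<dots> = shuffle_sign c * \<phi> (row_label c x) * 0] (mod P)"
      unfolding upd_def by (intro cong_scalar_left weight_upd_sum k j)
    finally show ?thesis by simp
  qed
  show ?thesis
    by (rule fibre_sum_cong_0[where V = "{0..<P}" and upd = upd and get = get])
      (simp_all only: upd get upd_upd sum0)
qed

text \<open>The face opposite row \<open>0\<close>. From row \<open>1\<close> on, coordinate
  \<open>c 0\<close> has left its start value, so adding a constant to all its later values
  translates every remaining label. The invariant \<open>\<phi>\<close> does not change modulo
  \<open>p\<close>, nor does the weight, which consists of differences of entries with positive
  index. The terms thus come in families of \<open>p\<close> congruent ones.\<close>

lemma shuffle_sum_row_0:
  assumes c: "c \<in> shuffle_words" and N: "0 < N"
    and loc: "\<And>A A'. (\<And>j. \<lbrakk>j \<le> N; j \<noteq> 0\<rbrakk> \<Longrightarrow> A j = A' j) \<Longrightarrow> \<phi> A = \<phi> A'"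
    and inv: "\<And>u A. \<lbrakk>u \<in> G; \<And>j. j \<le> N \<Longrightarrow> A j \<in> G\<rbrakk> \<Longrightarrow> [\<phi> (\<lambda>j. add u (A j)) = \<phi> A] (mod P)"
  shows "[(\<Sum>x\<in>path_families. shuffle_sign c * weight x * \<phi> (row_label c x)) = 0] (mod P)"
proof -
  define k where "k = c 0"
  have k: "k < n" using c N by (auto simp: shuffle_words_def k_def)
  have rank1: "1 \<le> step_count c k i" if "0 < i" for i
  proof -
    have "step_count c k (Suc 0) \<le> step_count c k i" by (rule step_count_mono) (use that in simp)
    then show ?thesis by (simp add: k_def)
  qed
  have a1: "1 \<le> num_lines k * (p - 1)" using rank1[OF N] step_count_le[OF c k order_refl] by (rule order_trans)
  \<comment> \<open>Shifts the entries of positive index so that the first of them becomes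
    \<open>v\<close>. Entry \<open>0\<close> is kept, and so is the value \<open>undefined\<close>
    beyond the end.\<close>
  define sh :: "(nat \<Rightarrow> int) \<Rightarrow> int \<Rightarrow> nat \<Rightarrow> int" where
    "sh = (\<lambda>y v j. if j = 0 \<or> j > num_lines k * (p - 1) then y j else (y j - y 1 + v) mod P)"
  define upd :: "(nat \<Rightarrow> nat \<Rightarrow> int) \<Rightarrow> int \<Rightarrow> nat \<Rightarrow> nat \<Rightarrow> int" where
    "upd = (\<lambda>x v. x(k := sh (x k) v))"
  define get :: "(nat \<Rightarrow> nat \<Rightarrow> int) \<Rightarrow> int" where "get = (\<lambda>x. x k 1)"
  have sh1: "sh y v 1 = v" if "v \<in> {0..<P}" for y v
    using a1 that by (auto simp: sh_def)
  have sh_sh: "sh (sh y v) u = sh y u" if "v \<in> {0..<P}" for y u v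
  proof
    fix j
    have "((y j - y 1 + v) mod P - v + u) mod P = ((y j - y 1 + v) - v + u) mod P"
      by (metis mod_add_left_eq mod_diff_left_eq)
    then have *: "((y j - y 1 + v) mod P - v + u) mod P = (y j - y 1 + u) mod P" by simp
    show "sh (sh y v) u j = sh y u j"
    proof (cases "j = 0 \<or> j > num_lines k * (p - 1)")
      case True
      then show ?thesis by (simp add: sh_def)
    next
      case False
      then have "sh (sh y v) u j = (sh y v j - sh y v 1 + u) mod P" by (simp add: sh_def)
      also have "\<dots> = ((y j - y 1 + v) mod P - v + u) mod P"
        unfolding sh1[OF that] using False by (simp add: sh_def)
      finally show ?thesis using * False by (simp add: sh_def)
    qed
  qed
  have upd: "upd x v \<in> path_families" if "x \<in> path_families" "v \<in> {0..<P}" for x v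
    unfolding upd_def by (rule path_familiesI) (use k that path_familiesD[OF that(1) k] in \<open>auto simp: sh_def\<close>)
  have get: "get x \<in> {0..<P}" if "x \<in> path_families" for x
    using path_familiesD(2)[OF that k a1] by (simp add: get_def)
  have upd_get: "upd x (get x) = x" if "x \<in> path_families" for x
    using path_familiesD(2)[OF that k] by (auto simp: fun_eq_iff sh_def upd_def get_def)
  have get_upd: "get (upd x v) = v" if "v \<in> {0..<P}" for x v
    using sh1[OF that] by (simp add: get_def upd_def)
  have upd_upd: "upd (upd x v) u = upd x u" if "v \<in> {0..<P}" for x u v
    using sh_sh[OF that] by (simp add: upd_def)
  have shift: "[shuffle_sign c * weight (upd x v) * \<phi> (row_label c (upd x v)) = shuffle_sign c * weight x * \<phi> (row_label c x)] (mod P)"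
    if x: "x \<in> path_families" and v: "v \<in> {0..<P}" for x v
  proof (intro cong_mult cong_refl)
    show "[weight (upd x v) = weight x] (mod P)"
      unfolding weight_def lineprod_def
    proof (intro cong_prod pairprod_cong_mod)
      fix k' l i j assume k': "k' \<in> {..<n}" and l: "l \<in> {..<num_lines k'}" and ij: "i < j" "j < p - 1"
      have "l * (p - 1) + Suc j \<le> Suc l * (p - 1)" using ij by simp
      also have "\<dots> \<le> num_lines k' * (p - 1)" using l by (intro mult_right_mono) auto
      finally have le: "l * (p - 1) + Suc j \<le> num_lines k' * (p - 1)" .
      show "[upd x v k' (l * (p - 1) + Suc j) - upd x v k' (l * (p - 1) + Suc i) =
            x k' (l * (p - 1) + Suc j) - x k' (l * (p - 1) + Suc i)] (mod P)"
      proof (cases "k' = k")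
        case True
        have "sh (x k) v (l * (p - 1) + Suc i) = (x k (l * (p - 1) + Suc i) - x k 1 + v) mod P"
          "sh (x k) v (l * (p - 1) + Suc j) = (x k (l * (p - 1) + Suc j) - x k 1 + v) mod P"
          using le ij True by (auto simp: sh_def)
        then show ?thesis unfolding True cong_def by (simp add: upd_def mod_diff_eq)
      qed (simp add: upd_def)
    qed
    define u where "u = (\<lambda>k'\<in>{..<n}. if k' = k then (v - x k 1) mod P else 0)"
    have u: "u \<in> G" using k by (auto simp: u_def G_def)
    have "\<phi> (row_label c (upd x v)) = \<phi> (\<lambda>i. add u (row_label c x i))"
    proof (rule loc)
      fix i assume i: "i \<le> N" "i \<noteq> 0"
      have "row_label c (upd x v) i k' = add u (row_label c x i) k'" if k': "k' < n" for k'
      proof (cases "k' = k")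
        case True
        have "step_count c k i \<le> num_lines k * (p - 1)" "step_count c k i \<noteq> 0"
          using step_count_le[OF c k i(1)] rank1[of i] i by auto
        then have "row_label c (upd x v) i k = (x k (step_count c k i) - x k 1 + v) mod P"
          using k by (simp add: row_label_def sh_def upd_def)
        also have "\<dots> = ((v - x k 1) mod P + x k (step_count c k i)) mod P"
          unfolding mod_add_left_eq by (rule arg_cong[where f = "\<lambda>a. a mod P"]) simp
        finally show ?thesis using k True by (simp add: row_label_def add_def u_def)
      next
        case False
        then show ?thesis
          using k' path_familiesD(2)[OF x k' step_count_le[OF c k' i(1)]] by (simp add: row_label_def add_def u_def upd_def)
      qed
      then show "row_label c (upd x v) i = add u (row_label c x i)"
        by (intro ext) (auto simp: row_label_def add_def)
    qed
    also have "[\<dots> = \<phi> (row_label c x)] (mod P)" by (rule inv[OF u row_label_in_G[OF c x]])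
    finally show "[\<phi> (row_label c (upd x v)) = \<phi> (row_label c x)] (mod P)" .
  qed
  have sum0: "[(\<Sum>v\<in>{0..<P}. shuffle_sign c * weight (upd x v) * \<phi> (row_label c (upd x v))) = 0] (mod P)"
    if x: "x \<in> path_families" for x
  proof -
    have "[(\<Sum>v\<in>{0..<P}. shuffle_sign c * weight (upd x v) * \<phi> (row_label c (upd x v))) =
        (\<Sum>v\<in>{0..<P}. shuffle_sign c * weight x * \<phi> (row_label c x))] (mod P)"
      by (rule cong_sum[OF shift[OF x]])
    also have "(\<Sum>v\<in>{0..<P}. shuffle_sign c * weight x * \<phi> (row_label c x)) = P * (shuffle_sign c * weight x * \<phi> (row_label c x))" by simp
    also have "[\<dots> = 0] (mod P)" by (simp add: cong_0_iff)
    finally show ?thesis .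
  qed
  show ?thesis
    by (rule fibre_sum_cong_0[where V = "{0..<P}" and upd = upd and get = get])
      (simp_all only: upd get upd_get get_upd upd_upd sum0)
qed

text \<open>Swapping two different adjacent steps alters the path only in row \<open>Suc i\<close>,
  which \<open>\<phi>\<close> does not see, and reverses the sign; the words pair off.\<close>

lemma shuffle_sum_swap:
  assumes i: "Suc i < N"
    and loc: "\<And>A A'. (\<And>j. \<lbrakk>j \<le> N; j \<noteq> Suc i\<rbrakk> \<Longrightarrow> A j = A' j) \<Longrightarrow> \<phi> A = \<phi> A'"
  shows "(\<Sum>c\<in>{c \<in> shuffle_words. c (Suc i) \<noteq> c i}. \<Sum>x\<in>path_families. shuffle_sign c * weight x * \<phi> (row_label c x)) = 0"
    (is "sum ?f ?D = 0")
proof -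
  let ?T = "Transposition.transpose i (Suc i)"
  have mem: "c \<circ> ?T \<in> ?D" if c: "c \<in> ?D" for c
  proof -
    have T: "?T j < N \<longleftrightarrow> j < N" for j using i by (auto simp: Transposition.transpose_def)
    have "c \<circ> ?T \<in> {..<N} \<rightarrow>\<^sub>E {..<n}"
    proof (rule PiE_I)
      fix j assume "j \<in> {..<N}"
      then have "?T j \<in> {..<N}" using T by simp
      then show "(c \<circ> ?T) j \<in> {..<n}" using c by (auto simp: shuffle_words_def PiE_iff)
    next
      fix j assume "j \<notin> {..<N}"
      then have "?T j \<notin> {..<N}" using T by simp
      then have "c (?T j) = undefined" using c unfolding shuffle_words_def by (auto simp: PiE_iff extensional_def)
      then show "(c \<circ> ?T) j = undefined" by simp
    qed
    then show ?thesis using c i step_count_transpose[of N i c] by (auto simp: shuffle_words_def)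
  qed
  have neg: "?f (c \<circ> ?T) = - ?f c" if c: "c \<in> ?D" for c
  proof -
    have "row_label (c \<circ> ?T) x j = row_label c x j" if "j \<noteq> Suc i" for x j
      using step_count_transpose[OF that, of c] by (auto simp: row_label_def fun_eq_iff)
    then have "\<phi> (row_label (c \<circ> ?T) x) = \<phi> (row_label c x)" for x by (intro loc) auto
    moreover have "shuffle_sign (c \<circ> ?T) = - shuffle_sign c"
      using pairprod_transpose[OF i, of "\<lambda>u v. if v < u then - 1 else 1" c] c
      by (auto simp: shuffle_sign_def split: if_splits)
    ultimately show ?thesis by (simp add: sum_negf)
  qed
  have "bij_betw (\<lambda>c. c \<circ> ?T) ?D ?D"
  proof (rule bij_betw_byWitness[where f' = "\<lambda>c. c \<circ> ?T"])
    have "c \<circ> ?T \<circ> ?T = c" for c :: "nat \<Rightarrow> nat" by (simp add: comp_assoc)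
    then show "\<forall>c\<in>?D. c \<circ> ?T \<circ> ?T = c" "\<forall>c\<in>?D. c \<circ> ?T \<circ> ?T = c" by simp_all
    show "(\<lambda>c. c \<circ> ?T) ` ?D \<subseteq> ?D" "(\<lambda>c. c \<circ> ?T) ` ?D \<subseteq> ?D"
      by (intro image_subsetI mem; assumption)+
  qed
  then have "(\<Sum>c\<in>?D. ?f (c \<circ> ?T)) = (\<Sum>c\<in>?D. ?f c)" by (rule sum.reindex_bij_betw)
  moreover have "(\<Sum>c\<in>?D. ?f (c \<circ> ?T)) = (\<Sum>c\<in>?D. - ?f c)" by (intro sum.cong refl neg)
  ultimately show ?thesis by (simp add: sum_negf)
qed

text \<open>The cycle property, modulo \<open>p\<close> and the action of \<open>G\<close>: a
  cochain that ignores row \<open>i\<close> lives on the facet opposite to it. Row \<open>0\<close>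
  is handled by translation, the last row and the rows inside a straight piece by the weight, and a
  corner by swapping its two steps.\<close>

proposition shuffle_pairing_cong_0:
  assumes i: "i \<le> N" and N: "0 < N"
    and loc: "\<And>A A'. (\<And>j. \<lbrakk>j \<le> N; j \<noteq> i\<rbrakk> \<Longrightarrow> A j = A' j) \<Longrightarrow> \<phi> A = \<phi> A'"
    and inv: "\<And>u A. \<lbrakk>u \<in> G; \<And>j. j \<le> N \<Longrightarrow> A j \<in> G\<rbrakk> \<Longrightarrow> [\<phi> (\<lambda>j. add u (A j)) = \<phi> A] (mod P)"
  shows "[shuffle_pairing \<phi> = 0] (mod P)"
proof (cases i)
  case 0
  have "[shuffle_pairing \<phi> = (\<Sum>c\<in>shuffle_words. 0)] (mod P)"
    unfolding shuffle_pairing_def by (intro cong_sum shuffle_sum_row_0 N loc inv) (use 0 in auto)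
  then show ?thesis by simp
next
  case (Suc i')
  let ?f = "\<lambda>c. \<Sum>x\<in>path_families. shuffle_sign c * weight x * \<phi> (row_label c x)"
  \<comment> \<open>The value of coordinate \<open>c i'\<close> in row \<open>i\<close> was entered
    by step \<open>i'\<close>, and step \<open>i\<close> leaves it again unless row \<open>i\<close>
    is the last one; so no other row reads it.\<close>
  have row: "[?f c = 0] (mod P)" if c: "c \<in> shuffle_words" and eq: "i = N \<or> c i = c i'" for c
  proof (rule shuffle_sum_inner_row)
    define k where "k = c i'"
    show "c \<in> shuffle_words" by fact
    show k: "c i' < n" using c i Suc by (auto simp: shuffle_words_def PiE_iff)
    show "0 < step_count c (c i') i" by (simp add: Suc)
    show "step_count c (c i') i \<le> num_lines (c i') * (p - 1)" by (rule step_count_le) (use c k i in auto)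
    show "step_count c (c i') j \<noteq> step_count c (c i') i" if j: "j \<le> N" "j \<noteq> i" for j
    proof (cases "j \<le> i'")
      case True
      then have "step_count c (c i') j \<le> step_count c (c i') i'" by (rule step_count_mono)
      then show ?thesis by (simp add: Suc)
    next
      case False
      then have "Suc i \<le> j" using j Suc by simp
      then have "step_count c (c i') (Suc i) \<le> step_count c (c i') j" by (rule step_count_mono)
      moreover have "c i = c i'" using eq False j Suc by auto
      ultimately show ?thesis by simp
    qed
  qed (rule loc, blast)
  show ?thesis
  proof (cases "i = N")
    case True
    have "[shuffle_pairing \<phi> = (\<Sum>c\<in>shuffle_words. 0)] (mod P)"
      unfolding shuffle_pairing_def by (intro cong_sum row) (use True in auto)
    then show ?thesis by simp
  next
    case False
    let ?E = "{c \<in> shuffle_words. c i = c i'}" and ?D = "{c \<in> shuffle_words. c i \<noteq> c i'}"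
    have "shuffle_words = ?E \<union> ?D" by blast
    moreover have "sum ?f (?E \<union> ?D) = sum ?f ?E + sum ?f ?D"
      by (rule sum.union_disjoint) (auto simp: finite_shuffle_words)
    moreover have "sum ?f ?D = 0"
      unfolding Suc by (rule shuffle_sum_swap) (use False i Suc in simp, rule loc, simp add: Suc)
    ultimately have "shuffle_pairing \<phi> = sum ?f ?E" unfolding shuffle_pairing_def by simp
    moreover have "[sum ?f ?E = (\<Sum>c\<in>?E. 0)] (mod P)"
      by (intro cong_sum row) auto
    ultimately show ?thesis by simp
  qed
qed

end

end

section \<open>Vandermonde products of lines\<close>

lemma prod_lessThan_add: "(\<Prod>i<m + s. f i) = (\<Prod>i<m. f i) * (\<Prod>i<s. f (m + i))"
  for f :: "nat \<Rightarrow> 'a::comm_monoid_mult"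
  by (induction s) (simp_all add: mult_ac)

lemma prod_lessThan_mult: "(\<Prod>i<q * s. f i) = (\<Prod>a<q. \<Prod>i<s. f (a * s + i))"
  for f :: "nat \<Rightarrow> 'a::comm_monoid_mult"
proof (induction q)
  case (Suc q)
  have "Suc q * s = q * s + s" by simp
  then show ?case using Suc by (simp only: prod_lessThan_add prod.lessThan_Suc)
qed simp

lemma pairs_Suc: "pairs (Suc m) = pairs m \<union> (\<lambda>i. (i, m)) ` {..<m}"
  by (auto simp: pairs_def less_Suc_eq)

lemma pairprod_0 [simp]: "pairprod F 0 g = 1"
  by (simp add: pairprod_def pairs_def)

lemma pairprod_Suc: "pairprod F (Suc m) g = pairprod F m g * (\<Prod>i<m. F (g i) (g m))"
proof -
  have "pairprod F (Suc m) g = (\<Prod>(i, j)\<in>pairs m \<union> (\<lambda>i. (i, m)) ` {..<m}. F (g i) (g j))"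
    by (simp add: pairprod_def pairs_Suc)
  also have "\<dots> = (\<Prod>(i, j)\<in>pairs m. F (g i) (g j)) * (\<Prod>(i, j)\<in>(\<lambda>i. (i, m)) ` {..<m}. F (g i) (g j))"
    by (rule prod.union_disjoint[OF finite_pairs]) (auto simp: pairs_def)
  also have "(\<Prod>(i, j)\<in>(\<lambda>i. (i, m)) ` {..<m}. F (g i) (g j)) = (\<Prod>i<m. F (g i) (g m))"
    by (subst prod.reindex) (auto simp: inj_on_def)
  finally show ?thesis by (simp add: pairprod_def)
qed

lemma pairprod_add:
  "pairprod F (m + s) g =
    pairprod F m g * (\<Prod>j<s. \<Prod>i<m. F (g i) (g (m + j))) * pairprod F s (\<lambda>j. g (m + j))"
  by (induction s) (simp_all add: pairprod_Suc prod_lessThan_add mult_ac)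

text \<open>Splits the pairs by whether their indices lie in different blocks of length
  \<open>s\<close> or in the same one.\<close>

lemma pairprod_mult:
  "pairprod F (q * s) g =
    pairprod (\<lambda>a b. \<Prod>j<s. \<Prod>i<s. F (g (a * s + i)) (g (b * s + j))) q (\<lambda>a. a) *
    (\<Prod>a<q. pairprod F s (\<lambda>i. g (a * s + i)))"
proof (induction q)
  case (Suc q)
  have "(\<Prod>j<s. \<Prod>i<q * s. F (g i) (g (q * s + j))) =
      (\<Prod>a<q. \<Prod>j<s. \<Prod>i<s. F (g (a * s + i)) (g (q * s + j)))"
    unfolding prod_lessThan_mult by (rule prod.swap)
  moreover have "pairprod F (Suc q * s) g = pairprod F (q * s + s) g" by (simp add: add.commute)
  ultimately show ?case
    unfolding pairprod_add Suc by (simp add: pairprod_Suc mult_ac)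
qed simp

text \<open>The product over ordered pairs is unchanged when the entries of \<open>g\<close> are
  permuted; this makes the square of a Vandermonde product independent of the order of its
  entries.\<close>

lemma pairprod_swap_mult:
  assumes anti: "\<And>x y. F y x = - F x y"
  shows "(- 1) ^ card (pairs m) * (pairprod F m g * pairprod F m g) =
    (\<Prod>(i, j)\<in>{(i, j). i < m \<and> j < m \<and> i \<noteq> j}. F (g i) (g j))"
proof -
  have eq: "{(i, j). i < m \<and> j < m \<and> i \<noteq> j} = pairs m \<union> prod.swap ` pairs m"
    by (auto simp: pairs_def image_iff)
  have "(\<Prod>(i, j)\<in>{(i, j). i < m \<and> j < m \<and> i \<noteq> j}. F (g i) (g j)) =
      (\<Prod>(i, j)\<in>pairs m. F (g i) (g j)) * (\<Prod>(i, j)\<in>prod.swap ` pairs m. F (g i) (g j))"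
    unfolding eq by (rule prod.union_disjoint[OF finite_pairs finite_imageI[OF finite_pairs]]) (auto simp: pairs_def)
  also have "(\<Prod>(i, j)\<in>prod.swap ` pairs m. F (g i) (g j)) = (\<Prod>(i, j)\<in>pairs m. F (g j) (g i))"
    by (subst prod.reindex) (auto simp: case_prod_beta)
  also have "\<dots> = (\<Prod>(i, j)\<in>pairs m. (- 1) * F (g i) (g j))"
    by (rule prod.cong[OF refl]) (clarsimp, rule anti)
  also have "\<dots> = (- 1) ^ card (pairs m) * (\<Prod>(i, j)\<in>pairs m. F (g i) (g j))"
    unfolding case_prod_beta prod.distrib by simp
  finally show ?thesis by (simp add: pairprod_def mult_ac)
qed

context elementary_abelian
begin

lemma prime_P: "prime P" using prime_p by simp

lemma power_p_cong: "[z ^ p = z] (mod P)" for z :: int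
proof (cases "P dvd z")
  case True
  then have "P dvd z ^ p" using p_pos by (meson dvd_power dvd_trans)
  with True show ?thesis by (simp add: cong_iff_dvd_diff)
next
  case False
  define a where "a = nat (z mod P)"
  have a: "[int a = z] (mod P)" by (simp add: a_def cong_def)
  have "\<not> p dvd a" using False a by (simp add: cong_dvd_iff flip: int_dvd_int_iff)
  then have "[a ^ (p - 1) = 1] (mod p)" by (rule fermat_theorem[OF prime_p])
  then have "[int a ^ (p - 1) = 1] (mod P)" using cong_int_iff[of "a ^ (p - 1)" 1 p] by simp
  then have "[int a ^ (p - 1) * int a = 1 * int a] (mod P)" by (rule cong_scalar_right)
  moreover have "int a ^ (p - 1) * int a = int a ^ p" using p_pos by (metis power_minus_mult)
  moreover have "[int a ^ p = z ^ p] (mod P)" using a by (rule cong_pow)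
  ultimately show ?thesis using a by (metis cong_sym cong_trans mult_1)
qed

lemma power_p_power_cong: "[z ^ (p ^ m) = z] (mod P)" for z :: int
proof (induction m)
  case (Suc m)
  have "z ^ (p ^ Suc m) = (z ^ (p ^ m)) ^ p" by (simp add: power_mult[symmetric] mult.commute)
  then show ?case using power_p_cong[of "z ^ (p ^ m)"] Suc by (simp add: cong_trans[of _ "z ^ (p ^ m)"])
qed simp

text \<open>Modulo \<open>p\<close>, the differences to \<open>y 0\<close> run through all nonzero
  residues.\<close>

lemma prod_translate_cong:
  assumes "inj_on y {..<p}" "\<And>i. i < p \<Longrightarrow> 0 \<le> y i \<and> y i < P"
  shows "[(\<Prod>i\<in>{..p - 1} - {0}. y i - y 0) = \<Prod>{1..<P}] (mod P)"
proof -
  let ?I = "{..p - 1} - {0::nat}"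
  let ?f = "\<lambda>i. (y i - y 0) mod P"
  have lt: "i < p" if "i \<in> ?I" for i using that p_gt_1 by auto
  have eqD: "y i = y j" if "i < p" "j < p" "[y i = y j] (mod P)" for i j
    using assms(2)[OF that(1)] assms(2)[OF that(2)] that(3) by (simp add: cong_def)
  have inj: "inj_on ?f ?I"
  proof (rule inj_onI)
    fix i j assume ij: "i \<in> ?I" "j \<in> ?I" and "?f i = ?f j"
    then have "[y i - y 0 = y j - y 0] (mod P)" by (simp add: cong_def)
    then have "[y i = y j] (mod P)" by (simp add: cong_iff_dvd_diff)
    then show "i = j" using ij lt eqD assms(1) by (meson inj_onD lessThan_iff)
  qed
  have "?f i \<noteq> 0" if "i \<in> ?I" for i
  proof
    assume "?f i = 0"
    then have "[y i = y 0] (mod P)" by (simp add: cong_iff_dvd_diff mod_eq_0_iff_dvd)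
    then have "i = 0" using lt[OF that] eqD[of i 0] assms(1) p_pos by (meson inj_onD lessThan_iff)
    with that show False by simp
  qed
  moreover have "0 \<le> ?f i" "?f i < P" for i by simp_all
  ultimately have "?f ` ?I \<subseteq> {1..<P}"
    by (intro image_subsetI) (metis atLeastLessThan_iff int_one_le_iff_zero_less order_less_le)
  moreover have "card (?f ` ?I) = card {1..<P}" using inj by (simp add: card_image)
  ultimately have img: "?f ` ?I = {1..<P}" by (intro card_subset_eq) auto
  have "[(\<Prod>i\<in>?I. y i - y 0) = (\<Prod>i\<in>?I. ?f i)] (mod P)" by (intro cong_prod) simp
  also have "(\<Prod>i\<in>?I. ?f i) = \<Prod>{1..<P}"
    unfolding img[symmetric] using inj by (simp add: prod.reindex)
  finally show ?thesis .
qed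

abbreviation "diff \<equiv> \<lambda>u v :: int. v - u"

text \<open>Here a weight factor meets an Euler factor. Multiplied by the differences to
  \<open>y 0\<close>, whose product is a constant unit modulo \<open>p\<close>, their product
  becomes the square of the full Vandermonde product, which depends on the set of values alone. So
  every order of the values on a line gives the same unit.\<close>

lemma pairprod_line:
  obtains \<kappa> where "\<not> P dvd \<kappa>"
    "\<And>y. \<lbrakk>inj_on y {..<p}; \<And>i. i < p \<Longrightarrow> 0 \<le> y i \<and> y i < P\<rbrakk> \<Longrightarrow>
      [pairprod diff (p - 1) (\<lambda>j. y (Suc j)) * pairprod diff p y = \<kappa>] (mod P)"
proof
  define X where "X = (\<lambda>y. pairprod diff (p - 1) (\<lambda>j. y (Suc j)) * pairprod diff p y)"
  define s where "s = (- 1 :: int) ^ card (pairs p)"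
  \<comment> \<open>The enumeration \<open>y\<close> does not occur here: only the set of residues
    matters.\<close>
  define E where "E = (\<Prod>(u, v)\<in>{(u, v). u \<in> {0..<P} \<and> v \<in> {0..<P} \<and> u \<noteq> v}. v - u)"
  have XW: "X y * (\<Prod>i\<in>{..p - 1} - {0}. y i - y 0) = pairprod diff p y * pairprod diff p y" for y
  proof -
    have "y \<circ> skip 0 = (\<lambda>j. y (Suc j))" by (auto simp: skip_def)
    then have "pairprod diff (Suc (p - 1)) y =
        pairprod diff (p - 1) (\<lambda>j. y (Suc j)) * (\<Prod>i\<in>{..p - 1} - {0}. y i - y 0)"
      using pairprod_remove[of 0 "p - 1" diff y] by simp
    then show ?thesis using p_pos by (simp add: X_def)
  qed
  have sE: "s * (pairprod diff p y * pairprod diff p y) = E"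
    if inj: "inj_on y {..<p}" and range: "\<And>i. i < p \<Longrightarrow> 0 \<le> y i \<and> y i < P" for y
  proof -
    let ?O = "{(i, j). i < p \<and> j < p \<and> i \<noteq> j}"
    have "y ` {..<p} = {0..<P}"
      by (rule card_subset_eq) (use range inj in \<open>auto simp: card_image\<close>)
    then have bij: "bij_betw y {..<p} {0..<P}" using inj by (simp add: bij_betw_def)
    have "bij_betw (map_prod y y) ?O {(u, v). u \<in> {0..<P} \<and> v \<in> {0..<P} \<and> u \<noteq> v}"
    proof (rule bij_betw_subset[OF bij_betw_map_prod[OF bij bij]])
      show "?O \<subseteq> {..<p} \<times> {..<p}" by auto
      show "map_prod y y ` ?O = {(u, v). u \<in> {0..<P} \<and> v \<in> {0..<P} \<and> u \<noteq> v}"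
      proof (intro Set.set_eqI iffI)
        fix z assume "z \<in> map_prod y y ` ?O"
        then show "z \<in> {(u, v). u \<in> {0..<P} \<and> v \<in> {0..<P} \<and> u \<noteq> v}"
          using range inj by (auto simp: inj_on_def)
      next
        fix z assume "z \<in> {(u, v). u \<in> {0..<P} \<and> v \<in> {0..<P} \<and> u \<noteq> v}"
        then obtain u v where z: "z = (u, v)" "u \<in> {0..<P}" "v \<in> {0..<P}" "u \<noteq> v" by auto
        then obtain i j where "i < p" "j < p" "u = y i" "v = y j"
          using \<open>y ` {..<p} = {0..<P}\<close> by (metis imageE lessThan_iff)
        then show "z \<in> map_prod y y ` ?O"
          using z by (intro image_eqI[of _ _ "(i, j)"]) auto
      qed
    qed
    then have "(\<Prod>x\<in>?O. case map_prod y y x of (u, v) \<Rightarrow> v - u) = E"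
      unfolding E_def by (rule prod.reindex_bij_betw)
    then show ?thesis
      unfolding s_def by (subst pairprod_swap_mult) (simp_all add: case_prod_beta)
  qed
  have inj_int: "inj_on int {..<p}" and range_int: "0 \<le> int i \<and> int i < P" if "i < p" for i
    using that by auto
  have inj_int: "inj_on int {..<p}" by simp
  have V: "\<not> P dvd pairprod diff p int"
  proof
    assume "P dvd pairprod diff p int"
    then obtain z where "z \<in> pairs p" "P dvd (case z of (i, j) \<Rightarrow> int j - int i)"
      unfolding pairprod_def using prime_dvd_prod_iff[OF finite_pairs prime_P] by blast
    then obtain i j where "i < j" "j < p" "P dvd int j - int i" by (auto simp: pairs_def)
    then show False using zdvd_imp_le[of P "int j - int i"] by auto
  qed
  have \<omega>: "\<not> P dvd \<Prod>{1..<P}"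
  proof
    assume "P dvd \<Prod>{1..<P}"
    then obtain z where "z \<in> {1..<P}" "P dvd z"
      using prime_dvd_prod_iff[OF _ prime_P, of "{1..<P}" "\<lambda>z. z"] by auto
    then show False using zdvd_imp_le[of P z] by auto
  qed
  show "\<not> P dvd X int"
  proof
    assume "P dvd X int"
    then have "P dvd pairprod diff p int * pairprod diff p int"
      unfolding XW[symmetric] by (rule dvd_mult2)
    then show False using V prime_P by (simp add: prime_dvd_mult_iff)
  qed
  fix y :: "nat \<Rightarrow> int" assume y: "inj_on y {..<p}" "\<And>i. i < p \<Longrightarrow> 0 \<le> y i \<and> y i < P"
  have "s * s = 1" by (simp add: s_def flip: power_add)
  then have sq: "pairprod diff p y * pairprod diff p y = pairprod diff p int * pairprod diff p int"
    using sE[OF y] sE[OF inj_int range_int] by (metis mult.assoc mult_1)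
  let ?w = "\<lambda>y. \<Prod>i\<in>{..p - 1} - {0}. y i - y 0"
  have 1: "[X y * ?w y = X y * \<Prod>{1..<P}] (mod P)"
    by (rule cong_scalar_left[OF prod_translate_cong[OF y]])
  have 2: "[X int * ?w int = X int * \<Prod>{1..<P}] (mod P)"
    by (rule cong_scalar_left[OF prod_translate_cong[OF inj_int range_int]])
  have 3: "X y * ?w y = X int * ?w int" by (simp only: XW sq)
  have "[X y * \<Prod>{1..<P} = X int * \<Prod>{1..<P}] (mod P)"
    by (rule cong_trans[OF cong_sym[OF 1[unfolded 3]] 2])
  then have "P dvd (X y - X int) * \<Prod>{1..<P}"
    by (simp add: cong_iff_dvd_diff left_diff_distrib)
  then have "[X y = X int] (mod P)"
    using \<omega> prime_P by (auto simp: prime_dvd_mult_iff cong_iff_dvd_diff)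
  then show "[pairprod diff (p - 1) (\<lambda>j. y (Suc j)) * pairprod diff p y = X int] (mod P)"
    by (simp add: X_def)
qed

text \<open>The paths are built value by value: position \<open>m + 1\<close> must avoid the
  \<open>m mod e + 1\<close> distinct values before it in its window, which leaves
  \<open>p - 1 - m mod e\<close> choices, a number strictly between \<open>0\<close> and
  \<open>p\<close>.\<close>

lemma valid_paths_card:
  assumes e: "0 < e" "e < p"
  shows "\<not> p dvd card {y \<in> {..m} \<rightarrow>\<^sub>E {0..<P}. y 0 = 0 \<and>
     (\<forall>i j l. l * e \<le> i \<and> i < j \<and> j \<le> l * e + e \<and> j \<le> m \<longrightarrow> y i \<noteq> y j)}"
    (is "\<not> p dvd card (?W m)")
proof (induction m)
  case 0
  have "?W 0 = {\<lambda>i\<in>{..0}. 0}"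
    using p_pos by (auto simp: PiE_iff extensional_def fun_eq_iff)
  then show ?case using p_gt_1 by simp
next
  case (Suc m)
  define q where "q = m div e * e"
  have q: "q \<le> m" "m < q + e" "m - q = m mod e"
    using div_mult_mod_eq[of m "e"] mod_less_divisor[OF e(1), of m] unfolding q_def by linarith+
  \<comment> \<open>Neighbouring windows share an end point, but \<open>Suc m\<close> has
    predecessors inside one window only.\<close>
  have l_eq: "l = m div e" if "l * e \<le> m" "Suc m \<le> l * e + e" for l
    using that by (intro div_nat_eqI[symmetric]) (auto simp: mult.commute)
  let ?S = "\<lambda>y. {0..<P} - y ` {q..m}"
  have card_S: "card (?S y) = p - Suc (m mod e)" if y: "y \<in> ?W m" for y
  proof -
    have "inj_on y {q..m}"
    proof (rule linorder_inj_onI)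
      fix i j assume "i < j" "i \<in> {q..m}" "j \<in> {q..m}"
      then have "m div e * e \<le> i \<and> i < j \<and> j \<le> m div e * e + e \<and> j \<le> m"
        using q by (auto simp: q_def)
      then show "y i \<noteq> y j" using y by blast
    qed auto
    then have "card (y ` {q..m}) = Suc (m mod e)" using q by (simp add: card_image Suc_diff_le)
    moreover have "y ` {q..m} \<subseteq> {0..<P}" using y by (auto simp: PiE_iff)
    ultimately show ?thesis by (subst card_Diff_subset) auto
  qed
  have "bij_betw (\<lambda>(y, v). y(Suc m := v)) (Sigma (?W m) ?S) (?W (Suc m))"
  proof (rule bij_betw_byWitness[where f' = "\<lambda>y. (restrict y {..m}, y (Suc m))"])
    show "\<forall>a\<in>Sigma (?W m) ?S. (restrict (case a of (y, v) \<Rightarrow> y(Suc m := v)) {..m}, (case a of (y, v) \<Rightarrow> y(Suc m := v)) (Suc m)) = a"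
      by (auto simp: PiE_iff extensional_def fun_eq_iff)
    show "\<forall>y\<in>?W (Suc m). (case (restrict y {..m}, y (Suc m)) of (y, v) \<Rightarrow> y(Suc m := v)) = y"
      by (auto simp: PiE_iff extensional_def fun_eq_iff)
    show "(\<lambda>(y, v). y(Suc m := v)) ` Sigma (?W m) ?S \<subseteq> ?W (Suc m)"
    proof (intro image_subsetI)
      fix z assume "z \<in> Sigma (?W m) ?S"
      then obtain y v where z: "z = (y, v)" and y: "y \<in> {..m} \<rightarrow>\<^sub>E {0..<P}" "y 0 = 0"
        "\<forall>i j l. l * e \<le> i \<and> i < j \<and> j \<le> l * e + e \<and> j \<le> m \<longrightarrow> y i \<noteq> y j"
        and v: "v \<in> {0..<P}" "v \<notin> y ` {q..m}" by blast
      let ?y = "y(Suc m := v)"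
      have y1: "?y \<in> {..Suc m} \<rightarrow>\<^sub>E {0..<P}"
        using y(1) v by (auto simp: PiE_iff extensional_def)
      have y2: "?y i \<noteq> ?y j"
        if "l * e \<le> i" "i < j" "j \<le> l * e + e" "j \<le> Suc m" for i j l
      proof (cases "j = Suc m")
        case True
        then have "l = m div e" using that by (intro l_eq) auto
        then have "i \<in> {q..m}" using that True by (auto simp: q_def)
        then show ?thesis using v True by auto
      next
        case False
        then have "l * e \<le> i \<and> i < j \<and> j \<le> l * e + e \<and> j \<le> m" using that by simp
        then have "y i \<noteq> y j" using y(3) by blast
        then show ?thesis using that False by simp
      qed
      have "?y 0 = 0" using y(2) by simp
      then have "?y \<in> ?W (Suc m)" using y1 y2 by blast
      then show "(case z of (y, v) \<Rightarrow> y(Suc m := v)) \<in> ?W (Suc m)" by (simp only: z prod.case)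
    qed
    show "(\<lambda>y. (restrict y {..m}, y (Suc m))) ` ?W (Suc m) \<subseteq> Sigma (?W m) ?S"
    proof (rule image_subsetI)
      fix y assume y: "y \<in> ?W (Suc m)"
      have "y (Suc m) \<noteq> y i" if "i \<in> {q..m}" for i
      proof -
        have "m div e * e \<le> i \<and> i < Suc m \<and> Suc m \<le> m div e * e + e \<and> Suc m \<le> Suc m"
          using that q by (auto simp: q_def)
        then have "y i \<noteq> y (Suc m)" using y by blast
        then show ?thesis by simp
      qed
      then have 1: "y (Suc m) \<in> ?S (restrict y {..m})"
        using y q(1) by (auto simp: PiE_iff image_iff)
      have 2: "restrict y {..m} i \<noteq> restrict y {..m} j"
        if "l * e \<le> i" "i < j" "j \<le> l * e + e" "j \<le> m" for i j l
      proof -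
        have "l * e \<le> i \<and> i < j \<and> j \<le> l * e + e \<and> j \<le> Suc m" using that by simp
        then have "y i \<noteq> y j" using y by blast
        then show ?thesis using that by simp
      qed
      have "restrict y {..m} \<in> {..m} \<rightarrow>\<^sub>E {0..<P}" "restrict y {..m} 0 = 0"
        using y by (auto simp: PiE_iff)
      with 2 have "restrict y {..m} \<in> ?W m" by blast
      with 1 show "(restrict y {..m}, y (Suc m)) \<in> Sigma (?W m) ?S" by (rule SigmaI[rotated])
    qed
  qed
  then have "card (?W (Suc m)) = card (Sigma (?W m) ?S)" by (rule bij_betw_same_card[symmetric])
  also have "\<dots> = (\<Sum>y\<in>?W m. card (?S y))"
    by (rule card_SigmaI) (auto intro: finite_subset[of _ "{..m} \<rightarrow>\<^sub>E {0..<P}"] finite_PiE)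
  also have "\<dots> = (\<Sum>y\<in>?W m. p - Suc (m mod e))" by (intro sum.cong refl card_S)
  also have "\<dots> = card (?W m) * (p - Suc (m mod e))" by simp
  finally have "card (?W (Suc m)) = card (?W m) * (p - Suc (m mod e))" .
  moreover have "0 < p - Suc (m mod e)" "p - Suc (m mod e) < p"
    using mod_less_divisor[OF e(1), of m] e(2) by linarith+
  then have "\<not> p dvd p - Suc (m mod e)" using nat_dvd_not_less by blast
  ultimately show ?case using Suc prime_p by (simp add: prime_dvd_mult_iff)
qed

end

section \<open>Shuffles that visit the whole group\<close>

lemma step_count_const:
  assumes "u \<le> v" "\<And>j. \<lbrakk>u \<le> j; j < v\<rbrakk> \<Longrightarrow> c j \<noteq> k"
  shows "step_count c k v = step_count c k u"
  using assms by (induction rule: dec_induct) auto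

lemma mult_minus_one_div: "0 < w \<Longrightarrow> (q * w - 1) div w = q - 1" for q w :: nat
proof (cases q)
  case (Suc q')
  assume w: "0 < w"
  then show ?thesis using Suc by (intro div_nat_eqI) (auto simp: algebra_simps)
qed simp

context elementary_abelian
begin

text \<open>The labels agree from coordinate \<open>k\<close> on, so the \<open>k\<close> lower
  coordinates have to tell them apart.\<close>

lemma fibre_card:
  assumes inj: "inj_on g I" and I: "finite I" and g: "\<And>i. i \<in> I \<Longrightarrow> g i \<in> G" and k: "k \<le> n"
    and eq: "\<And>i j k'. \<lbrakk>i \<in> I; j \<in> I; k \<le> k'; k' < n\<rbrakk> \<Longrightarrow> g i k' = g j k'"
  shows "card I \<le> p ^ k"
proof -
  let ?f = "\<lambda>i. restrict (g i) {..<k}"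
  have "inj_on ?f I"
  proof (rule inj_onI)
    fix i j assume ij: "i \<in> I" "j \<in> I" and "?f i = ?f j"
    then have lt: "g i k' = g j k'" if "k' < k" for k' using that by (metis lessThan_iff restrict_apply')
    have "g i = g j"
      by (rule G_eqI[OF g[OF ij(1)] g[OF ij(2)]]) (use lt eq ij in \<open>metis not_less\<close>)
    then show "i = j" using inj ij by (meson inj_onD)
  qed
  then have "card I = card (?f ` I)" by (simp add: card_image)
  also have "\<dots> \<le> card ({..<k} \<rightarrow>\<^sub>E {0..<P})"
  proof (rule card_mono)
    show "finite ({..<k} \<rightarrow>\<^sub>E {0..<P})" by (intro finite_PiE) auto
    show "?f ` I \<subseteq> {..<k} \<rightarrow>\<^sub>E {0..<P}"
      by (intro image_subsetI PiE_I) (use g k G_bounds in \<open>auto simp: less_le_trans\<close>)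
  qed
  also have "\<dots> = p ^ k" by (subst card_PiE) auto
  finally show ?thesis .
qed

lemma geometric: "k \<le> n \<Longrightarrow> (\<Sum>k'\<in>{k..<n}. p ^ (n - 1 - k') * (p - 1)) + 1 = p ^ (n - k)"
proof (induction rule: inc_induct)
  case (step m)
  have "(\<Sum>k'\<in>{m..<n}. p ^ (n - 1 - k') * (p - 1)) + 1 = p ^ (n - 1 - m) * (p - 1) + p ^ (n - Suc m)"
    using step by (simp add: sum.atLeast_Suc_lessThan)
  also have "\<dots> = p ^ (n - Suc m) * (p - 1 + 1)"
    by (simp only: distrib_left mult_1_right diff_diff_left plus_1_eq_Suc)
  also have "p - 1 + 1 = p" using p_pos by linarith
  also have "p ^ (n - Suc m) * p = p ^ Suc (n - Suc m)" by simp
  finally show ?case using step by (simp add: Suc_diff_Suc)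
qed simp

text \<open>This is one step for each of the \<open>p ^ (n - k) - 1\<close> disjoint windows of
  \<open>p ^ k\<close> steps that fit into a block, so the supply is just enough for what
  \<open>window\<close> demands.\<close>

lemma card_shuffle_ge:
  assumes c: "c \<in> shuffle_words B" and k: "k \<le> n"
  shows "card {j. j < N B \<and> k \<le> c j} = B * (p ^ (n - k) - 1)"
proof -
  have eq: "{j. j < N B \<and> k \<le> c j} = (\<Union>k'\<in>{k..<n}. {j. j < N B \<and> c j = k'})"
    using c by (auto simp: shuffle_words_def PiE_iff)
  have "card {j. j < N B \<and> k \<le> c j} = (\<Sum>k'\<in>{k..<n}. card {j. j < N B \<and> c j = k'})"
    unfolding eq by (rule card_UN_disjoint) auto
  also have "\<dots> = (\<Sum>k'\<in>{k..<n}. B * (p ^ (n - 1 - k') * (p - 1)))"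
    by (rule sum.cong) (use c in \<open>auto simp: shuffle_words_def step_count_def num_lines_def\<close>)
  also have "\<dots> = B * (\<Sum>k'\<in>{k..<n}. p ^ (n - 1 - k') * (p - 1))" by (simp only: sum_distrib_left)
  also have "(\<Sum>k'\<in>{k..<n}. p ^ (n - 1 - k') * (p - 1)) = p ^ (n - k) - 1"
    using geometric[OF k] by simp
  finally show ?thesis .
qed

lemma row_le_N: "\<lbrakk>b < B; i < r\<rbrakk> \<Longrightarrow> b * (r - 1) + i \<le> N B"
proof -
  assume "b < B" "i < r"
  then have "b * (r - 1) + i \<le> Suc b * (r - 1)" by simp
  also have "\<dots> \<le> B * (r - 1)" using \<open>b < B\<close> by (intro mult_right_mono) auto
  finally show ?thesis by (simp add: N_def)
qed

lemma step_less_N: "\<lbrakk>b < B; i < r - 1\<rbrakk> \<Longrightarrow> b * (r - 1) + i < N B"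
proof -
  assume "b < B" "i < r - 1"
  then have "b * (r - 1) + i < Suc b * (r - 1)" by simp
  also have "\<dots> \<le> B * (r - 1)" using \<open>b < B\<close> by (intro mult_right_mono) auto
  finally show ?thesis by (simp add: N_def)
qed

text \<open>\<open>p ^ k\<close> consecutive steps in directions below \<open>k\<close> would confine \<open>p ^ k + 1\<close> distinct labels to a coset
  of size \<open>p ^ k\<close>.\<close>

lemma window:
  assumes c: "c \<in> shuffle_words B" and x: "x \<in> path_families B" and b: "b < B" and k: "k < n"
    and inj: "inj_on (\<lambda>i. row_label c x (b * (r - 1) + i)) {..<r}"
    and s: "s + p ^ k \<le> r - 1"
  shows "\<exists>i. s \<le> i \<and> i < s + p ^ k \<and> k \<le> c (b * (r - 1) + i)"
proof (rule ccontr)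
  assume neg: "\<not> ?thesis"
  let ?I = "{s..s + p ^ k}"
  have lt: "i < r" if "i \<in> ?I" for i
  proof -
    have "i \<le> r - 1" using that s by simp
    moreover have "0 < r" by simp
    ultimately show ?thesis by linarith
  qed
  have const: "row_label c x (b * (r - 1) + i) k' = row_label c x (b * (r - 1) + s) k'"
    if i: "i \<in> ?I" and k': "k \<le> k'" "k' < n" for i k'
  proof -
    have "step_count c k' (b * (r - 1) + i) = step_count c k' (b * (r - 1) + s)"
    proof (rule step_count_const)
      fix j assume j: "b * (r - 1) + s \<le> j" "j < b * (r - 1) + i"
      then have "s \<le> j - b * (r - 1)" "j - b * (r - 1) < s + p ^ k" "b * (r - 1) + (j - b * (r - 1)) = j"
        using i by auto
      then have "\<not> k \<le> c j" using neg by metis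
      then show "c j \<noteq> k'" using k' by auto
    qed (use i in auto)
    then show ?thesis by (simp add: row_label_def)
  qed
  have "card ?I \<le> p ^ k"
  proof (rule fibre_card)
    show "inj_on (\<lambda>i. row_label c x (b * (r - 1) + i)) ?I"
      by (rule inj_on_subset[OF inj]) (use lt in auto)
    show "row_label c x (b * (r - 1) + i) \<in> G" if "i \<in> ?I" for i
      by (rule row_label_in_G[OF c x row_le_N[OF b lt[OF that]]])
    show "row_label c x (b * (r - 1) + i) k' = row_label c x (b * (r - 1) + j) k'"
      if "i \<in> ?I" "j \<in> ?I" "k \<le> k'" "k' < n" for i j k'
      using const[OF that(1,3,4)] const[OF that(2,3,4)] by simp
  qed (use k in auto)
  then show False by simp
qed

text \<open>The ruler sequence: inside a block, a step goes in the direction of the exponent of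
  \<open>p\<close> in its number, counted from \<open>1\<close>. This is the digit at which an
  odometer stops carrying.\<close>

definition "ruler B c \<longleftrightarrow>
  (\<forall>i<N B. c i < n \<and> (\<forall>k<n. k \<le> c i \<longleftrightarrow> p ^ k dvd Suc (i mod (r - 1))))"

text \<open>A counting argument: there are only as many steps of direction at least \<open>k\<close>
  as disjoint windows that need one. If such a step were off the grid of multiples of
  \<open>p ^ k\<close>, the windows of its block could be placed around it, and one step too many
  would be required.\<close>

lemma ruler_of_inj:
  assumes c: "c \<in> shuffle_words B" and x: "x \<in> path_families B"
    and inj: "\<And>b. b < B \<Longrightarrow> inj_on (\<lambda>i. row_label c x (b * (r - 1) + i)) {..<r}"
  shows "ruler B c"
proof -
  have block: "j div (r - 1) < B" "j mod (r - 1) < r - 1" "j div (r - 1) * (r - 1) + j mod (r - 1) = j"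
    if "j < N B" for j
  proof -
    have "0 < r - 1" using that by (cases "r - 1 = 0") (simp_all add: N_def)
    then show "j div (r - 1) < B" "j mod (r - 1) < r - 1"
      using that by (simp_all add: N_def less_mult_imp_div_less)
    show "j div (r - 1) * (r - 1) + j mod (r - 1) = j" by (rule div_mult_mod_eq)
  qed
  have dvd: "p ^ k dvd Suc (j0 mod (r - 1))" if j0: "j0 < N B" "k \<le> c j0" and k: "k < n" for j0 k
  proof (rule ccontr)
    assume ndvd: "\<not> p ^ k dvd Suc (j0 mod (r - 1))"
    define w Q b0 i0 where "w = p ^ k" and "Q = p ^ (n - k)" and "b0 = j0 div (r - 1)" and "i0 = j0 mod (r - 1)"
    have w: "0 < w" by (simp add: w_def)
    have rQ: "r = Q * w" using k by (simp add: Q_def w_def flip: power_add)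
    define q where "q = Suc i0 div w"
    have q: "q * w < Suc i0" "Suc i0 < Suc q * w"
    proof -
      have "q * w + Suc i0 mod w = Suc i0" by (simp add: q_def)
      moreover have "Suc i0 mod w \<noteq> 0" using ndvd by (simp add: w_def i0_def mod_eq_0_iff_dvd)
      moreover have "Suc i0 mod w < w" using w by simp
      ultimately show "q * w < Suc i0" "Suc i0 < Suc q * w" by simp_all
    qed
    define D where "D = {j. j < N B \<and> k \<le> c j}"
    \<comment> \<open>Assigns to a step its block and the number of its window. In block
      \<open>b0\<close> the windows before \<open>i0\<close> start at \<open>m * w\<close> with
      \<open>m < q\<close>, those after it at \<open>(m + 1) * w - 1\<close> with
      \<open>m \<ge> q\<close>. Since \<open>i0 + 1\<close> is not a multiple of \<open>w\<close>,
      \<open>i0\<close> falls into the gap between them, and still \<open>Q - 1\<close> windows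
      fit.\<close>
    define dec where "dec = (\<lambda>j. (j div (r - 1),
       if j div (r - 1) = b0 \<and> i0 < j mod (r - 1) then Suc (j mod (r - 1)) div w - 1
       else j mod (r - 1) div w))"
    have "{..<B} \<times> {..<Q - 1} \<subseteq> dec ` (D - {j0})"
    proof clarify
      fix b m assume b: "b < B" and m: "m < Q - 1"
      have hit: "(b, m) \<in> dec ` (D - {j0})"
        if i: "i < r - 1" "k \<le> c (b * (r - 1) + i)"
          and d: "(if b = b0 \<and> i0 < i then Suc i div w - 1 else i div w) = m"
          and ne: "b = b0 \<Longrightarrow> i \<noteq> i0" for i
      proof -
        let ?j = "b * (r - 1) + i"
        have j: "?j div (r - 1) = b" "?j mod (r - 1) = i" using i by auto
        have "?j \<in> D" using step_less_N[OF b i(1)] i(2) by (simp add: D_def)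
        moreover have "?j \<noteq> j0" using ne j by (auto simp: b0_def i0_def)
        moreover have "dec ?j = (b, m)" using d unfolding dec_def j by simp
        ultimately show ?thesis by (metis DiffI image_eqI singletonD)
      qed
      have bound: "(m + 2) * w \<le> r" unfolding rQ by (rule mult_right_mono) (use m in auto)
      show "(b, m) \<in> dec ` (D - {j0})"
      proof (cases "b = b0 \<and> q \<le> m")
        case True
        have "(m + 1) * w - 1 + p ^ k \<le> r - 1" using bound w unfolding w_def[symmetric] by simp
        from window[OF c x b k inj[OF b] this] obtain i where
          i: "(m + 1) * w - 1 \<le> i" "i < (m + 1) * w - 1 + w" "k \<le> c (b * (r - 1) + i)"
          unfolding w_def by blast
        have "Suc q * w \<le> (m + 1) * w" by (rule mult_right_mono) (use True in auto)
        then have "i0 < i" using q i(1) by linarith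
        moreover have "Suc i div w = m + 1"
          by (rule div_nat_eqI) (use i w in \<open>auto simp: algebra_simps\<close>)
        moreover have "i < r - 1" using i(2) bound by (simp add: algebra_simps)
        ultimately show ?thesis using i True by (intro hit) auto
      next
        case False
        have "m * w + p ^ k \<le> r - 1" using bound w unfolding w_def[symmetric] by simp
        from window[OF c x b k inj[OF b] this] obtain i where
          i: "m * w \<le> i" "i < m * w + w" "k \<le> c (b * (r - 1) + i)"
          unfolding w_def by blast
        have lt: "i < i0" if "b = b0"
        proof -
          have "Suc m * w \<le> q * w" by (rule mult_right_mono) (use False that in auto)
          then show ?thesis using i q by simp
        qed
        moreover have "i div w = m"
          by (rule div_nat_eqI) (use i in \<open>auto simp: algebra_simps\<close>)
        moreover have "i < r - 1" using i(2) bound w by (simp add: algebra_simps)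
        ultimately show ?thesis using i by (intro hit) (auto dest: lt)
      qed
    qed
    then have "card ({..<B} \<times> {..<Q - 1}) \<le> card (D - {j0})"
      by (rule surj_card_le[rotated]) (simp add: D_def)
    moreover have "card D = B * (Q - 1)" using card_shuffle_ge[OF c] k by (simp add: D_def Q_def)
    moreover have "j0 \<in> D" "finite D" using j0 by (auto simp: D_def)
    then have "card D = Suc (card (D - {j0}))" by (intro card.remove)
    ultimately show False by simp
  qed
  show ?thesis
    unfolding ruler_def
  proof (intro allI impI conjI iffI)
    fix j assume j: "j < N B"
    show "c j < n" using c j by (auto simp: shuffle_words_def PiE_iff)
    fix k assume k: "k < n"
    show "p ^ k dvd Suc (j mod (r - 1))" if "k \<le> c j" using dvd[OF j that k] .
    assume "p ^ k dvd Suc (j mod (r - 1))"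
    then obtain m where m: "Suc (j mod (r - 1)) = Suc m * p ^ k"
      by (metis dvd_def mult.commute mult_0 nat.distinct(1) not0_implies_Suc)
    \<comment> \<open>The window that ends with step \<open>j\<close> contains a step of direction
      at least \<open>k\<close>, and by \<open>dvd\<close> only its last step is in
      question.\<close>
    have "m * p ^ k + p ^ k \<le> r - 1" using m block(2)[OF j] by simp
    from window[OF c x block(1)[OF j] k inj[OF block(1)[OF j]] this] obtain i where
      i: "m * p ^ k \<le> i" "i < m * p ^ k + p ^ k" "k \<le> c (j div (r - 1) * (r - 1) + i)" by blast
    have ir: "i < r - 1" using i m block(2)[OF j] by simp
    have "p ^ k dvd Suc i"
      using dvd[OF step_less_N[OF block(1)[OF j] ir] i(3) k] ir by simp
    then obtain m' where m': "Suc i = m' * p ^ k" by (metis dvd_def mult.commute)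
    have "m * p ^ k < m' * p ^ k" "m' * p ^ k \<le> m * p ^ k + p ^ k" using i m' by linarith+
    then have "m * p ^ k < m' * p ^ k" "m' * p ^ k \<le> Suc m * p ^ k" by simp_all
    then have "m < m'" "m' \<le> Suc m" using p_pos by (simp_all only: mult_less_cancel2 mult_le_cancel2 zero_less_power simp_thms)
    then have "m' = Suc m" by simp
    then have "i = j mod (r - 1)" using m m' by simp
    then show "k \<le> c j" using i(3) block(3)[OF j] by simp
  qed
qed

text \<open>Coordinate \<open>k\<close> moves at the multiples of \<open>p ^ k\<close> that are not
  multiples of \<open>p ^ Suc k\<close>. The latter are added on the left, which avoids subtraction
  of naturals.\<close>

lemma step_count_ruler:
  assumes c: "ruler B c" and k: "k < n"
  shows "b \<le> B \<Longrightarrow> step_count c k (b * (r - 1)) = b * p ^ (n - 1 - k) * (p - 1)"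
    and "\<lbrakk>b < B; i < r\<rbrakk> \<Longrightarrow> step_count c k (b * (r - 1) + i) + i div p ^ Suc k =
      b * p ^ (n - 1 - k) * (p - 1) + i div p ^ k"
proof -
  \<comment> \<open>Stated relative to the count at the start of the block, because that count is
    itself obtained from the last row of the block before.\<close>
  have step: "step_count c k (b * (r - 1) + i) + i div p ^ Suc k =
      b * p ^ (n - 1 - k) * (p - 1) + i div p ^ k"
    if b: "b < B" and start: "step_count c k (b * (r - 1)) = b * p ^ (n - 1 - k) * (p - 1)" and "i < r" for b i
    using \<open>i < r\<close>
  proof (induction i)
    case (Suc i)
    let ?j = "b * (r - 1) + i"
    have i: "i < r - 1" using Suc by simp
    have jN: "?j < N B" by (rule step_less_N[OF b i])
    have jm: "?j mod (r - 1) = i" using i by simp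
    have ge: "k' \<le> c ?j \<longleftrightarrow> p ^ k' dvd Suc i" if "k' < n" for k'
    proof -
      have "\<forall>k<n. k \<le> c ?j \<longleftrightarrow> p ^ k dvd Suc (?j mod (r - 1))" using c jN unfolding ruler_def by blast
      then show ?thesis using that unfolding jm by blast
    qed
    have "c ?j < n" using c jN by (auto simp: ruler_def)
    have "Suc k \<le> c ?j \<longleftrightarrow> p ^ Suc k dvd Suc i"
    proof (cases "Suc k < n")
      case False
      then have "Suc k = n" using k by simp
      moreover have "\<not> r dvd Suc i" using Suc.prems by (auto dest: dvd_imp_le)
      ultimately show ?thesis using \<open>c ?j < n\<close> by auto
    qed (rule ge)
    then have ck: "c ?j = k \<longleftrightarrow> p ^ k dvd Suc i \<and> \<not> p ^ Suc k dvd Suc i" using ge[OF k] by auto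
    have imp: "p ^ k dvd Suc i" if "p ^ Suc k dvd Suc i" using that by (metis dvd_mult_right power_Suc)
    have IH: "step_count c k ?j + i div p ^ Suc k = b * p ^ (n - 1 - k) * (p - 1) + i div p ^ k"
      using Suc by simp
    have "Suc i div p ^ k = i div p ^ k + (if p ^ k dvd Suc i then 1 else 0)"
      "Suc i div p ^ Suc k = i div p ^ Suc k + (if p ^ Suc k dvd Suc i then 1 else 0)"
      by (simp_all only: div_Suc mod_eq_0_iff_dvd split: if_splits) simp_all
    moreover have "step_count c k (b * (r - 1) + Suc i) = step_count c k ?j + (if c ?j = k then 1 else 0)" by simp
    ultimately show ?case
      using IH ck imp by (simp only: split: if_splits) auto
  qed (use start in simp)
  show start: "step_count c k (b * (r - 1)) = b * p ^ (n - 1 - k) * (p - 1)" if "b \<le> B" for b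
    using that
  proof (induction b)
    case (Suc b)
    have "step_count c k (b * (r - 1) + (r - 1)) + (r - 1) div p ^ Suc k =
      b * p ^ (n - 1 - k) * (p - 1) + (r - 1) div p ^ k"
      by (rule step) (use Suc in auto)
    moreover have "(r - 1) div p ^ k = p ^ (n - 1 - k) * p - 1"
    proof -
      have "r = (p ^ (n - 1 - k) * p) * p ^ k"
      proof -
        have "r = p ^ ((n - 1 - k) + 1 + k)" using k by simp
        then show ?thesis by (simp only: power_add power_one_right)
      qed
      then show ?thesis by (metis mult_minus_one_div p_pos zero_less_power)
    qed
    moreover have "(r - 1) div p ^ Suc k = p ^ (n - 1 - k) - 1"
    proof -
      have "r = p ^ ((n - 1 - k) + Suc k)" using k by simp
      then have "r = p ^ (n - 1 - k) * p ^ Suc k" by (simp only: power_add)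
      then show ?thesis by (metis mult_minus_one_div p_pos zero_less_power)
    qed
    ultimately have *: "step_count c k (b * (r - 1) + (r - 1)) + (p ^ (n - 1 - k) - 1) =
      b * p ^ (n - 1 - k) * (p - 1) + (p ^ (n - 1 - k) * p - 1)" by (simp only:)
    define X where "X = p ^ (n - 1 - k)"
    have "1 \<le> X" by (simp add: X_def Suc_leI)
    moreover have "X * p = X + X * (p - 1)" using p_gt_1 by (cases p) auto
    ultimately have "step_count c k (b * (r - 1) + (r - 1)) = b * X * (p - 1) + X * (p - 1)"
      using *[folded X_def] by linarith
    then show ?case by (simp add: X_def distrib_right add.commute)
  qed simp
  show "step_count c k (b * (r - 1) + i) + i div p ^ Suc k = b * p ^ (n - 1 - k) * (p - 1) + i div p ^ k"
    if "b < B" "i < r"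
    by (rule step[OF that(1) start that(2)]) (use that in simp)
qed

lemma ruler_unique:
  assumes "c \<in> shuffle_words B" "c' \<in> shuffle_words B" "ruler B c" "ruler B c'"
  shows "c = c'"
proof (rule PiE_ext)
  show "c \<in> {..<N B} \<rightarrow>\<^sub>E {..<n}" "c' \<in> {..<N B} \<rightarrow>\<^sub>E {..<n}" using assms by (auto simp: shuffle_words_def)
  fix i assume "i \<in> {..<N B}"
  then have "c i < n" "c' i < n" "\<forall>k<n. k \<le> c i \<longleftrightarrow> k \<le> c' i"
    using assms(3,4) by (auto simp: ruler_def)
  then show "c i = c' i" by (meson le_antisym order_refl)
qed

lemma ruler_exists:
  assumes n: "0 < n"
  obtains c where "c \<in> shuffle_words B" "ruler B c"
proof -
  define K where "K = (\<lambda>i. {k. k < n \<and> p ^ k dvd Suc (i mod (r - 1))})"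
  define c where "c = (\<lambda>i\<in>{..<N B}. Max (K i))"
  have K: "finite (K i)" "0 \<in> K i" for i using n by (auto simp: K_def)
  then have MK: "Max (K i) \<in> K i" for i by (metis Max_in empty_iff)
  have ruler: "ruler B c"
    unfolding ruler_def
  proof (intro allI impI conjI iffI)
    fix i assume i: "i < N B"
    then have ci: "c i = Max (K i)" by (simp add: c_def)
    show "c i < n" using MK[of i] by (simp add: ci K_def)
    fix k assume k: "k < n"
    show "p ^ k dvd Suc (i mod (r - 1))" if "k \<le> c i"
      using MK[of i] le_imp_power_dvd[OF that] unfolding ci K_def by (auto intro: dvd_trans)
    show "k \<le> c i" if "p ^ k dvd Suc (i mod (r - 1))"
      unfolding ci by (rule Max_ge[OF K(1)]) (use that k in \<open>simp add: K_def\<close>)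
  qed
  have "c \<in> shuffle_words B"
    unfolding shuffle_words_def
  proof (intro CollectI conjI allI impI)
    show "c \<in> {..<N B} \<rightarrow>\<^sub>E {..<n}" using ruler by (auto simp: c_def ruler_def)
    show "step_count c k (N B) = num_lines B k * (p - 1)" if "k < n" for k
      using step_count_ruler(1)[OF ruler that order_refl] by (simp add: N_def num_lines_def)
  qed
  with ruler show thesis by (rule that[rotated])
qed

end

section \<open>The pairing does not vanish\<close>

context elementary_abelian
begin

definition "valid B x \<longleftrightarrow>
  (\<forall>k<n. \<forall>l<num_lines B k. inj_on (\<lambda>d. x k (l * (p - 1) + d)) {..<p})"

text \<open>\<open>t\<close> stands for \<open>i div p ^ k\<close>, the number of multiples of
  \<open>p ^ k\<close> passed in the block. At every \<open>p\<close>-th of them a higher coordinate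
  moves instead, hence \<open>t - t div p\<close>.\<close>

definition "coord B x b k t = x k (b * p ^ (n - 1 - k) * (p - 1) + (t - t div p))"
  for x :: "nat \<Rightarrow> nat \<Rightarrow> int"

lemma row_label_ruler:
  assumes c: "ruler B c" and "b < B" "i < r" "k < n"
  shows "row_label c x (b * (r - 1) + i) k = coord B x b k (i div p ^ k)"
proof -
  have "i div p ^ Suc k = i div p ^ k div p" by (simp only: power_Suc2 div_mult2_eq)
  then have "step_count c k (b * (r - 1) + i) = b * p ^ (n - 1 - k) * (p - 1) + (i div p ^ k - i div p ^ k div p)"
    using step_count_ruler(2)[OF assms(1,4,2,3)] div_le_dividend[of "i div p ^ k" p] by linarith
  then show ?thesis using assms by (simp only: row_label_def coord_def restrict_apply' lessThan_iff)
qed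

lemma coord_line:
  assumes "d < p"
  shows "coord B x b k (h * p + d) = x k ((b * p ^ (n - 1 - k) + h) * (p - 1) + d)"
proof -
  have "(h * p + d) div p = h" using assms by simp
  moreover have "h * p + d - h = h * (p - 1) + d" using p_pos by (cases p) simp_all
  ultimately show ?thesis by (simp only: coord_def distrib_right add.assoc)
qed

text \<open>If a line repeated a value at places \<open>a\<close> and \<open>d\<close>, the
  \<open>2 * p ^ k\<close> rows with \<open>i div p ^ k\<close> equal to \<open>h * p + a\<close> or
  \<open>h * p + d\<close> would agree in all coordinates from \<open>k\<close> on, too many for a
  coset of \<open>p ^ k\<close> elements.\<close>

lemma valid_of_inj:
  assumes c: "c \<in> shuffle_words B" "ruler B c" and x: "x \<in> path_families B"
    and inj: "\<And>b. b < B \<Longrightarrow> inj_on (\<lambda>i. row_label c x (b * (r - 1) + i)) {..<r}"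
  shows "valid B x"
  unfolding valid_def
proof (intro allI impI linorder_inj_onI)
  fix k l a d assume k: "k < n" and l: "l < num_lines B k" and ad: "a < d" "d \<in> {..<p}"
  define m where "m = p ^ (n - 1 - k)"
  \<comment> \<open>Line \<open>l\<close> of coordinate \<open>k\<close> runs in block
    \<open>b\<close> and has number \<open>h\<close> among the \<open>m\<close> lines of that
    block.\<close>
  define b h where "b = l div m" and "h = l mod m"
  have m: "0 < m" by (simp add: m_def)
  have b: "b < B" using l unfolding b_def num_lines_def m_def by (rule less_mult_imp_div_less)
  have h: "h < m" using m by (simp add: h_def)
  have lbh: "l = b * m + h" by (simp add: b_def h_def)
  define w where "w = p ^ k"
  have w: "0 < w" by (simp add: w_def)
  have rw: "r = m * p * w"
  proof -
    have "r = p ^ ((n - 1 - k) + 1 + k)" using k by simp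
    then show ?thesis unfolding m_def w_def by (simp only: power_add power_one_right)
  qed
  let ?I = "\<lambda>e. {(h * p + e) * w..<(h * p + e) * w + w}"
  have I_div: "i div w = h * p + e" if "i \<in> ?I e" for i e
    by (rule div_nat_eqI) (use that in \<open>auto simp: algebra_simps\<close>)
  have I_lt: "i < r" if "i \<in> ?I e" "e < p" for i e
  proof -
    have "i < (h * p + e + 1) * w" using that by (simp add: distrib_right)
    also have "\<dots> \<le> (h * p + p) * w" by (rule mult_right_mono) (use that in auto)
    also have "\<dots> = Suc h * p * w" by simp
    also have "\<dots> \<le> m * p * w" by (intro mult_right_mono) (use h in auto)
    finally show ?thesis unfolding rw .
  qed
  show "x k (l * (p - 1) + a) \<noteq> x k (l * (p - 1) + d)"
  proof
    assume eq: "x k (l * (p - 1) + a) = x k (l * (p - 1) + d)"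
    have ap: "a < p" and dp: "d < p" using ad by auto
    have ce: "coord B x b k (h * p + e) = x k (l * (p - 1) + e)" if "e < p" for e
      unfolding lbh m_def by (rule coord_line[OF that])
    define J where "J = ?I a \<union> ?I d"
    have lt: "i < r" if "i \<in> J" for i using that I_lt ap dp unfolding J_def by blast
    have "card J \<le> p ^ k"
    proof (rule fibre_card)
      show "inj_on (\<lambda>i. row_label c x (b * (r - 1) + i)) J"
        by (rule inj_on_subset[OF inj[OF b]]) (use lt in blast)
      show "row_label c x (b * (r - 1) + i) \<in> G" if "i \<in> J" for i
        by (rule row_label_in_G[OF c(1) x row_le_N[OF b lt[OF that]]])
      have const: "row_label c x (b * (r - 1) + i) k' = coord B x b k' (if k' = k then h * p + a else h div p ^ (k' - Suc k))"
        if i: "i \<in> J" and k': "k \<le> k'" "k' < n" for i k'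
      proof -
        obtain e where e: "e = a \<or> e = d" "i \<in> ?I e" using i unfolding J_def by blast
        have ep: "e < p" using e ap dp by auto
        have iw: "i div p ^ k = h * p + e" using I_div[OF e(2)] by (simp add: w_def)
        show ?thesis
        proof (cases "k' = k")
          case True
          have "coord B x b k (h * p + e) = coord B x b k (h * p + a)"
            using e(1) eq by (auto simp: ce ap dp)
          then show ?thesis using row_label_ruler[OF c(2) b lt[OF i] k'(2)] True iw by simp
        next
          case False
          then have "k' = k + 1 + (k' - Suc k)" using k'(1) by simp
          then have "p ^ k' = p ^ (k + 1 + (k' - Suc k))" by (rule arg_cong)
          then have "p ^ k' = p ^ k * p * p ^ (k' - Suc k)" by (simp only: power_add power_one_right)
          then have "i div p ^ k' = i div p ^ k div p div p ^ (k' - Suc k)" by (simp add: div_mult2_eq)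
          then show ?thesis using row_label_ruler[OF c(2) b lt[OF i] k'(2)] False iw ep by simp
        qed
      qed
      show "row_label c x (b * (r - 1) + i) k' = row_label c x (b * (r - 1) + j) k'"
        if "i \<in> J" "j \<in> J" "k \<le> k'" "k' < n" for i j k'
        using const[OF that(1,3,4)] const[OF that(2,3,4)] by simp
    qed (use k in \<open>auto simp: J_def\<close>)
    moreover have "card J = w + w"
    proof -
      have "?I a \<inter> ?I d = {}"
      proof (rule ccontr)
        assume "?I a \<inter> ?I d \<noteq> {}"
        then obtain i where "i \<in> ?I a" "i \<in> ?I d" by blast
        then show False using I_div ad(1) by (metis add_left_cancel less_irrefl)
      qed
      then show ?thesis unfolding J_def by (subst card_Un_disjoint) auto
    qed
    ultimately show False using w by (simp add: w_def)
  qed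
qed auto

text \<open>Cut \<open>p ^ Suc m\<close> rows into \<open>p\<close> pieces of \<open>p ^ m\<close>
  rows. Coordinates above \<open>m\<close> are constant on all of them, and coordinate
  \<open>m\<close> is constant on each piece and separates the pieces. Two pieces therefore
  contribute one difference of coordinate \<open>m\<close> to the power \<open>p ^ (m + m)\<close>,
  which Fermat reduces to the difference itself. This leaves a Vandermonde product of coordinate
  \<open>m\<close> and the same problem inside each piece.\<close>

lemma pairprod_tau_digits:
  assumes g: "\<And>i k. \<lbrakk>i < r; k < n\<rbrakk> \<Longrightarrow> g i k = Z k (i div p ^ k)"
    and inj: "\<And>k h. \<lbrakk>k < n; h < p ^ (n - 1 - k)\<rbrakk> \<Longrightarrow> inj_on (\<lambda>d. Z k (h * p + d)) {..<p}"
  shows "\<lbrakk>m \<le> n; u < p ^ (n - m)\<rbrakk> \<Longrightarrow> [pairprod tau (p ^ m) (\<lambda>i. g (u * p ^ m + i)) =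
    (\<Prod>k<m. \<Prod>h<p ^ (m - 1 - k). pairprod diff p (\<lambda>d. Z k ((u * p ^ (m - 1 - k) + h) * p + d)))] (mod P)"
proof (induction m arbitrary: u)
  case 0
  have "pairs (Suc 0) = {}" by (auto simp: pairs_def)
  then show ?case by (simp add: pairprod_def)
next
  case (Suc m)
  let ?s = "p ^ m"
  let ?g = "\<lambda>i. g (u * p ^ Suc m + i)"
  have s: "0 < ?s" by simp
  have m: "m < n" using Suc.prems by simp
  have pw: "p ^ (n - m) = p ^ (n - Suc m) * p" using m by (metis Suc_diff_Suc power_Suc2)
  have row: "u * p ^ Suc m + (a * ?s + i) < r" if "a < p" "i < ?s" for a i
  proof -
    have "a * ?s + i < Suc a * ?s" using that by simp
    also have "\<dots> \<le> p * ?s" by (rule mult_right_mono) (use that in auto)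
    finally have "u * p ^ Suc m + (a * ?s + i) < Suc u * p ^ Suc m" by simp
    also have "\<dots> \<le> p ^ (n - Suc m) * p ^ Suc m" by (rule mult_right_mono) (use Suc.prems in auto)
    also have "\<dots> = r" using Suc.prems by (subst power_add[symmetric]) simp
    finally show ?thesis .
  qed
  have dig: "?g (a * ?s + i) k = Z k ((u * p + a) div p ^ (k - m))" if "a < p" "i < ?s" "m \<le> k" "k < n" for a i k
  proof -
    have "u * p ^ Suc m + (a * ?s + i) = (u * p + a) * ?s + i" by (simp add: algebra_simps)
    then have "(u * p ^ Suc m + (a * ?s + i)) div ?s = ((u * p + a) * ?s + i) div ?s" by (simp only:)
    also have "\<dots> = u * p + a" using that by simp
    finally have "(u * p ^ Suc m + (a * ?s + i)) div ?s = u * p + a" .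
    moreover have "p ^ k = ?s * p ^ (k - m)" using that by (simp flip: power_add)
    ultimately show ?thesis using g[OF row[OF that(1,2)] that(4)] by (simp only: div_mult2_eq)
  qed
  have cross: "[(\<Prod>j<?s. \<Prod>i<?s. tau (?g (a * ?s + i)) (?g (b * ?s + j))) =
      Z m (u * p + b) - Z m (u * p + a)] (mod P)" if ab: "a < b" "b < p" for a b
  proof -
    have "tau (?g (a * ?s + i)) (?g (b * ?s + j)) = Z m (u * p + b) - Z m (u * p + a)"
      if ij: "i < ?s" "j < ?s" for i j
    proof -
      have a: "a < p" using ab by simp
      have 1: "?g (a * ?s + i) m = Z m (u * p + a)" "?g (b * ?s + j) m = Z m (u * p + b)"
        using dig[OF a ij(1) order_refl m] dig[OF ab(2) ij(2) order_refl m] by simp_all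
      have "u < p ^ (n - 1 - m)" using Suc.prems by simp
      from inj[OF m this] have "Z m (u * p + a) \<noteq> Z m (u * p + b)"
        using ab by (auto simp: inj_on_def)
      then have "?g (a * ?s + i) m \<noteq> ?g (b * ?s + j) m" unfolding 1 .
      then have "tau (?g (a * ?s + i)) (?g (b * ?s + j)) = ?g (b * ?s + j) m - ?g (a * ?s + i) m"
      proof (rule tau_top[OF m])
        fix k assume k: "m < k" "k < n"
        have "(u * p + e) div p ^ (k - m) = u div p ^ (k - Suc m)" if "e < p" for e
        proof -
          have "p ^ (k - m) = p * p ^ (k - Suc m)" using k by (simp flip: power_Suc add: Suc_diff_Suc)
          then have "(u * p + e) div p ^ (k - m) = (u * p + e) div p div p ^ (k - Suc m)"
            by (simp only: div_mult2_eq)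
          then show ?thesis using that by simp
        qed
        then show "?g (a * ?s + i) k = ?g (b * ?s + j) k"
          using dig[OF a ij(1)] dig[OF ab(2) ij(2)] k a ab(2) by simp
      qed
      then show ?thesis unfolding 1 .
    qed
    then have "(\<Prod>j<?s. \<Prod>i<?s. tau (?g (a * ?s + i)) (?g (b * ?s + j))) =
        (Z m (u * p + b) - Z m (u * p + a)) ^ (p ^ m * p ^ m)"
      by (simp add: power_mult)
    also have "p ^ m * p ^ m = p ^ (m + m)" by (simp add: power_add)
    also have "[(Z m (u * p + b) - Z m (u * p + a)) ^ p ^ (m + m) = Z m (u * p + b) - Z m (u * p + a)] (mod P)"
      by (rule power_p_power_cong)
    finally show ?thesis .
  qed
  have top: "[pairprod (\<lambda>a b. \<Prod>j<?s. \<Prod>i<?s. tau (?g (a * ?s + i)) (?g (b * ?s + j))) p (\<lambda>a. a) =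
      pairprod diff p (\<lambda>d. Z m (u * p + d))] (mod P)"
    by (rule pairprod_cong_mod) (rule cross; assumption)
  let ?V = "\<lambda>k l. pairprod diff p (\<lambda>d. Z k (l * p + d))"
  have sub: "[(\<Prod>a<p. pairprod tau ?s (\<lambda>i. ?g (a * ?s + i))) =
      (\<Prod>k<m. \<Prod>h<p ^ (m - k). ?V k (u * p ^ (m - k) + h))] (mod P)"
  proof -
    have "[pairprod tau ?s (\<lambda>i. ?g (a * ?s + i)) =
        (\<Prod>k<m. \<Prod>h<p ^ (m - 1 - k). ?V k ((u * p + a) * p ^ (m - 1 - k) + h))] (mod P)" if "a < p" for a
    proof -
      have "u * p + a < Suc u * p" using that by simp
      also have "\<dots> \<le> p ^ (n - Suc m) * p" by (rule mult_right_mono) (use Suc.prems in auto)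
      finally have "u * p + a < p ^ (n - m)" unfolding pw .
      from Suc.IH[OF less_imp_le[OF m] this] show ?thesis by (simp add: algebra_simps)
    qed
    then have "[(\<Prod>a<p. pairprod tau ?s (\<lambda>i. ?g (a * ?s + i))) =
        (\<Prod>a<p. \<Prod>k<m. \<Prod>h<p ^ (m - 1 - k). ?V k ((u * p + a) * p ^ (m - 1 - k) + h))] (mod P)"
      by (intro cong_prod) auto
    also have "(\<Prod>a<p. \<Prod>k<m. \<Prod>h<p ^ (m - 1 - k). ?V k ((u * p + a) * p ^ (m - 1 - k) + h)) =
        (\<Prod>k<m. \<Prod>a<p. \<Prod>h<p ^ (m - 1 - k). ?V k ((u * p + a) * p ^ (m - 1 - k) + h))"
      by (rule prod.swap)
    also have "\<dots> = (\<Prod>k<m. \<Prod>h<p ^ (m - k). ?V k (u * p ^ (m - k) + h))"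
    proof (rule prod.cong[OF refl])
      fix k assume "k \<in> {..<m}"
      then have e: "p ^ (m - k) = p * p ^ (m - 1 - k)" by (simp flip: power_Suc add: Suc_diff_Suc)
      show "(\<Prod>a<p. \<Prod>h<p ^ (m - 1 - k). ?V k ((u * p + a) * p ^ (m - 1 - k) + h)) =
          (\<Prod>h<p ^ (m - k). ?V k (u * p ^ (m - k) + h))"
        unfolding e prod_lessThan_mult by (simp add: algebra_simps)
    qed
    finally show ?thesis .
  qed
  have 1: "pairprod tau (p ^ Suc m) ?g =
      pairprod (\<lambda>a b. \<Prod>j<?s. \<Prod>i<?s. tau (?g (a * ?s + i)) (?g (b * ?s + j))) p (\<lambda>a. a) *
      (\<Prod>a<p. pairprod tau ?s (\<lambda>i. ?g (a * ?s + i)))"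
    unfolding power_Suc by (rule pairprod_mult)
  have 2: "(\<Prod>k<Suc m. \<Prod>h<p ^ (Suc m - 1 - k). ?V k (u * p ^ (Suc m - 1 - k) + h)) =
      ?V m u * (\<Prod>k<m. \<Prod>h<p ^ (m - k). ?V k (u * p ^ (m - k) + h))" by simp
  show ?case unfolding 1 2 by (rule cong_mult[OF top sub])
qed

text \<open>Regrouped by lines, each factor of the weight meets the Euler factor of the same line,
  and their product is \<open>\<kappa>\<close>.\<close>

lemma weight_euler:
  assumes \<kappa>: "\<And>y. \<lbrakk>inj_on y {..<p}; \<And>i. i < p \<Longrightarrow> 0 \<le> y i \<and> y i < P\<rbrakk> \<Longrightarrow>
      [pairprod diff (p - 1) (\<lambda>j. y (Suc j)) * pairprod diff p y = \<kappa>] (mod P)"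
    and c: "ruler B c" and x: "x \<in> path_families B" and v: "valid B x"
  shows "[weight B x * euler B (\<lambda>b g. g) (row_label c x) = (\<Prod>k<n. \<kappa> ^ num_lines B k)] (mod P)"
proof -
  let ?y = "\<lambda>k l d. x k (l * (p - 1) + d)"
  let ?V = "\<lambda>k l. pairprod diff p (?y k l)"
  have l_lt: "b * p ^ (n - 1 - k) + h < num_lines B k" if "b < B" "h < p ^ (n - 1 - k)" for b h k
  proof -
    have "b * p ^ (n - 1 - k) + h < Suc b * p ^ (n - 1 - k)" using that by simp
    also have "\<dots> \<le> B * p ^ (n - 1 - k)" by (rule mult_right_mono) (use that in auto)
    finally show ?thesis by (simp add: num_lines_def)
  qed
  have line: "coord B x b k (h * p + d) = ?y k (b * p ^ (n - 1 - k) + h) d" if "d < p" for b k h d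
    by (rule coord_line[OF that])
  have block: "[pairprod tau r (\<lambda>i. row_label c x (b * (r - 1) + i)) =
      (\<Prod>k<n. \<Prod>h<p ^ (n - 1 - k). ?V k (b * p ^ (n - 1 - k) + h))] (mod P)" if b: "b < B" for b
  proof -
    have "[pairprod tau (p ^ n) (\<lambda>i. row_label c x (b * (r - 1) + (0 * p ^ n + i))) =
      (\<Prod>k<n. \<Prod>h<p ^ (n - 1 - k). pairprod diff p (\<lambda>d. coord B x b k ((0 * p ^ (n - 1 - k) + h) * p + d)))] (mod P)"
    proof (rule pairprod_tau_digits)
      show "row_label c x (b * (r - 1) + i) k = coord B x b k (i div p ^ k)" if "i < r" "k < n" for i k
        by (rule row_label_ruler[OF c b that])
      show "inj_on (\<lambda>d. coord B x b k (h * p + d)) {..<p}" if "k < n" "h < p ^ (n - 1 - k)" for k h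
      proof -
        have "inj_on (?y k (b * p ^ (n - 1 - k) + h)) {..<p}"
          using v that(1) l_lt[OF b that(2)] unfolding valid_def by blast
        then show ?thesis using line by (simp add: inj_on_def)
      qed
    qed auto
    also have "(\<Prod>k<n. \<Prod>h<p ^ (n - 1 - k). pairprod diff p (\<lambda>d. coord B x b k ((0 * p ^ (n - 1 - k) + h) * p + d))) =
        (\<Prod>k<n. \<Prod>h<p ^ (n - 1 - k). ?V k (b * p ^ (n - 1 - k) + h))"
      by (intro prod.cong refl pairprod_cong) (simp add: line)
    finally show ?thesis by simp
  qed
  have "[euler B (\<lambda>b g. g) (row_label c x) =
      (\<Prod>b<B. \<Prod>k<n. \<Prod>h<p ^ (n - 1 - k). ?V k (b * p ^ (n - 1 - k) + h))] (mod P)"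
    unfolding euler_def by (intro cong_prod block) auto
  also have "(\<Prod>b<B. \<Prod>k<n. \<Prod>h<p ^ (n - 1 - k). ?V k (b * p ^ (n - 1 - k) + h)) =
      (\<Prod>k<n. \<Prod>b<B. \<Prod>h<p ^ (n - 1 - k). ?V k (b * p ^ (n - 1 - k) + h))" by (rule prod.swap)
  also have "\<dots> = (\<Prod>k<n. \<Prod>l<num_lines B k. ?V k l)" unfolding num_lines_def prod_lessThan_mult ..
  finally have "[weight B x * euler B (\<lambda>b g. g) (row_label c x) = weight B x * (\<Prod>k<n. \<Prod>l<num_lines B k. ?V k l)] (mod P)"
    by (rule cong_scalar_left)
  also have "weight B x * (\<Prod>k<n. \<Prod>l<num_lines B k. ?V k l) =
      (\<Prod>k<n. \<Prod>l<num_lines B k. pairprod diff (p - 1) (\<lambda>j. ?y k l (Suc j)) * ?V k l)"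
    by (simp only: weight_def lineprod_def prod.distrib)
  also have "[\<dots> = (\<Prod>k<n. \<Prod>l<num_lines B k. \<kappa>)] (mod P)"
  proof (intro cong_prod \<kappa>)
    fix k l assume kl: "k \<in> {..<n}" "l \<in> {..<num_lines B k}"
    then show "inj_on (?y k l) {..<p}" using v by (auto simp: valid_def)
    fix d assume "d < p"
    have "l * (p - 1) + d \<le> Suc l * (p - 1)" using \<open>d < p\<close> by simp
    also have "\<dots> \<le> num_lines B k * (p - 1)" by (rule mult_right_mono) (use kl in auto)
    finally show "0 \<le> ?y k l d \<and> ?y k l d < P" using path_familiesD(2)[OF x] kl by simp
  qed
  finally show ?thesis by simp
qed

lemma card_valid: "\<not> p dvd card {x \<in> path_families B. valid B x}"
proof -
  let ?Q = "\<lambda>k y. \<forall>l<num_lines B k. inj_on (\<lambda>d. y (l * (p - 1) + d)) {..<p}"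
  have "{x \<in> path_families B. valid B x} = PiE {..<n} (\<lambda>k. {y \<in> paths B k. ?Q k y})"
    by (auto simp: path_families_def valid_def PiE_iff extensional_def)
  then have "card {x \<in> path_families B. valid B x} = (\<Prod>k<n. card {y \<in> paths B k. ?Q k y})"
    by (simp add: card_PiE)
  moreover have "\<not> p dvd card {y \<in> paths B k. ?Q k y}" for k
  proof -
    have p1: "0 < p - 1" "p - 1 < p" using p_gt_1 by auto
    have "{y \<in> paths B k. ?Q k y} = {y \<in> {..num_lines B k * (p - 1)} \<rightarrow>\<^sub>E {0..<P}. y 0 = 0 \<and>
       (\<forall>i j l. l * (p - 1) \<le> i \<and> i < j \<and> j \<le> l * (p - 1) + (p - 1) \<and> j \<le> num_lines B k * (p - 1) \<longrightarrow> y i \<noteq> y j)}"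
      (is "?L = ?R")
    proof (intro Set.set_eqI iffI)
      fix y assume y: "y \<in> ?L"
      have "y i \<noteq> y j" if ij: "l * (p - 1) \<le> i" "i < j" "j \<le> l * (p - 1) + (p - 1)" "j \<le> num_lines B k * (p - 1)" for i j l
      proof
        assume "y i = y j"
        have "l * (p - 1) < num_lines B k * (p - 1)" using ij by linarith
        then have "l < num_lines B k" by simp
        then have inj: "inj_on (\<lambda>d. y (l * (p - 1) + d)) {..<p}" using y by blast
        have le: "i - l * (p - 1) < p" "j - l * (p - 1) < p" using ij p1 by linarith+
        have "l * (p - 1) + (i - l * (p - 1)) = i" "l * (p - 1) + (j - l * (p - 1)) = j" using ij by linarith+
        then have "y (l * (p - 1) + (i - l * (p - 1))) = y (l * (p - 1) + (j - l * (p - 1)))"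
          using \<open>y i = y j\<close> by (simp only:)
        then have "i - l * (p - 1) = j - l * (p - 1)" using inj_onD[OF inj] le by simp
        then show False using ij by linarith
      qed
      then show "y \<in> ?R" using y unfolding paths_def by blast
    next
      fix y assume y: "y \<in> ?R"
      have "inj_on (\<lambda>d. y (l * (p - 1) + d)) {..<p}" if l: "l < num_lines B k" for l
      proof (rule linorder_inj_onI)
        fix i j :: nat assume ij: "i < j" "j \<in> {..<p}"
        have "l * (p - 1) + j \<le> Suc l * (p - 1)" using ij by simp
        also have "\<dots> \<le> num_lines B k * (p - 1)" by (rule mult_right_mono) (use l in auto)
        finally have "l * (p - 1) \<le> l * (p - 1) + i \<and> l * (p - 1) + i < l * (p - 1) + j \<and>
          l * (p - 1) + j \<le> l * (p - 1) + (p - 1) \<and> l * (p - 1) + j \<le> num_lines B k * (p - 1)"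
          using ij by simp
        then show "y (l * (p - 1) + i) \<noteq> y (l * (p - 1) + j)" using y by blast
      qed auto
      then show "y \<in> ?L" using y unfolding paths_def by blast
    qed
    then show ?thesis using valid_paths_card[OF p1] by simp
  qed
  ultimately show ?thesis using prime_p by (auto simp: prime_dvd_prod_iff)
qed

text \<open>A nonzero term has distinct labels in every block, which forces the ruler word and valid
  paths. All these terms are congruent to one unit, and their number is prime to
  \<open>p\<close>.\<close>

proposition shuffle_pairing_euler:
  assumes n: "0 < n"
  shows "\<not> [shuffle_pairing B (euler B (\<lambda>b g. g)) = 0] (mod P)"
proof
  assume 0: "[shuffle_pairing B (euler B (\<lambda>b g. g)) = 0] (mod P)"
  obtain c where c: "c \<in> shuffle_words B" "ruler B c" using ruler_exists[OF n] .
  obtain \<kappa> where \<kappa>: "\<not> P dvd \<kappa>"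
    "\<And>y. \<lbrakk>inj_on y {..<p}; \<And>i. i < p \<Longrightarrow> 0 \<le> y i \<and> y i < P\<rbrakk> \<Longrightarrow>
      [pairprod diff (p - 1) (\<lambda>j. y (Suc j)) * pairprod diff p y = \<kappa>] (mod P)"
    using pairprod_line by blast
  let ?t = "\<lambda>c x. shuffle_sign B c * weight B x * euler B (\<lambda>b g. g) (row_label c x)"
  have inj: "inj_on (\<lambda>i. row_label c' x (b * (r - 1) + i)) {..<r}"
    if "?t c' x \<noteq> 0" "b < B" for c' x b
  proof -
    have "pairprod tau r (\<lambda>i. row_label c' x (b * (r - 1) + i)) \<noteq> 0"
      using that by (auto simp: euler_def)
    then show ?thesis by (rule pairprod_tau_inj)
  qed
  have other: "?t c' x = 0" if "c' \<in> shuffle_words B" "c' \<noteq> c" "x \<in> path_families B" for c' x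
    using ruler_of_inj[OF that(1,3) inj] ruler_unique[OF that(1) c(1) _ c(2)] that(2) by metis
  have invalid: "?t c x = 0" if "x \<in> path_families B" "\<not> valid B x" for x
    using valid_of_inj[OF c that(1) inj] that(2) by metis
  let ?X = "{x \<in> path_families B. valid B x}"
  have fin: "finite (path_families B)"
    unfolding path_families_def paths_def
    by (intro finite_PiE) (auto intro: finite_subset[OF _ finite_PiE[of "{.._}" "\<lambda>_. {0..<P}"]])
  have "shuffle_pairing B (euler B (\<lambda>b g. g)) = (\<Sum>c'\<in>{c}. \<Sum>x\<in>path_families B. ?t c' x)"
    unfolding shuffle_pairing_def
    by (rule sum.mono_neutral_right) (use finite_shuffle_words c(1) other in \<open>auto intro!: sum.neutral\<close>)
  also have "\<dots> = (\<Sum>x\<in>path_families B. ?t c x)" by simp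
  also have "\<dots> = (\<Sum>x\<in>?X. ?t c x)"
    by (rule sum.mono_neutral_right) (use fin invalid in auto)
  finally have L: "shuffle_pairing B (euler B (\<lambda>b g. g)) = (\<Sum>x\<in>?X. ?t c x)" .
  have "[(\<Sum>x\<in>?X. ?t c x) = (\<Sum>x\<in>?X. shuffle_sign B c * (\<Prod>k<n. \<kappa> ^ num_lines B k))] (mod P)"
    unfolding mult.assoc by (intro cong_sum cong_scalar_left weight_euler[OF \<kappa>(2) c(2)]) auto
  also have "(\<Sum>x\<in>?X. shuffle_sign B c * (\<Prod>k<n. \<kappa> ^ num_lines B k)) = int (card ?X) * (shuffle_sign B c * (\<Prod>k<n. \<kappa> ^ num_lines B k))" by simp
  finally have "P dvd int (card ?X) * (shuffle_sign B c * (\<Prod>k<n. \<kappa> ^ num_lines B k))"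
    using 0 unfolding L by (meson cong_0_iff cong_sym cong_trans)
  moreover have "\<not> P dvd int (card ?X)" using card_valid[of B] by (metis int_dvd_int_iff)
  moreover have "\<not> P dvd shuffle_sign B c"
  proof
    assume "P dvd shuffle_sign B c"
    then obtain z where "P dvd (case z of (i, j) \<Rightarrow> (if c j < c i then - 1 else 1 :: int))"
      unfolding shuffle_sign_def pairprod_def using prime_dvd_prod_iff[OF finite_pairs prime_P] by blast
    then show False using p_gt_1 by (auto split: prod.splits if_splits)
  qed
  moreover have "\<not> P dvd (\<Prod>k<n. \<kappa> ^ num_lines B k)"
    using \<kappa>(1) by (auto simp: prime_dvd_prod_iff[OF _ prime_P] dest: prime_dvd_power[OF prime_P])
  ultimately show False using prime_P by (simp add: prime_dvd_mult_iff)
qed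

end

section \<open>Labels on iterated subdivisions\<close>

text \<open>The linear extension of \<open>E\<close> to chains. As \<open>frag_extend\<close> takes
  values in a free abelian group, the integers are modelled by the group on the single generator
  \<open>()\<close>.\<close>

definition cochain :: "('b \<Rightarrow> int) \<Rightarrow> ('b \<Rightarrow>\<^sub>0 int) \<Rightarrow> int" where
  "cochain E c = Poly_Mapping.lookup (frag_extend (\<lambda>s. frag_cmul (E s) (frag_of ())) c) ()"

lemma cochain_0 [simp]: "cochain E 0 = 0"
  by (simp add: cochain_def)

lemma cochain_of [simp]: "cochain E (frag_of s) = E s"
  by (simp add: cochain_def)

lemma cochain_add: "cochain E (a + b) = cochain E a + cochain E b"
  by (simp add: cochain_def frag_extend_add lookup_add)

lemma cochain_diff: "cochain E (a - b) = cochain E a - cochain E b"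
  by (simp add: cochain_def frag_extend_diff lookup_minus)

lemma cochain_cmul: "cochain E (frag_cmul k a) = k * cochain E a"
  by (simp add: cochain_def frag_extend_cmul)

lemma cochain_sum: "finite I \<Longrightarrow> cochain E (\<Sum>i\<in>I. f i) = (\<Sum>i\<in>I. cochain E (f i))"
  by (induction I rule: finite_induct) (simp_all add: cochain_add)

lemma cochain_cong:
  assumes "\<And>s. s \<in> Poly_Mapping.keys c \<Longrightarrow> [E s = E' s] (mod m)"
  shows "[cochain E c = cochain E' c] (mod m)"
proof -
  have "Poly_Mapping.keys c \<subseteq> {s. [E s = E' s] (mod m)}" using assms by blast
  then show ?thesis
    by (induction c rule: frag_induction) (auto simp: cochain_diff intro: cong_diff)
qed

lemma cochain_eq:
  assumes "\<And>s. s \<in> Poly_Mapping.keys c \<Longrightarrow> E s = E' s"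
  shows "cochain E c = cochain E' c"
  using cochain_cong[of c E E' 0] assms by simp

lemma cochain_eq_0:
  assumes "\<And>s. s \<in> Poly_Mapping.keys c \<Longrightarrow> E s = 0"
  shows "cochain E c = 0"
proof -
  have "cochain E c = cochain (\<lambda>_. 0) c" by (rule cochain_eq) (rule assms)
  then show ?thesis by (simp add: cochain_def frag_extend_eq_0)
qed

lemma cochain_chain_map: "cochain E (chain_map q g c) = cochain (\<lambda>s. E (simplex_map q g s)) c"
proof -
  have "Poly_Mapping.keys c \<subseteq> UNIV" by simp
  then show ?thesis
    by (induction c rule: frag_induction) (simp_all add: cochain_diff chain_map_diff)
qed

lemma cochain_boundary:
  assumes "0 < q"
    and "\<And>s. s \<in> Poly_Mapping.keys c \<Longrightarrow> [(\<Sum>k\<le>q. (- 1) ^ k * E (singular_face q k s)) = 0] (mod m)"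
  shows "[cochain E (chain_boundary q c) = 0] (mod m)"
proof -
  have "Poly_Mapping.keys c \<subseteq> {s. [(\<Sum>k\<le>q. (- 1) ^ k * E (singular_face q k s)) = 0] (mod m)}"
    using assms by blast
  then show ?thesis
  proof (induction c rule: frag_induction)
    case (one s)
    then show ?case using assms(1) by (simp add: chain_boundary_of cochain_sum cochain_cmul)
  next
    case (diff a b)
    then have "[cochain E (chain_boundary q a) - cochain E (chain_boundary q b) = 0 - 0] (mod m)"
      by (intro cong_diff)
    then show ?case by (simp add: chain_boundary_diff cochain_diff)
  qed simp
qed

section \<open>Vertices and facets of the standard simplex\<close>

abbreviation simplex_top :: "nat \<Rightarrow> (nat \<Rightarrow> real) topology" where
  "simplex_top q \<equiv> subtopology (powertop_real UNIV) (standard_simplex q)"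

abbreviation id_simplex :: "nat \<Rightarrow> (nat \<Rightarrow> real) \<Rightarrow> nat \<Rightarrow> real" where
  "id_simplex q \<equiv> restrict id (standard_simplex q)"

abbreviation face_map :: "nat \<Rightarrow> nat \<Rightarrow> (nat \<Rightarrow> real) \<Rightarrow> nat \<Rightarrow> real" where
  "face_map q k \<equiv> singular_face q k (id_simplex q)"

definition vertex :: "nat \<Rightarrow> nat \<Rightarrow> real" where
  "vertex j = (\<lambda>i. if i = j then 1 else 0)"

lemma vertex_in_simplex: "vertex j \<in> standard_simplex q \<longleftrightarrow> j \<le> q"
  unfolding vertex_def by simp

text \<open>Translates singular faces into the deletions \<open>skip\<close> of the cochain
  calculus.\<close>

lemma face_vertex:
  assumes "j \<le> q"
  shows "singular_face (Suc q) k s (vertex j) = s (vertex (skip k j))"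
proof -
  have "simplical_face k (vertex j) = vertex (skip k j)"
    by (auto simp: simplical_face_def vertex_def skip_def fun_eq_iff)
  then show ?thesis using assms by (simp add: singular_face_def vertex_in_simplex)
qed

lemma id_simplicial: "simplicial_chain q (standard_simplex q) (frag_of (id_simplex q))"
  by simp

lemma id_singular: "singular_chain q (simplex_top q) (frag_of (id_simplex q))"
  by (rule simplicial_imp_singular_chain[OF id_simplicial])

lemma face_map_simplicial:
  "\<lbrakk>1 \<le> q; k \<le> q\<rbrakk> \<Longrightarrow> simplicial_simplex (q - Suc 0) (standard_simplex q) (face_map q k)"
  by (rule simplicial_simplex_singular_face) simp_all

lemma face_map_id:
  assumes "1 \<le> q" "k \<le> q"
  shows "frag_of (face_map q k) = chain_map (q - Suc 0) (face_map q k) (frag_of (id_simplex (q - Suc 0)))"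
  by (rule singular_simplex_chain_map_id[symmetric, where X = "simplex_top q"])
    (use face_map_simplicial[OF assms] in \<open>simp add: simplicial_simplex_def\<close>)

lemma face_map_in:
  assumes "1 \<le> q" "k \<le> q" "t \<in> standard_simplex (q - Suc 0)"
  shows "face_map q k t \<in> standard_simplex q" "face_map q k t k = 0"
proof -
  have in_q: "simplical_face k t \<in> standard_simplex q"
    by (rule simplical_face_in_standard_simplex) (use assms in auto)
  then show "face_map q k t \<in> standard_simplex q" using assms by (simp add: singular_face_def)
  show "face_map q k t k = 0" using assms in_q by (simp add: singular_face_def simplical_face_def)
qed

text \<open>The chain homotopy between iterated subdivision and the identity is natural on simplicial
  chains, so on each facet it is the image of one and the same chain \<open>z\<close>.\<close>

lemma iterated_subdivision_id:
  assumes q: "1 \<le> q"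
  shows "\<exists>y z. singular_chain (Suc q) (simplex_top q) y \<and> singular_chain q (simplex_top (q - Suc 0)) z \<and>
    (singular_subdivision q ^^ m) (frag_of (id_simplex q)) = frag_of (id_simplex q) +
      chain_boundary (Suc q) y + (\<Sum>k\<le>q. frag_cmul ((- 1) ^ k) (chain_map q (face_map q k) z))"
    (is "\<exists>y z. ?Q m y z")
proof -
  let ?i = "frag_of (id_simplex q)" and ?j = "frag_of (id_simplex (q - Suc 0))"
  define y1 where "y1 = subd q ?i"
  define z1 where "z1 = - subd (q - Suc 0) ?j"
  have y1: "singular_chain (Suc q) (simplex_top q) y1"
    unfolding y1_def
    by (rule simplicial_imp_singular_chain[OF chain_homotopic_simplicial_subdivision2[OF id_simplicial]])
  have z1: "singular_chain q (simplex_top (q - Suc 0)) z1"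
  proof -
    have "singular_chain (Suc (q - Suc 0)) (simplex_top (q - Suc 0)) (subd (q - Suc 0) ?j)"
      by (rule simplicial_imp_singular_chain[OF chain_homotopic_simplicial_subdivision2[OF id_simplicial]])
    then show ?thesis using q by (simp add: z1_def singular_chain_minus)
  qed
  have face: "subd (q - Suc 0) (frag_of (face_map q k)) = - chain_map q (face_map q k) z1" if "k \<le> q" for k
  proof -
    have "chain_map (Suc (q - Suc 0)) (face_map q k) (subd (q - Suc 0) ?j) =
        subd (q - Suc 0) (chain_map (q - Suc 0) (face_map q k) ?j)"
      by (rule chain_homotopic_simplicial_subdivision1[OF id_simplicial face_map_simplicial[OF q that]])
    then show ?thesis using face_map_id[OF q that] q by (simp add: z1_def chain_map_minus)
  qed
  have one: "singular_subdivision q ?i = ?i + chain_boundary (Suc q) y1 -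
      (\<Sum>k\<le>q. frag_cmul ((- 1) ^ k) (chain_map q (face_map q k) z1))"
  proof -
    have "subd (q - Suc 0) (chain_boundary q ?i) =
        (\<Sum>k\<le>q. frag_cmul ((- 1) ^ k) (subd (q - Suc 0) (frag_of (face_map q k))))"
      using q by (simp add: chain_boundary_of subd_power_sum subd_power_uminus)
    also have "\<dots> = (\<Sum>k\<le>q. frag_cmul ((- 1) ^ k) (- chain_map q (face_map q k) z1))"
      by (rule sum.cong) (simp_all only: atMost_iff face)
    also have "\<dots> = - (\<Sum>k\<le>q. frag_cmul ((- 1) ^ k) (chain_map q (face_map q k) z1))"
      unfolding sum_negf[symmetric] by (rule sum.cong) (simp_all flip: frag_cmul_minus_one)
    finally have "subd (q - Suc 0) (chain_boundary q ?i) = \<dots>" .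
    then show ?thesis
      using chain_homotopic_simplicial_subdivision3[OF id_simplicial, of q]
        singular_subdivision_simplicial_simplex[OF id_simplicial, of q]
      by (simp add: y1_def)
  qed
  have "frag_cmul a (c - d) = frag_cmul a c - frag_cmul a d" for a and c d :: "(nat \<Rightarrow> real) chain"
    by (rule poly_mapping_eqI) (simp add: lookup_minus right_diff_distrib)
  then have split: "(\<Sum>k\<le>q. frag_cmul ((- 1) ^ k) (chain_map q (face_map q k) (c - d))) =
      (\<Sum>k\<le>q. frag_cmul ((- 1) ^ k) (chain_map q (face_map q k) c)) -
      (\<Sum>k\<le>q. frag_cmul ((- 1) ^ k) (chain_map q (face_map q k) d))" for c d
    by (simp only: chain_map_diff sum_subtractf)
  have sd_cmul: "singular_subdivision q (frag_cmul a c) = frag_cmul a (singular_subdivision q c)" for a c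
    by (simp add: singular_subdivision_def frag_extend_cmul)
  have sd_sum: "singular_subdivision q (\<Sum>k\<le>q. f k) = (\<Sum>k\<le>q. singular_subdivision q (f k))" for f
    by (simp add: singular_subdivision_def frag_extend_sum)
  show ?thesis
  proof (induction m)
    case 0
    have "?Q 0 0 0" by simp
    then show ?case by blast
  next
    case (Suc m)
    then obtain y z where y: "singular_chain (Suc q) (simplex_top q) y"
      and z: "singular_chain q (simplex_top (q - Suc 0)) z"
      and eq: "(singular_subdivision q ^^ m) ?i = ?i + chain_boundary (Suc q) y +
        (\<Sum>k\<le>q. frag_cmul ((- 1) ^ k) (chain_map q (face_map q k) z))" by blast
    have "(singular_subdivision q ^^ Suc m) ?i = singular_subdivision q ?i +
        singular_subdivision q (chain_boundary (Suc q) y) +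
        (\<Sum>k\<le>q. frag_cmul ((- 1) ^ k) (singular_subdivision q (chain_map q (face_map q k) z)))"
      by (simp add: eq singular_subdivision_add sd_cmul sd_sum)
    also have "singular_subdivision q (chain_boundary (Suc q) y) =
        chain_boundary (Suc q) (singular_subdivision (Suc q) y)"
      using chain_boundary_singular_subdivision[OF y] by simp
    also have "(\<Sum>k\<le>q. frag_cmul ((- 1) ^ k) (singular_subdivision q (chain_map q (face_map q k) z))) =
        (\<Sum>k\<le>q. frag_cmul ((- 1) ^ k) (chain_map q (face_map q k) (singular_subdivision q z)))"
      by (simp only: naturality_singular_subdivision[OF z])
    finally have "(singular_subdivision q ^^ Suc m) ?i = ?i +
        chain_boundary (Suc q) (y1 + singular_subdivision (Suc q) y) +
        (\<Sum>k\<le>q. frag_cmul ((- 1) ^ k) (chain_map q (face_map q k) (singular_subdivision q z - z1)))"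
      unfolding one by (simp only: split chain_boundary_add algebra_simps)
    moreover have "singular_chain (Suc q) (simplex_top q) (y1 + singular_subdivision (Suc q) y)"
      by (intro singular_chain_add y1 singular_chain_singular_subdivision y)
    moreover have "singular_chain q (simplex_top (q - Suc 0)) (singular_subdivision q z - z1)"
      by (intro singular_chain_diff z1 singular_chain_singular_subdivision z)
    ultimately show ?case by blast
  qed
qed

lemma singular_simplex_vertex:
  assumes "singular_simplex q (simplex_top q') s" "j \<le> q"
  shows "s (vertex j) \<in> standard_simplex q'"
  using assms vertex_in_simplex[of j q] unfolding singular_simplex_def continuous_map_def by auto

context elementary_abelian
begin

lemma shuffle_pairing_sum: "shuffle_pairing B (\<lambda>A. \<Sum>i\<in>I. \<theta> i A) = (\<Sum>i\<in>I. shuffle_pairing B (\<theta> i))"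
proof -
  have "shuffle_pairing B (\<lambda>A. \<Sum>i\<in>I. \<theta> i A) =
      (\<Sum>c\<in>shuffle_words B. \<Sum>i\<in>I. \<Sum>x\<in>path_families B. shuffle_sign B c * weight B x * \<theta> i (row_label c x))"
    unfolding shuffle_pairing_def sum_distrib_left by (intro sum.cong refl sum.swap)
  also have "\<dots> = (\<Sum>i\<in>I. shuffle_pairing B (\<theta> i))" unfolding shuffle_pairing_def by (rule sum.swap)
  finally show ?thesis .
qed

lemma N_pos: "\<lbrakk>0 < n; 0 < B\<rbrakk> \<Longrightarrow> 0 < N B"
  using one_less_power[OF p_gt_1, of n] by (simp add: N_def)

text \<open>\<open>\<theta> i\<close> is the share of the facet opposite vertex \<open>i\<close> in
  an equivariant coboundary. The shuffle chain annihilates every such share modulo \<open>p\<close>,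
  but not the Euler cochain.\<close>

proposition euler_not_coboundary:
  assumes n: "0 < n" and B: "0 < B"
    and eq: "\<And>A. (\<And>j. j \<le> N B \<Longrightarrow> A j \<in> G) \<Longrightarrow>
      [euler B (\<lambda>b g. g) A = (\<Sum>i\<le>N B. \<theta> i A)] (mod P)"
    and loc: "\<And>i A A'. \<lbrakk>i \<le> N B; \<And>j. \<lbrakk>j \<le> N B; j \<noteq> i\<rbrakk> \<Longrightarrow> A j = A' j\<rbrakk> \<Longrightarrow> \<theta> i A = \<theta> i A'"
    and inv: "\<And>i u A. \<lbrakk>i \<le> N B; u \<in> G; \<And>j. j \<le> N B \<Longrightarrow> A j \<in> G\<rbrakk> \<Longrightarrow>
      [\<theta> i (\<lambda>j. add u (A j)) = \<theta> i A] (mod P)"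
  shows False
proof -
  have "[shuffle_pairing B (euler B (\<lambda>b g. g)) = shuffle_pairing B (\<lambda>A. \<Sum>i\<le>N B. \<theta> i A)] (mod P)"
    unfolding shuffle_pairing_def by (intro cong_sum cong_scalar_left eq row_label_in_G)
  moreover have "[shuffle_pairing B (\<theta> i) = 0] (mod P)" if "i \<in> {..N B}" for i
  proof (rule shuffle_pairing_cong_0[of i])
    show i: "i \<le> N B" using that by simp
    show "0 < N B" by (rule N_pos[OF n B])
    show "\<theta> i A = \<theta> i A'" if "\<And>j. \<lbrakk>j \<le> N B; j \<noteq> i\<rbrakk> \<Longrightarrow> A j = A' j" for A A'
      by (rule loc[OF i]) (rule that)
    show "[\<theta> i (\<lambda>j. add u (A j)) = \<theta> i A] (mod P)"
      if "u \<in> G" "\<And>j. j \<le> N B \<Longrightarrow> A j \<in> G" for u A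
      by (rule inv[OF i that(1)]) (rule that(2))
  qed
  then have "[(\<Sum>i\<le>N B. shuffle_pairing B (\<theta> i)) = (\<Sum>i\<le>N B. 0)] (mod P)" by (rule cong_sum)
  ultimately have "[shuffle_pairing B (euler B (\<lambda>b g. g)) = 0] (mod P)"
    unfolding shuffle_pairing_sum by (simp add: cong_trans)
  then show False using shuffle_pairing_euler[OF n] by blast
qed

lemma add_assoc: "add (add u v) g = add u (add v g)"
  by (auto simp: add_def fun_eq_iff mod_add_left_eq mod_add_right_eq add.assoc)

lemma add_surj:
  assumes "g \<in> G"
  obtains h where "h \<in> G" "add u h = g"
proof
  let ?h = "\<lambda>k\<in>{..<n}. (g k - u k) mod P"
  show "?h \<in> G" by (auto simp: G_def)
  show "add u ?h = g"
  proof (rule G_eqI[OF _ assms])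
    fix k assume "k < n"
    then show "add u ?h k = g k"
      using G_bounds[OF assms] by (simp add: add_def mod_add_right_eq)
  qed simp
qed

text \<open>A statement of Borsuk-Ulam type for the join of \<open>N B + 1\<close> copies of
  \<open>G\<close>: \<open>F A b g t\<close> is coordinate \<open>b\<close> of face \<open>g\<close>
  at the point \<open>t\<close> labelled by \<open>A\<close>. By \<open>loc\<close> the labels of
  vertices of weight \<open>0\<close> are irrelevant, as in a join. By \<open>vert\<close> vertex
  \<open>j\<close> gets the label \<open>A j\<close>, so that the undivided simplex returns the
  Euler cochain of \<open>A\<close> itself.\<close>

proposition equivariant_zero:
  fixes F :: "(nat \<Rightarrow> nat \<Rightarrow> int) \<Rightarrow> nat \<Rightarrow> (nat \<Rightarrow> int) \<Rightarrow> (nat \<Rightarrow> real) \<Rightarrow> real"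
  assumes n: "0 < n" and B: "0 < B"
    and cont: "\<And>A b g. \<lbrakk>\<And>j. j \<le> N B \<Longrightarrow> A j \<in> G; b < B; g \<in> G\<rbrakk> \<Longrightarrow>
      continuous_map (simplex_top (N B)) euclideanreal (F A b g)"
    and equiv: "\<And>A u b g t. \<lbrakk>\<And>j. j \<le> N B \<Longrightarrow> A j \<in> G; u \<in> G; b < B; g \<in> G; t \<in> standard_simplex (N B)\<rbrakk> \<Longrightarrow>
      F (\<lambda>j. add u (A j)) b (add u g) t = F A b g t"
    and loc: "\<And>A A' b g t. \<lbrakk>t \<in> standard_simplex (N B); \<And>j. \<lbrakk>j \<le> N B; t j \<noteq> 0\<rbrakk> \<Longrightarrow> A j = A' j\<rbrakk> \<Longrightarrow>
      F A b g t = F A' b g t"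
    and vert: "\<And>A j b h. \<lbrakk>\<And>j. j \<le> N B \<Longrightarrow> A j \<in> G; j \<le> N B; b < B; h \<in> G; h \<noteq> A j\<rbrakk> \<Longrightarrow>
      F A b h (vertex j) < F A b (A j) (vertex j)"
  shows "\<exists>A t. (\<forall>j\<le>N B. A j \<in> G) \<and> t \<in> standard_simplex (N B) \<and>
    (\<forall>b<B. \<forall>g\<in>G. \<forall>h\<in>G. F A b g t = F A b h t)"
proof (rule ccontr)
  assume neg: "\<not> ?thesis"
  let ?N = "N B"
  let ?S = "standard_simplex ?N"
  have N: "1 \<le> ?N" using N_pos[OF n B] by simp
  define low where "low = (\<lambda>t :: nat \<Rightarrow> real. LEAST j. t j \<noteq> 0)"
  define top where "top = (\<lambda>A b t g. \<forall>h\<in>G. F A b h t \<le> F A b g t)"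
  \<comment> \<open>Several labels may be maximal, and an arbitrary choice would not be equivariant.
    The choice is made relative to the label of the first vertex in the support of \<open>t\<close>,
    which moves along with the action and reads no label outside the support.\<close>
  define L where "L = (\<lambda>A b t. add (A (low t)) (SOME h. h \<in> G \<and> top A b t (add (A (low t)) h)))"
  have low: "t (low t) \<noteq> 0" "low t \<le> ?N" if "t \<in> ?S" for t
  proof -
    have "\<exists>j. t j \<noteq> 0"
    proof (rule ccontr)
      assume "\<nexists>j. t j \<noteq> 0"
      then show False using that by (simp add: standard_simplex_def)
    qed
    then show 1: "t (low t) \<noteq> 0" unfolding low_def by (rule LeastI_ex)
    show "low t \<le> ?N"
    proof (rule ccontr)
      assume "\<not> low t \<le> ?N"
      then show False using 1 that by (simp add: standard_simplex_def)
    qed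
  qed
  have L_G: "L A b t \<in> G" for A b t by (simp add: L_def)
  have L_top: "top A b t (L A b t)" for A b t
  proof -
    have "G \<noteq> {}" using add_in_G by blast
    then obtain g where g: "g \<in> G" "top A b t g"
      using obtains_MAX[OF finite_G, of "\<lambda>g. F A b g t"] unfolding top_def
      by (metis (no_types, lifting) Max_ge finite_G finite_imageI image_eqI)
    obtain h where "h \<in> G" "add (A (low t)) h = g" using add_surj[OF g(1)] .
    then have "\<exists>h. h \<in> G \<and> top A b t (add (A (low t)) h)" using g by blast
    from someI_ex[OF this] show ?thesis by (simp add: L_def)
  qed
  have L_loc: "L A b t = L A' b t" if "t \<in> ?S" "\<And>j. \<lbrakk>j \<le> ?N; t j \<noteq> 0\<rbrakk> \<Longrightarrow> A j = A' j" for A A' b t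
  proof -
    have "F A b g t = F A' b g t" for g by (rule loc[OF that])
    moreover have "A (low t) = A' (low t)" using low[OF that(1)] that(2) by blast
    ultimately show ?thesis by (simp add: L_def top_def)
  qed
  have L_equiv: "L (\<lambda>j. add u (A j)) b t = add u (L A b t)"
    if A: "\<And>j. j \<le> ?N \<Longrightarrow> A j \<in> G" and u: "u \<in> G" and b: "b < B" and t: "t \<in> ?S" for A u b t
  proof -
    have e: "F (\<lambda>j. add u (A j)) b (add u g) t = F A b g t" if "g \<in> G" for g
      by (rule equiv) (use A u b t that in auto)
    have "top (\<lambda>j. add u (A j)) b t (add u g) \<longleftrightarrow> top A b t g" if g: "g \<in> G" for g
    proof
      assume *: "top (\<lambda>j. add u (A j)) b t (add u g)"
      show "top A b t g" unfolding top_def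
      proof
        fix h assume h: "h \<in> G"
        have "F (\<lambda>j. add u (A j)) b (add u h) t \<le> F (\<lambda>j. add u (A j)) b (add u g) t"
          using * by (simp add: top_def)
        then show "F A b h t \<le> F A b g t" unfolding e[OF g] e[OF h] .
      qed
    next
      assume *: "top A b t g"
      show "top (\<lambda>j. add u (A j)) b t (add u g)" unfolding top_def
      proof
        fix h' assume "h' \<in> G"
        then obtain h where h: "h \<in> G" "h' = add u h" by (metis add_surj)
        have "F A b h t \<le> F A b g t" using * h(1) by (simp add: top_def)
        then show "F (\<lambda>j. add u (A j)) b h' t \<le> F (\<lambda>j. add u (A j)) b (add u g) t"
          unfolding h(2) e[OF g] e[OF h(1)] .
      qed
    qed
    then show ?thesis by (simp add: L_def add_assoc)
  qed
  have L_vert: "L A b (vertex j) = A j"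
    if A: "\<And>j. j \<le> ?N \<Longrightarrow> A j \<in> G" and "j \<le> ?N" "b < B" for A b j
  proof (rule ccontr)
    assume ne: "L A b (vertex j) \<noteq> A j"
    have "F A b (L A b (vertex j)) (vertex j) < F A b (A j) (vertex j)"
      by (rule vert[of A j b "L A b (vertex j)"]) (use A that(2,3) L_G ne in auto)
    moreover have "F A b (A j) (vertex j) \<le> F A b (L A b (vertex j)) (vertex j)"
      using L_top[of A b "vertex j"] A that(2) unfolding top_def by blast
    ultimately show False by simp
  qed
  define E where "E = (\<lambda>A (s :: (nat \<Rightarrow> real) \<Rightarrow> nat \<Rightarrow> real). euler B (L A) (\<lambda>j. s (vertex j)))"
  have small: "\<exists>m. \<forall>m'\<ge>m. \<forall>s\<in>Poly_Mapping.keys ((singular_subdivision ?N ^^ m') (frag_of (id_simplex ?N))). E A s = 0"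
    if A: "\<And>j. j \<le> ?N \<Longrightarrow> A j \<in> G" for A
  proof -
    \<comment> \<open>On \<open>W b g h\<close> the label \<open>g\<close> does not occur for
      coordinate \<open>b\<close>. These open sets cover the simplex by the assumption
      \<open>neg\<close>, and a simplex inside one of them has at most \<open>r - 1\<close>
      different labels on the \<open>r\<close> rows of block \<open>b\<close>.\<close>
    define W where "W = (\<lambda>b g h. {t \<in> ?S. F A b g t < F A b h t})"
    let ?\<C> = "{W b g h |b g h. b < B \<and> g \<in> G \<and> h \<in> G}"
    have opn: "openin (simplex_top ?N) U" if "U \<in> ?\<C>" for U
    proof -
      from that obtain b g h where bgh: "b < B" "g \<in> G" "h \<in> G" "U = W b g h" by blast
      have "continuous_map (simplex_top ?N) euclideanreal (\<lambda>t. F A b h t - F A b g t)"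
        by (intro continuous_map_diff cont A bgh)
      then have "openin (simplex_top ?N) {t \<in> topspace (simplex_top ?N). F A b h t - F A b g t \<in> {0<..}}"
        by (rule openin_continuous_map_preimage) simp
      then show ?thesis by (simp add: bgh(4) W_def)
    qed
    have cov: "topspace (simplex_top ?N) \<subseteq> \<Union>?\<C>"
    proof
      fix t assume "t \<in> topspace (simplex_top ?N)"
      then have t: "t \<in> ?S" by simp
      have "\<not> (\<forall>b<B. \<forall>g\<in>G. \<forall>h\<in>G. F A b g t = F A b h t)" using neg A t by blast
      then obtain b g h where bgh: "b < B" "g \<in> G" "h \<in> G" "F A b g t < F A b h t"
        by (metis linorder_neqE_linordered_idom)
      then have "t \<in> W b g h" using t by (simp add: W_def)
      then show "t \<in> \<Union>?\<C>" using bgh by blast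
    qed
    obtain m where m: "\<And>m' s. \<lbrakk>m \<le> m'; s \<in> Poly_Mapping.keys ((singular_subdivision ?N ^^ m') (frag_of (id_simplex ?N)))\<rbrakk>
        \<Longrightarrow> \<exists>V\<in>?\<C>. s \<in> standard_simplex ?N \<rightarrow> V"
      by (rule sufficient_iterated_singular_subdivision_exists[OF opn cov id_singular]) blast+
    have "E A s = 0" if s: "m \<le> m'" "s \<in> Poly_Mapping.keys ((singular_subdivision ?N ^^ m') (frag_of (id_simplex ?N)))" for m' s
    proof -
      obtain b g h where b: "b < B" and g: "g \<in> G" and h: "h \<in> G" and W: "s \<in> ?S \<rightarrow> W b g h"
        using m[OF s] by blast
      let ?x = "\<lambda>i. L A b (s (vertex (b * (r - 1) + i)))"
      have "?x ` {..<r} \<subseteq> G - {g}"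
      proof (rule image_subsetI)
        fix i assume "i \<in> {..<r}"
        then have "vertex (b * (r - 1) + i) \<in> ?S" using row_le_N[OF b] by (simp add: vertex_in_simplex)
        then have "s (vertex (b * (r - 1) + i)) \<in> W b g h" using W by blast
        then have "F A b g (s (vertex (b * (r - 1) + i))) < F A b (?x i) (s (vertex (b * (r - 1) + i)))"
          using L_top[of A b "s (vertex (b * (r - 1) + i))"] h unfolding W_def top_def by force
        then show "?x i \<in> G - {g}" using L_G by auto
      qed
      then have "card (?x ` {..<r}) \<le> card (G - {g})" by (intro card_mono) (simp_all add: finite_G)
      also have "\<dots> < card G" by (rule card_Diff1_less[OF finite_G g])
      finally have "card (?x ` {..<r}) < r" unfolding card_G .
      then have "\<not> inj_on ?x {..<r}" using card_image[of ?x "{..<r}"] by auto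
      then have "pairprod tau r ?x = 0" using pairprod_tau_inj by blast
      then show ?thesis using b unfolding E_def euler_def by (auto intro!: prod_zero)
    qed
    then show ?thesis by blast
  qed
  have E_loc: "E A s = E A' s"
    if "\<And>i. i \<le> ?N \<Longrightarrow> s (vertex i) \<in> ?S"
      "\<And>i j. \<lbrakk>i \<le> ?N; j \<le> ?N; s (vertex i) j \<noteq> 0\<rbrakk> \<Longrightarrow> A j = A' j" for A A' s
    unfolding E_def
  proof (rule euler_cong)
    fix i b assume "i \<le> B * (r - 1)" "b < B"
    then have i: "i \<le> ?N" by (simp add: N_def)
    show "L A b (s (vertex i)) = L A' b (s (vertex i))"
      by (rule L_loc[OF that(1)[OF i] that(2)[OF i]])
  qed
  \<comment> \<open>One \<open>m\<close> serves all labellings, since only their finitely many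
    restrictions to the vertices matter.\<close>
  have "\<exists>m. \<forall>A\<in>{..?N} \<rightarrow>\<^sub>E G. \<forall>s\<in>Poly_Mapping.keys ((singular_subdivision ?N ^^ m) (frag_of (id_simplex ?N))). E A s = 0"
  proof -
    have fin: "finite ({..?N} \<rightarrow>\<^sub>E G)" by (intro finite_PiE finite_G) auto
    have "\<forall>A\<in>{..?N} \<rightarrow>\<^sub>E G. \<exists>m. \<forall>m'\<ge>m. \<forall>s\<in>Poly_Mapping.keys ((singular_subdivision ?N ^^ m') (frag_of (id_simplex ?N))). E A s = 0"
      by (intro ballI small) auto
    then obtain mm where "\<forall>A\<in>{..?N} \<rightarrow>\<^sub>E G. \<forall>m'\<ge>mm A. \<forall>s\<in>Poly_Mapping.keys ((singular_subdivision ?N ^^ m') (frag_of (id_simplex ?N))). E A s = 0"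
      by metis
    moreover have "mm A \<le> Max (mm ` ({..?N} \<rightarrow>\<^sub>E G))" if "A \<in> {..?N} \<rightarrow>\<^sub>E G" for A
      using that fin by simp
    ultimately show ?thesis by blast
  qed
  then obtain m where m: "\<And>A s. \<lbrakk>A \<in> {..?N} \<rightarrow>\<^sub>E G; s \<in> Poly_Mapping.keys ((singular_subdivision ?N ^^ m) (frag_of (id_simplex ?N)))\<rbrakk> \<Longrightarrow> E A s = 0"
    by blast
  obtain y z where y: "singular_chain (Suc ?N) (simplex_top ?N) y"
    and z: "singular_chain ?N (simplex_top (?N - Suc 0)) z"
    and sd: "(singular_subdivision ?N ^^ m) (frag_of (id_simplex ?N)) = frag_of (id_simplex ?N) +
      chain_boundary (Suc ?N) y + (\<Sum>k\<le>?N. frag_cmul ((- 1) ^ k) (chain_map ?N (face_map ?N k) z))"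
    using iterated_subdivision_id[OF N, of m] by blast
  have sd_chain: "singular_chain ?N (simplex_top ?N) ((singular_subdivision ?N ^^ m) (frag_of (id_simplex ?N)))"
  proof (induction m)
    case 0
    show ?case using id_singular by (simp only: funpow_0)
  next
    case (Suc m)
    then show ?case by (simp only: funpow.simps comp_apply singular_chain_singular_subdivision)
  qed
  \<comment> \<open>The facet terms of the subdivision formula, moved to the other side. The image
    of face map \<open>i\<close> has \<open>i\<close>-th coordinate \<open>0\<close>, so the label
    of vertex \<open>i\<close> is not read.\<close>
  define \<theta> where "\<theta> = (\<lambda>i A. - ((- 1) ^ i * cochain (E A) (chain_map ?N (face_map ?N i) z)))"
  have z_vertex: "s (vertex j) \<in> standard_simplex (?N - Suc 0)" if "s \<in> Poly_Mapping.keys z" "j \<le> ?N" for s j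
    using z that unfolding singular_chain_def by (blast intro: singular_simplex_vertex)
  show False
  proof (rule euler_not_coboundary[OF n B, of \<theta>])
    fix A assume A: "\<And>j. j \<le> ?N \<Longrightarrow> A j \<in> G"
    have "cochain (E A) ((singular_subdivision ?N ^^ m) (frag_of (id_simplex ?N))) = 0"
    proof (rule cochain_eq_0)
      fix s assume s: "s \<in> Poly_Mapping.keys ((singular_subdivision ?N ^^ m) (frag_of (id_simplex ?N)))"
      then have "singular_simplex ?N (simplex_top ?N) s" using sd_chain by (auto simp: singular_chain_def)
      then have "E A s = E (restrict A {..?N}) s"
        by (intro E_loc) (auto intro: singular_simplex_vertex)
      also have "\<dots> = 0" by (rule m[OF _ s]) (use A in auto)
      finally show "E A s = 0" .
    qed
    moreover have "[cochain (E A) (chain_boundary (Suc ?N) y) = 0] (mod P)"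
    proof (rule cochain_boundary)
      fix s assume "s \<in> Poly_Mapping.keys y"
      have "E A (singular_face (Suc ?N) k s) = euler B (L A) ((\<lambda>j. s (vertex j)) \<circ> skip k)" for k
        unfolding E_def
      proof (rule euler_cong)
        fix i b assume "i \<le> B * (r - 1)"
        then have "i \<le> ?N" by (simp add: N_def)
        then show "L A b (singular_face (Suc ?N) k s (vertex i)) = L A b (((\<lambda>j. s (vertex j)) \<circ> skip k) i)"
          by (simp add: face_vertex)
      qed
      then show "[(\<Sum>k\<le>Suc ?N. (- 1) ^ k * E A (singular_face (Suc ?N) k s)) = 0] (mod P)"
        using euler_coboundary[of B "L A" "\<lambda>j. s (vertex j)"] L_G by (simp only: N_def)
    qed simp
    moreover have "E A (id_simplex ?N) = euler B (\<lambda>b g. g) A"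
      unfolding E_def
    proof (rule euler_cong)
      fix i b assume "i \<le> B * (r - 1)" "b < B"
      then have "i \<le> ?N" by (simp add: N_def)
      then show "L A b (id_simplex ?N (vertex i)) = A i"
        using L_vert[OF A _ \<open>b < B\<close>] by (simp add: vertex_in_simplex)
    qed
    moreover have "cochain (E A) ((singular_subdivision ?N ^^ m) (frag_of (id_simplex ?N))) =
        E A (id_simplex ?N) + cochain (E A) (chain_boundary (Suc ?N) y) - (\<Sum>i\<le>?N. \<theta> i A)"
      unfolding sd cochain_add cochain_of cochain_sum[OF finite_atMost] cochain_cmul \<theta>_def sum_negf
      by (rule diff_minus_eq_add[symmetric])
    ultimately have "euler B (\<lambda>b g. g) A - (\<Sum>i\<le>?N. \<theta> i A) = - cochain (E A) (chain_boundary (Suc ?N) y)"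
      and "P dvd cochain (E A) (chain_boundary (Suc ?N) y)" by (simp_all add: cong_0_iff)
    then show "[euler B (\<lambda>b g. g) A = (\<Sum>i\<le>?N. \<theta> i A)] (mod P)"
      by (simp only: cong_iff_dvd_diff dvd_minus_iff)
  next
    fix i A A' assume i: "i \<le> ?N" and eq: "\<And>j. \<lbrakk>j \<le> ?N; j \<noteq> i\<rbrakk> \<Longrightarrow> A j = (A' j :: nat \<Rightarrow> int)"
    have "cochain (E A) (chain_map ?N (face_map ?N i) z) = cochain (E A') (chain_map ?N (face_map ?N i) z)"
      unfolding cochain_chain_map
    proof (intro cochain_eq E_loc)
      fix s j assume s: "s \<in> Poly_Mapping.keys z" and j: "j \<le> ?N"
      have e: "simplex_map ?N (face_map ?N i) s (vertex j) = face_map ?N i (s (vertex j))"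
        using j by (simp add: simplex_map_def vertex_in_simplex)
      show "simplex_map ?N (face_map ?N i) s (vertex j) \<in> ?S"
        unfolding e by (rule face_map_in[OF N i z_vertex[OF s j]])
      show "A k = A' k" if "k \<le> ?N" "simplex_map ?N (face_map ?N i) s (vertex j) k \<noteq> 0" for k
        using eq that face_map_in(2)[OF N i z_vertex[OF s j]] unfolding e by metis
    qed
    then show "\<theta> i A = \<theta> i A'" by (simp add: \<theta>_def)
  next
    fix i u A assume i: "i \<le> ?N" and u: "u \<in> G" and A: "\<And>j. j \<le> ?N \<Longrightarrow> A j \<in> G"
    have "[cochain (E (\<lambda>j. add u (A j))) (chain_map ?N (face_map ?N i) z) =
        cochain (E A) (chain_map ?N (face_map ?N i) z)] (mod P)"
      unfolding cochain_chain_map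
    proof (rule cochain_cong)
      fix s assume s: "s \<in> Poly_Mapping.keys z"
      let ?s = "simplex_map ?N (face_map ?N i) s"
      have 1: "E (\<lambda>j. add u (A j)) ?s = euler B (\<lambda>b t. add u (L A b t)) (\<lambda>j. ?s (vertex j))"
        unfolding E_def
      proof (rule euler_cong)
        fix j b assume "j \<le> B * (r - 1)" and b: "b < B"
        then have j: "j \<le> ?N" by (simp add: N_def)
        have "?s (vertex j) = face_map ?N i (s (vertex j))"
          using j by (simp add: simplex_map_def vertex_in_simplex)
        then have t: "?s (vertex j) \<in> ?S" using face_map_in[OF N i z_vertex[OF s j]] by simp
        show "L (\<lambda>j. add u (A j)) b (?s (vertex j)) = add u (L A b (?s (vertex j)))"
          by (rule L_equiv) (use A u b t in auto)
      qed
      show "[E (\<lambda>j. add u (A j)) ?s = E A ?s] (mod P)"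
        unfolding 1 unfolding E_def by (rule euler_add) (rule L_G)
    qed
    then show "[\<theta> i (\<lambda>j. add u (A j)) = \<theta> i A] (mod P)"
      by (simp add: \<theta>_def cong_minus_minus_iff cong_scalar_left)
  qed
qed

end

section \<open>Tverberg partitions\<close>

lemma continuous_map_simplex_top:
  fixes g :: "(nat \<Rightarrow> real) \<Rightarrow> 'b::topological_space"
  shows "continuous_map (simplex_top q) euclidean g \<longleftrightarrow> continuous_on (standard_simplex q) g"
  by (simp add: euclidean_product_topology)

lemma continuous_on_coordinate: "continuous_on S (\<lambda>x :: nat \<Rightarrow> real. x i)"
  by (rule continuous_on_subset[OF continuous_on_product_coordinates]) simp

text \<open>The portion of \<open>t\<close> that falls to face \<open>g\<close>. It is left
  unnormalised because it may be zero.\<close>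

definition part :: "nat \<Rightarrow> (nat \<Rightarrow> 'a) \<Rightarrow> 'a \<Rightarrow> (nat \<Rightarrow> real) \<Rightarrow> nat \<Rightarrow> real" where
  "part q A g t = (\<lambda>i. if i \<le> q \<and> A i = g then t i else 0)"

definition mass :: "nat \<Rightarrow> (nat \<Rightarrow> real) \<Rightarrow> real" where
  "mass q z = (\<Sum>i\<le>q. z i)"

text \<open>A retraction of \<open>{z. 0 \<le> z i, mass q z \<le> 1}\<close> onto the simplex that is the radial
  projection where the mass is at least \<open>e\<close>; the mass that is missing otherwise goes to vertex \<open>0\<close>,
  which keeps it continuous at \<open>z = 0\<close>.\<close>

definition normalise :: "real \<Rightarrow> nat \<Rightarrow> (nat \<Rightarrow> real) \<Rightarrow> nat \<Rightarrow> real" where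
  "normalise e q z = (\<lambda>i. (if i \<le> q then z i / max (mass q z) e else 0) +
     (if i = 0 then 1 - mass q z / max (mass q z) e else 0))"

lemma continuous_on_part: "continuous_on S (\<lambda>t. part q A g t i)"
  unfolding part_def by (cases "i \<le> q \<and> A i = g") 
    (simp_all only: if_True if_False simp_thms continuous_on_coordinate continuous_on_const)

lemma continuous_on_mass_part: "continuous_on S (\<lambda>t. mass q (part q A g t))"
  unfolding mass_def by (intro continuous_on_sum continuous_on_part)

lemma continuous_on_normalise_part:
  assumes "0 < e"
  shows "continuous_on S (\<lambda>t. normalise e q (part q A g t))"
proof (rule continuous_on_coordinatewise_then_product)
  fix i
  have "max (mass q (part q A g t)) e \<noteq> 0" for t using assms by (simp add: max_def)
  then show "continuous_on S (\<lambda>t. normalise e q (part q A g t) i)"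
    unfolding normalise_def
    by (cases "i \<le> q"; cases "i = 0")
      (auto intro!: continuous_on_add continuous_on_diff continuous_on_divide continuous_on_max
        continuous_on_const continuous_on_part continuous_on_mass_part)
qed

lemma normalise_in_simplex:
  assumes e: "0 < e" and z: "\<And>i. 0 \<le> z i"
  shows "normalise e q z \<in> standard_simplex q"
proof -
  let ?m = "max (mass q z) e"
  have m: "0 < ?m" using e by (simp add: less_max_iff_disj)
  have le: "mass q z / ?m \<le> 1" using m by simp
  have nonneg: "0 \<le> normalise e q z i" for i
    using z[of i] m le by (simp add: normalise_def)
  have sum: "(\<Sum>i\<le>q. normalise e q z i) = 1"
  proof -
    have "(\<Sum>i\<le>q. if i \<le> q then z i / ?m else 0) = mass q z / ?m"
      by (simp add: mass_def sum_divide_distrib)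
    moreover have "(\<Sum>i\<le>q. if i = 0 then 1 - mass q z / ?m else 0) = 1 - mass q z / ?m"
      by (simp add: sum.delta)
    ultimately show ?thesis by (simp add: normalise_def sum.distrib)
  qed
  have zero: "normalise e q z i = 0" if "q < i" for i
    using that by (simp add: normalise_def)
  have "normalise e q z i \<le> 1" for i
  proof (cases "i \<le> q")
    case True
    then have "normalise e q z i \<le> (\<Sum>i\<le>q. normalise e q z i)"
      by (intro member_le_sum) (auto simp: nonneg)
    then show ?thesis by (simp add: sum)
  qed (simp add: zero)
  then show ?thesis using nonneg sum zero by (simp add: standard_simplex_def)
qed

lemma normalise_mass:
  assumes "mass q z = e" "0 < e"
  shows "normalise e q z = (\<lambda>i. if i \<le> q then z i / e else 0)"
  using assms by (auto simp: normalise_def fun_eq_iff)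

lemma mass_part_vertex:
  assumes "j \<le> q"
  shows "mass q (part q A g (vertex j)) = (if A j = g then 1 else 0)"
proof -
  have "mass q (part q A g (vertex j)) = (\<Sum>i\<le>q. if i = j then (if A j = g then 1 else 0) else 0)"
    unfolding mass_def part_def vertex_def by (intro sum.cong) auto
  then show ?thesis using assms by simp
qed

context elementary_abelian
begin

lemma add_inj:
  assumes "g \<in> G" "h \<in> G"
  shows "add u g = add u h \<longleftrightarrow> g = h"
proof
  assume "add u g = add u h"
  then show "g = h" by (intro G_eqI assms) (metis add_cancel[OF assms])
qed simp

text \<open>\<open>D\<close> functions take \<open>Suc D\<close> target coordinates, one of them for
  the masses; hence the dimension \<open>Suc D * (r - 1)\<close>.\<close>

proposition topological_tverberg:
  fixes \<phi> :: "nat \<Rightarrow> (nat \<Rightarrow> real) \<Rightarrow> real"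
  assumes n: "0 < n"
    and \<phi>: "\<And>b. b < D \<Longrightarrow> continuous_map (simplex_top (Suc D * (r - 1))) euclideanreal (\<phi> b)"
  shows "\<exists>x. (\<forall>g\<in>G. x g \<in> standard_simplex (Suc D * (r - 1))) \<and>
    (\<forall>g\<in>G. \<forall>h\<in>G. g \<noteq> h \<longrightarrow> (\<forall>i. x g i = 0 \<or> x h i = 0)) \<and>
    (\<forall>b<D. \<forall>g\<in>G. \<forall>h\<in>G. \<phi> b (x g) = \<phi> b (x h))"
proof -
  define q where "q = Suc D * (r - 1)"
  have q: "N (Suc D) = q" by (simp add: N_def q_def)
  define e where "e = 1 / real r"
  have e: "0 < e" by (simp add: e_def)
  define T :: "(nat \<Rightarrow> nat \<Rightarrow> int) \<Rightarrow> (nat \<Rightarrow> int) \<Rightarrow> (nat \<Rightarrow> real) \<Rightarrow> real"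
    where "T = (\<lambda>A g t. mass q (part q A g t))"
  \<comment> \<open>Coordinate \<open>0\<close> equalises the masses. In the others, the mass is
    multiplied by a positive number, so that at a vertex its own face has the only nonzero and hence
    largest value, whatever the sign of \<open>\<phi>\<close>. Once the masses agree, injectivity of
    \<open>exp\<close> gives back the values of \<open>\<phi>\<close>.\<close>
  define F :: "(nat \<Rightarrow> nat \<Rightarrow> int) \<Rightarrow> nat \<Rightarrow> (nat \<Rightarrow> int) \<Rightarrow> (nat \<Rightarrow> real) \<Rightarrow> real"
    where "F = (\<lambda>A b g t. if b = 0 then T A g t
    else T A g t * exp (\<phi> (b - 1) (normalise e q (part q A g t))))"
  have part_nonneg: "0 \<le> part q A g t i" if "t \<in> standard_simplex q" for A g t i
    using that by (simp add: part_def standard_simplex_def)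
  have "\<exists>A t. (\<forall>j\<le>N (Suc D). A j \<in> G) \<and> t \<in> standard_simplex (N (Suc D)) \<and>
    (\<forall>b<Suc D. \<forall>g\<in>G. \<forall>h\<in>G. F A b g t = F A b h t)"
  proof (unfold q, rule equivariant_zero[OF n, of "Suc D" F, unfolded q])
    fix A :: "nat \<Rightarrow> nat \<Rightarrow> int" and b g
    assume b: "b < Suc D"
    have T: "continuous_on (standard_simplex q) (T A g)"
      unfolding T_def by (rule continuous_on_mass_part)
    show "continuous_map (simplex_top q) euclideanreal (F A b g)"
    proof (cases "b = 0")
      case True
      then have "F A b g = T A g" by (simp add: F_def)
      then show ?thesis using T by (simp only: continuous_map_simplex_top)
    next
      case False
      then have b1: "b - 1 < D" using b by simp
      have \<phi>_cont: "continuous_on (standard_simplex q) (\<phi> (b - 1))"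
        using \<phi>[OF b1] unfolding q_def[symmetric] by (simp only: continuous_map_simplex_top)
      have sub: "(\<lambda>t. normalise e q (part q A g t)) ` standard_simplex q \<subseteq> standard_simplex q"
        by (intro image_subsetI normalise_in_simplex e part_nonneg)
      have "continuous_on (standard_simplex q) (\<lambda>t. \<phi> (b - 1) (normalise e q (part q A g t)))"
        by (rule continuous_on_compose2[OF \<phi>_cont continuous_on_normalise_part[OF e] sub])
      then have "continuous_on (standard_simplex q) (\<lambda>t. T A g t * exp (\<phi> (b - 1) (normalise e q (part q A g t))))"
        by (intro continuous_on_mult T continuous_on_exp)
      moreover have "F A b g = (\<lambda>t. T A g t * exp (\<phi> (b - 1) (normalise e q (part q A g t))))"
        using False by (simp add: F_def)
      ultimately show ?thesis by (simp only: continuous_map_simplex_top)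
    qed
  next
    fix A u b g t assume A: "\<And>j. j \<le> q \<Longrightarrow> A j \<in> G" and g: "g \<in> G"
    have "part q (\<lambda>j. add u (A j)) (add u g) t = part q A g t"
    proof
      show "part q (\<lambda>j. add u (A j)) (add u g) t i = part q A g t i" for i
      proof (cases "i \<le> q")
        case True
        show ?thesis unfolding part_def add_inj[OF A[OF True] g] ..
      qed (simp add: part_def)
    qed
    then show "F (\<lambda>j. add u (A j)) b (add u g) t = F A b g t" by (simp add: F_def T_def)
  next
    fix A A' :: "nat \<Rightarrow> nat \<Rightarrow> int" and b g and t :: "nat \<Rightarrow> real"
    assume "\<And>j. \<lbrakk>j \<le> q; t j \<noteq> 0\<rbrakk> \<Longrightarrow> A j = A' j"
    then have "part q A g t = part q A' g t" by (fastforce simp: part_def fun_eq_iff)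
    then show "F A b g t = F A' b g t" by (simp add: F_def T_def)
  next
    fix A :: "nat \<Rightarrow> nat \<Rightarrow> int" and j b h assume j: "j \<le> q" and h: "h \<noteq> A j"
    show "F A b h (vertex j) < F A b (A j) (vertex j)"
      using j h by (auto simp: F_def T_def mass_part_vertex)
  qed simp
  then obtain A t where A: "\<And>j. j \<le> q \<Longrightarrow> A j \<in> G" and t: "t \<in> standard_simplex q"
    and F: "\<And>b g h. \<lbrakk>b < Suc D; g \<in> G; h \<in> G\<rbrakk> \<Longrightarrow> F A b g t = F A b h t"
    unfolding q by blast
  \<comment> \<open>The \<open>r\<close> masses are equal and add up to \<open>1\<close>. Their
    common value \<open>e\<close> is the threshold from which on \<open>normalise\<close> is an
    exact rescaling.\<close>
  have T: "T A g t = e" if g: "g \<in> G" for g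
  proof -
    have "(\<Sum>h\<in>G. T A h t) = (\<Sum>i\<le>q. \<Sum>h\<in>G. part q A h t i)"
      unfolding T_def mass_def by (rule sum.swap)
    also have "\<dots> = (\<Sum>i\<le>q. t i)"
    proof (rule sum.cong[OF refl])
      fix i assume "i \<in> {..q}"
      then have "(\<Sum>h\<in>G. part q A h t i) = (\<Sum>h\<in>G. if A i = h then t i else 0)"
        by (simp add: part_def)
      also have "\<dots> = t i" using A finite_G \<open>i \<in> {..q}\<close> by simp
      finally show "(\<Sum>h\<in>G. part q A h t i) = t i" .
    qed
    also have "\<dots> = 1" using t by (simp add: standard_simplex_def)
    finally have "(\<Sum>h\<in>G. T A h t) = 1" .
    moreover have "T A h t = T A g t" if "h \<in> G" for h
      using F[OF zero_less_Suc that g] by (simp add: F_def)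
    then have "(\<Sum>h\<in>G. T A h t) = (\<Sum>h\<in>G. T A g t)" by (rule sum.cong[OF refl])
    ultimately have "real r * T A g t = 1" by (simp add: card_G)
    then show ?thesis unfolding e_def by (simp add: field_simps)
  qed
  define x where "x = (\<lambda>g. normalise e q (part q A g t))"
  have x_eq: "x g = (\<lambda>i. if i \<le> q then part q A g t i / e else 0)" if "g \<in> G" for g
    unfolding x_def by (rule normalise_mass[OF T[OF that, unfolded T_def] e])
  show ?thesis
    unfolding q_def[symmetric]
  proof (intro exI[of _ x] conjI ballI allI impI)
    show "x g \<in> standard_simplex q" for g
      unfolding x_def by (rule normalise_in_simplex[OF e part_nonneg[OF t]])
    show "x g i = 0 \<or> x h i = 0" if "g \<in> G" "h \<in> G" "g \<noteq> h" for g h i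
      using that by (simp add: x_eq part_def)
    show "\<phi> b (x g) = \<phi> b (x h)" if "b < D" "g \<in> G" "h \<in> G" for b g h
      using F[of "Suc b" g h] that T e by (simp add: F_def x_def)
  qed
qed

end

section \<open>Color constraints as real functions, and the colored theorem\<close>

lemma card_le_1_iff_products_0:
  fixes x :: "nat \<Rightarrow> real"
  assumes "finite S" and nonneg: "\<And>i. 0 \<le> x i"
  shows "(\<Sum>u\<in>S. \<Sum>v\<in>S - {u}. x u * x v) = 0 \<longleftrightarrow> card ({i. x i \<noteq> 0} \<inter> S) \<le> 1"
proof -
  have "(\<Sum>u\<in>S. \<Sum>v\<in>S - {u}. x u * x v) = 0 \<longleftrightarrow> (\<forall>u\<in>S. \<forall>v\<in>S - {u}. x u * x v = 0)"
    using assms by (simp add: sum_nonneg_eq_0_iff sum_nonneg)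
  also have "\<dots> \<longleftrightarrow> (\<forall>u\<in>{i. x i \<noteq> 0} \<inter> S. \<forall>v\<in>{i. x i \<noteq> 0} \<inter> S. u = v)" by auto
  also have "\<dots> \<longleftrightarrow> card ({i. x i \<noteq> 0} \<inter> S) \<le> 1"
    using assms(1) by (simp add: card_le_Suc0_iff_eq)
  finally show ?thesis .
qed

theorem theorem4p12:
  fixes d r k N :: nat
    and f :: "(nat \<Rightarrow> real) \<Rightarrow> (nat \<Rightarrow> real)"
    and C :: "nat \<Rightarrow> nat set"
  assumes "d \<ge> 1"
    and "primepow r"
    and "int k \<ge> \<lceil>real d * ((real r - 1) / real r)\<rceil> + 1"
    and "N = (d + k + 1) * (r - 1)"
    and "continuous_map (subtopology (powertop_real UNIV) (standard_simplex N))
           (Euclidean_space d) f"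
    and "coloring {..N} k C"
    and "\<forall>i\<in>{1..k}. card (C i) \<le> 2 * r - 1"
  shows "\<exists>\<sigma> :: nat \<Rightarrow> nat set.
           (\<forall>j\<in>{1..r}. \<sigma> j \<noteq> {} \<and> \<sigma> j \<subseteq> {..N} \<and> rainbow k C (\<sigma> j)) \<and>
           disjoint_family_on \<sigma> {1..r} \<and>
           (\<Inter>j\<in>{1..r}. f ` simplex_face N (\<sigma> j)) \<noteq> {}"
proof -
  obtain p n where p: "prime p" and n: "0 < n" and r: "r = p ^ n"
    using assms(2) by (auto simp: primepow_def)
  interpret elementary_abelian p n by unfold_locales (rule p)
  have r0: "0 < r" using r by simp
  have Nq: "N = Suc (d + k) * (p ^ n - 1)" using assms(4) r by simp
  \<comment> \<open>The indices below \<open>d\<close> are the coordinates of \<open>f\<close>.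
    Index \<open>b\<close> from \<open>d\<close> on is the constraint for color
    \<open>b - d + 1\<close>, since colors are counted from \<open>1\<close>.\<close>
  define \<phi> where "\<phi> = (\<lambda>b x. if b < d then f x b
    else (\<Sum>u\<in>C (b - d + 1). \<Sum>v\<in>C (b - d + 1) - {u}. x u * x v))"
  have f_cont: "continuous_map (simplex_top N) euclideanreal (\<lambda>x. f x b)" for b
    using assms(5) unfolding Euclidean_space_def continuous_map_in_subtopology continuous_map_componentwise_UNIV
    by blast
  have \<phi>: "continuous_map (simplex_top N) euclideanreal (\<phi> b)" for b
  proof (cases "b < d")
    case True
    then show ?thesis using f_cont by (simp add: \<phi>_def)
  next
    case False
    then have "\<phi> b = (\<lambda>x. \<Sum>u\<in>C (b - d + 1). \<Sum>v\<in>C (b - d + 1) - {u}. x u * x v)"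
      by (simp add: \<phi>_def)
    moreover have "continuous_on (standard_simplex N) (\<lambda>x. \<Sum>u\<in>C (b - d + 1). \<Sum>v\<in>C (b - d + 1) - {u}. x u * x v)"
      by (intro continuous_on_sum continuous_on_mult continuous_on_coordinate)
    ultimately show ?thesis by (simp only: continuous_map_simplex_top)
  qed
  obtain x where X: "(\<forall>g\<in>G. x g \<in> standard_simplex N) \<and>
    (\<forall>g\<in>G. \<forall>h\<in>G. g \<noteq> h \<longrightarrow> (\<forall>i. x g i = 0 \<or> x h i = 0)) \<and>
    (\<forall>b<d + k. \<forall>g\<in>G. \<forall>h\<in>G. \<phi> b (x g) = \<phi> b (x h))"
    using topological_tverberg[OF n, of "d + k" \<phi>, folded Nq, OF \<phi>] by (rule exE) (erule that)
  have x: "x g \<in> standard_simplex N" if "g \<in> G" for g using X that by blast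
  have disj: "x g i = 0 \<or> x h i = 0" if "g \<in> G" "h \<in> G" "g \<noteq> h" for g h i using X that by blast
  have eq: "\<phi> b (x g) = \<phi> b (x h)" if "b < d + k" "g \<in> G" "h \<in> G" for b g h using X that by blast
  \<comment> \<open>Renumbers the faces, indexed by \<open>G\<close> so far, by
    \<open>{1..r}\<close>.\<close>
  obtain e where e: "bij_betw e {1..r} G"
    using finite_same_card_bij[of "{1..r}" G] finite_G card_G r by auto
  have eG: "e j \<in> G" if "j \<in> {1..r}" for j using e that by (auto simp: bij_betw_def)
  have e_inj: "e i \<noteq> e j" if "i \<in> {1..r}" "j \<in> {1..r}" "i \<noteq> j" for i j
    using inj_on_eq_iff[OF bij_betw_imp_inj_on[OF e]] that by simp
  define \<sigma> where "\<sigma> = (\<lambda>j. {i. x (e j) i \<noteq> 0})"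
  have nonneg: "0 \<le> x (e j) i" if "j \<in> {1..r}" for i j
    using x[OF eG[OF that]] by (simp add: standard_simplex_def)
  have sub: "\<sigma> j \<subseteq> {..N}" if "j \<in> {1..r}" for j
    using x[OF eG[OF that]] by (auto simp: \<sigma>_def standard_simplex_def intro: leI)
  have ne: "\<sigma> j \<noteq> {}" if "j \<in> {1..r}" for j
  proof
    assume "\<sigma> j = {}"
    then have "x (e j) i = 0" for i by (auto simp: \<sigma>_def)
    then show False using x[OF eG[OF that]] by (simp add: standard_simplex_def)
  qed
  have dis: "disjoint_family_on \<sigma> {1..r}"
    unfolding disjoint_family_on_def \<sigma>_def using disj eG e_inj by blast
  have face: "x (e j) \<in> simplex_face N (\<sigma> j)" if "j \<in> {1..r}" for j
    using x[OF eG[OF that]] by (simp add: simplex_face_def \<sigma>_def)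
  have C: "C i \<subseteq> {..N}" if "i \<in> {1..k}" for i using assms(6) that by (auto simp: coloring_def)
  have rain: "rainbow k C (\<sigma> j)" if j: "j \<in> {1..r}" for j
    unfolding rainbow_def
  proof
    fix i assume i: "i \<in> {1..k}"
    have fin: "finite (C i)" using C[OF i] finite_subset by blast
    define b where "b = d + (i - 1)"
    have b: "b < d + k" "\<not> b < d" "b - d + 1 = i" using i by (auto simp: b_def)
    have \<phi>b: "\<phi> b y = (\<Sum>u\<in>C i. \<Sum>v\<in>C i - {u}. y u * y v)" for y
      using b by (simp add: \<phi>_def)
    have iff: "\<phi> b (x (e j)) = 0 \<longleftrightarrow> card (\<sigma> j \<inter> C i) \<le> 1" if "j \<in> {1..r}" for j
      unfolding \<phi>b \<sigma>_def by (rule card_le_1_iff_products_0[OF fin nonneg[OF that]])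
    have "\<exists>j0\<in>{1..r}. card (\<sigma> j0 \<inter> C i) \<le> 1"
    proof (rule ccontr)
      assume neg: "\<not> ?thesis"
      have "2 * r = (\<Sum>j\<in>{1..r}. 2)" by simp
      also have "\<dots> \<le> (\<Sum>j\<in>{1..r}. card (\<sigma> j \<inter> C i))"
        by (rule sum_mono) (use neg in force)
      also have "\<dots> = card (\<Union>j\<in>{1..r}. \<sigma> j \<inter> C i)"
        by (rule card_UN_disjoint[symmetric])
          (use fin dis in \<open>auto simp: disjoint_family_on_def\<close>)
      also have "\<dots> \<le> card (C i)" by (rule card_mono[OF fin]) auto
      also have "\<dots> \<le> 2 * r - 1" using assms(7) i by blast
      finally show False using r0 by simp
    qed
    then obtain j0 where j0: "j0 \<in> {1..r}" "card (\<sigma> j0 \<inter> C i) \<le> 1" by blast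
    then have "\<phi> b (x (e j)) = 0" using iff[OF j0(1)] eq[OF b(1) eG[OF j] eG[OF j0(1)]] by simp
    then show "card (\<sigma> j \<inter> C i) \<le> 1" using iff[OF j] by simp
  qed
  have one: "1 \<in> {1..r}" using r0 by simp
  have f_eq: "f (x (e j)) = f (x (e 1))" if j: "j \<in> {1..r}" for j
  proof
    fix b
    show "f (x (e j)) b = f (x (e 1)) b"
    proof (cases "b < d")
      case True
      then show ?thesis using eq[of b "e j" "e 1"] eG[OF j] eG[OF one] by (simp add: \<phi>_def)
    next
      case False
      have "f y b = 0" if "y \<in> standard_simplex N" for y
      proof -
        have "f \<in> topspace (simplex_top N) \<rightarrow> topspace (Euclidean_space d)"
          using assms(5) unfolding continuous_map_def by blast
        then have "f y \<in> topspace (Euclidean_space d)" by (rule Pi_mem) (use that in simp)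
        then show ?thesis using False by (simp add: topspace_Euclidean_space)
      qed
      then show ?thesis using x eG[OF j] eG[OF one] by simp
    qed
  qed
  have common: "f (x (e 1)) \<in> (\<Inter>j\<in>{1..r}. f ` simplex_face N (\<sigma> j))"
  proof (rule INT_I)
    fix j assume "j \<in> {1..r}"
    then show "f (x (e 1)) \<in> f ` simplex_face N (\<sigma> j)"
      using imageI[OF face, of j f] f_eq[of j] by simp
  qed
  show ?thesis
  proof (intro exI[of _ \<sigma>] conjI ballI dis)
    show "\<sigma> j \<noteq> {}" "\<sigma> j \<subseteq> {..N}" "rainbow k C (\<sigma> j)" if "j \<in> {1..r}" for j
      by (rule ne[OF that], rule sub[OF that], rule rain[OF that])
    show "(\<Inter>j\<in>{1..r}. f ` simplex_face N (\<sigma> j)) \<noteq> {}" using common by (metis empty_iff)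
  qed
qed

end
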